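(* Suppose that $X=(p_n)_{n=1}^\infty$ is a strictly increasing sequence of positive numbers satisfying $\lim_{n\to\infty} \frac{p_n}{n^2}=\pi^2$, let $\nu>-1$, and for every $R>0$ write $N(R)$ for the number of points in $X\cap[0,R]$. For $R>0$ let $\bar w_{X,\nu,R}$ be the weight on $[0,R]$ given by $$\bar w_{X,\nu,R}(t)=t^\nu\prod_{p_n>R}\Big(1-\frac{t}{p_n}\Big)^2,\qquad t\in[0,R].$$ Then the normalized Christoffel-Darboux kernels associated to the weights $\bar w_{X,\nu,R}$ satisfy $$\lim_{R\to\infty}K_{N(R)}(x,y;\bar w_{X,\nu,R})=J_\nu(x,y),\qquad (x,y)\in(0,\infty)^2,$$ uniformly on compact subsets of $(0,\infty)^2$, where $J_\nu(x,y)$ is the Bessel kernel with parameter $\nu$.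
   Context: For a weight $w$ on a compact interval $[a,b]$, let $(\varphi_j(\cdot;w))_{j\ge0}$ be the orthonormal polynomials with positive leading coefficients: $\deg\varphi_j=j$ and $\int_a^b\varphi_i(t;w)\varphi_j(t;w)w(t)\,dt=\delta_{i,j}$. The normalized Christoffel-Darboux kernel is $$K_n(x,y;w)=\sqrt{w(x)w(y)}\sum_{i=0}^{n-1}\varphi_i(x;w)\varphi_i(y;w),\qquad x,y\in[a,b].$$ The Bessel kernel with parameter $\nu>-1$ is $$J_\nu(x,y)=\frac{J_\nu(\sqrt x)\sqrt y\,J_\nu'(\sqrt y)-J_\nu(\sqrt y)\sqrt x\,J_\nu'(\sqrt x)}{2(x-y)},\qquad x,y\in(0,\infty),$$ where on the right-hand side $J_\nu$ (with one argument) is the Bessel function of the first kind of order $\nu$, and the value for $x=y$ is defined by continuity. *)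

theory Defs
  imports "HOL-Analysis.Analysis" "HOL-Computational_Algebra.Polynomial"
begin

text \<open>The defining conditions of the orthonormal polynomials of a weight. For a weight that is
  positive almost everywhere and has finite moments, exactly one sequence satisfies them, so that
  the definite description in \<open>orthonormal_poly\<close> is proper.\<close>

definition is_orthonormal_polys ::
    "real \<Rightarrow> real \<Rightarrow> (real \<Rightarrow> real) \<Rightarrow> (nat \<Rightarrow> real poly) \<Rightarrow> bool" where
  "is_orthonormal_polys a b w \<phi> \<longleftrightarrow>
     (\<forall>j. degree (\<phi> j) = j \<and> lead_coeff (\<phi> j) > 0) \<and>
     (\<forall>i j. (LBINT t:{a..b}. poly (\<phi> i) t * poly (\<phi> j) t * w t) = (if i = j then 1 else 0))"

definition orthonormal_poly :: "real \<Rightarrow> real \<Rightarrow> (real \<Rightarrow> real) \<Rightarrow> nat \<Rightarrow> real poly" where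
  "orthonormal_poly a b w = (THE \<phi>. is_orthonormal_polys a b w \<phi>)"

definition CD_kernel ::
    "real \<Rightarrow> real \<Rightarrow> (real \<Rightarrow> real) \<Rightarrow> nat \<Rightarrow> real \<Rightarrow> real \<Rightarrow> real" where
  "CD_kernel a b w n x y =
     sqrt (w x * w y) *
     (\<Sum>i<n. poly (orthonormal_poly a b w i) x * poly (orthonormal_poly a b w i) y)"

text \<open>Bessel function of the first kind on the positive half-line; \<open>rGamma\<close> is the
  reciprocal Gamma function.\<close>

definition Bessel_J :: "real \<Rightarrow> real \<Rightarrow> real" where
  "Bessel_J \<nu> x =
     (\<Sum>k. (-1) ^ k * rGamma (real k + \<nu> + 1) / fact k * (x / 2) powr (2 * real k + \<nu>))"

definition Bessel_kernel_offdiag :: "real \<Rightarrow> real \<Rightarrow> real \<Rightarrow> real" where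
  "Bessel_kernel_offdiag \<nu> x y =
     (Bessel_J \<nu> (sqrt x) * sqrt y * deriv (Bessel_J \<nu>) (sqrt y)
        - Bessel_J \<nu> (sqrt y) * sqrt x * deriv (Bessel_J \<nu>) (sqrt x)) / (2 * (x - y))"

text \<open>On the diagonal, the value is the joint limit through off-diagonal points of the open
  quadrant.\<close>

definition Bessel_kernel :: "real \<Rightarrow> real \<Rightarrow> real \<Rightarrow> real" where
  "Bessel_kernel \<nu> x y =
     (if x \<noteq> y then Bessel_kernel_offdiag \<nu> x y
      else Lim (at (x, x) within {(s, t). 0 < s \<and> 0 < t \<and> s \<noteq> t})
             (\<lambda>(s, t). Bessel_kernel_offdiag \<nu> s t))"

text \<open>Sequences \<open>p\<close> are indexed from 1 in what follows; the value \<open>p 0\<close> is never used.\<close>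

definition count_upto :: "(nat \<Rightarrow> real) \<Rightarrow> real \<Rightarrow> nat" where
  "count_upto p R = card (p ` {1..} \<inter> {0..R})"

text \<open>Since \<open>0 powr \<nu> = 0\<close>, this weight vanishes at \<open>t = 0\<close> for every \<open>\<nu>\<close>. The value at that single
  point affects neither the orthonormal polynomials nor the kernel at positive arguments.\<close>

definition tail_weight :: "(nat \<Rightarrow> real) \<Rightarrow> real \<Rightarrow> real \<Rightarrow> real \<Rightarrow> real" where
  "tail_weight p \<nu> R t =
     t powr \<nu> * (\<Prod>n. if 1 \<le> n \<and> p n > R then (1 - t / p n)\<^sup>2 else 1)"

end

theory Submission
  imports Defs "HOL-Real_Asymp.Real_Asymp"
begin

text \<open>
  Write \<open>N = N(R)\<close>, and let \<open>P\<close> be the product of the factors \<open>1 - t / p n\<close> with \<open>p n > R\<close>. The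
  kernel is, up to the factor \<open>(x y)\<close> to the power \<open>\<nu> / 2\<close>, the reproducing kernel of the functions
  \<open>q P\<close>, \<open>degree q < N\<close>, in the weighted \<open>L\<^sup>2([0, R])\<close> space with weight \<open>t powr \<nu>\<close>. It is squeezed
  between kernels of the explicitly known Jacobi polynomials for the weight \<open>t powr \<nu>\<close> on \<open>[0, S]\<close>,
  where \<open>S = 4 M\<^sup>2 c\<^sup>2\<close>, \<open>M\<close> is a large multiple of \<open>N\<close>, and \<open>c\<close> is close to 1; their scaling limit
  is a Bessel kernel dilated by \<open>c\<^sup>2\<close>.

  The Chebyshev nodes \<open>z k\<close> of \<open>[0, S]\<close> satisfy \<open>z k \<approx> c\<^sup>2 \<pi>\<^sup>2 k\<^sup>2\<close> for \<open>k\<close> small against \<open>M\<close>. Comparing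
  factor by factor, \<open>P\<close> dominates (for \<open>c < 1\<close>) or is dominated by (for \<open>c > 1\<close>) a polynomial \<open>h\<close> whose
  zeros are nodes beyond \<open>N\<close>; the factors beyond \<open>M\<close> cost less than is gained between \<open>N\<close> and a multiple
  of \<open>N\<close>. A polynomial \<open>q h\<close> is determined by its values at about \<open>N\<close> nodes, and the Lagrange
  polynomials at Chebyshev nodes are bounded, so \<open>q h\<close> grows at most polynomially in \<open>N\<close> outside
  \<open>[0, R]\<close>. Multiplication by \<open>(1 - t / S) ^ d\<close> with \<open>d\<close> about \<open>sqrt N\<close> makes that part negligible
  without changing anything near the origin. For \<open>c < 1\<close> this turns \<open>q P\<close> into a polynomial and bounds
  the kernel on the diagonal from above; for \<open>c > 1\<close> it turns the Jacobi kernel into a nearly optimal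
  competitor \<open>q P\<close>. Together, and after letting \<open>c\<close> tend to 1, the bounds determine the limit off the
  diagonal too, because the difference of a reproducing kernel and a nearly optimal competitor is small.
\<close>

section \<open>Orthonormal polynomials\<close>

text \<open>The hypothesis locates \<open>p n\<close> only up to a factor tending to 1, so a
  comparison with the squares k^2 needs a margin; that is what the dilation \<open>c\<close>, later
  \<open>\<theta> ^ 3\<close> or \<open>(1 / \<theta>) ^ 3\<close>, provides. The margin also pays
  for factors left without a partner: their total cost is of order t / M, while the margin earns a
  fixed multiple of t / N, so a ratio of \<open>M\<close> to \<open>N\<close> depending on
  \<open>\<theta>\<close> alone is enough. The exponent \<open>d\<close> must outgrow every multiple
  of log N, so that exponential decay in \<open>d\<close> beats the polynomial growth, and must be
  o(N), so that spending \<open>d\<close> degrees leaves the scaling limit alone; sqrt N satisfies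
  both. The nodes are Chebyshev nodes for every \<open>\<nu>\<close>: the power
  \<open>t powr \<nu>\<close> is common to both sides and only the product is replaced, so all that
  is asked of the nodes is quadratic spacing near 0 and bounded Lagrange polynomials. The two sides
  are not symmetric: one inequality comes from the extremal property of the kernel on the diagonal,
  while the other needs a competitor, and the same competitor then settles the values off the
  diagonal.\<close>

locale poly_inner =
  fixes ip :: "real poly \<Rightarrow> real poly \<Rightarrow> real"
  assumes ip_add: "ip (p + q) r = ip p r + ip q r"
    and ip_smult: "ip (smult a p) r = a * ip p r"
    and ip_commute: "ip p q = ip q p"
    and ip_pos: "p \<noteq> 0 \<Longrightarrow> ip p p > 0"
begin

lemma ip_zero [simp]: "ip 0 r = 0"
  using ip_smult[of 0 0 r] by simp

lemma ip_diff: "ip (p - q) r = ip p r - ip q r"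
  using ip_add[of "p - q" q r] by simp

lemma ip_diff_right: "ip r (p - q) = ip r p - ip r q"
  and ip_smult_right: "ip r (smult a p) = a * ip r p"
  by (metis ip_commute ip_diff ip_smult)+

lemma ip_sum: "ip (\<Sum>i\<in>A. f i) r = (\<Sum>i\<in>A. ip (f i) r)"
  by (induction A rule: infinite_finite_induct) (auto simp: ip_add)

lemma ip_nonneg: "ip p p \<ge> 0"
  using ip_pos[of p] by (cases "p = 0") auto

text \<open>The sign of the leading coefficient is left open, so that the definition also covers the
  Jacobi polynomials \<open>jac_on\<close>, whose leading coefficients alternate in sign. Kernels do
  not see the sign.\<close>

definition orthonormal_upto :: "nat \<Rightarrow> (nat \<Rightarrow> real poly) \<Rightarrow> bool" where
  "orthonormal_upto n \<phi> \<longleftrightarrow> (\<forall>j<n. degree (\<phi> j) = j) \<and>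
     (\<forall>i<n. \<forall>j<n. ip (\<phi> i) (\<phi> j) = (if i = j then 1 else 0))"

lemma orthonormal_sum:
  assumes "orthonormal_upto n \<phi>" "j < n"
  shows "(\<Sum>i<n. c i * ip (\<phi> i) (\<phi> j)) = c j"
proof -
  have "(\<Sum>i<n. c i * ip (\<phi> i) (\<phi> j)) = (\<Sum>i<n. if i = j then c i else 0)"
    using assms by (intro sum.cong) (auto simp: orthonormal_upto_def)
  with assms(2) show ?thesis by simp
qed

text \<open>Comparing leading coefficients shows that \<open>\<phi>\<close> spans the polynomials of
  degree below \<open>n\<close>; pairing with \<open>\<phi> j\<close> then identifies the
  coefficients. The disjunct \<open>q = 0\<close> is there because \<open>degree 0 = 0\<close> is
  not below \<open>n = 0\<close>, the base of the induction.\<close>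

lemma orthonormal_expansion:
  assumes "orthonormal_upto n \<phi>" "q = 0 \<or> degree q < n"
  shows "q = (\<Sum>i<n. smult (ip q (\<phi> i)) (\<phi> i))"
proof -
  have "\<exists>c. q = (\<Sum>i<n. smult (c i) (\<phi> i))" using assms
  proof (induction n arbitrary: q)
    case (Suc n)
    have deg: "degree (\<phi> n) = n" and nz: "\<phi> n \<noteq> 0"
      using Suc.prems(1) by (auto simp: orthonormal_upto_def)
    define a where "a = coeff q n / lead_coeff (\<phi> n)"
    define q' where "q' = q - smult a (\<phi> n)"
    have "degree q' \<le> n" using Suc.prems(2) deg
      by (auto simp: q'_def intro!: degree_diff_le)
    moreover have "coeff (\<phi> n) n \<noteq> 0" using nz deg by (metis leading_coeff_0_iff)
    then have "coeff q' n = 0" using deg by (simp add: q'_def a_def)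
    ultimately have "q' = 0 \<or> degree q' < n"
      by (metis leading_coeff_0_iff le_neq_implies_less)
    moreover have "orthonormal_upto n \<phi>" using Suc.prems(1) by (auto simp: orthonormal_upto_def)
    ultimately obtain c where "q' = (\<Sum>i<n. smult (c i) (\<phi> i))" using Suc.IH by blast
    then have "q = (\<Sum>i<Suc n. smult ((c(n := a)) i) (\<phi> i))"
      by (simp add: q'_def algebra_simps)
    then show ?case by blast
  qed auto
  then obtain c where c: "q = (\<Sum>i<n. smult (c i) (\<phi> i))" by blast
  have "ip q (\<phi> j) = c j" if "j < n" for j
    using orthonormal_sum[OF assms(1) that] by (simp add: c ip_sum ip_smult)
  then have "(\<Sum>i<n. smult (ip q (\<phi> i)) (\<phi> i)) = (\<Sum>i<n. smult (c i) (\<phi> i))" by simp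
  with c show ?thesis by simp
qed

lemma orthonormal_parseval:
  assumes "orthonormal_upto n \<phi>" "q = 0 \<or> degree q < n"
  shows "ip q r = (\<Sum>i<n. ip q (\<phi> i) * ip (\<phi> i) r)"
  by (subst orthonormal_expansion[OF assms]) (simp add: ip_sum ip_smult)

text \<open>Cauchy-Schwarz applied to the expansion of \<open>q\<close>. The constant is the
  diagonal of the reproducing kernel; upper bounds for kernels and for kernel differences both start
  from here.\<close>

lemma eval_bound:
  assumes "orthonormal_upto n \<phi>" "q = 0 \<or> degree q < n"
  shows "(poly q x)\<^sup>2 \<le> (\<Sum>i<n. (poly (\<phi> i) x)\<^sup>2) * ip q q"
proof -
  have "poly q x = (\<Sum>i<n. ip q (\<phi> i) * poly (\<phi> i) x)"
    by (subst orthonormal_expansion[OF assms]) (simp add: poly_sum)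
  moreover have "ip q q = (\<Sum>i<n. (ip q (\<phi> i))\<^sup>2)"
    by (subst orthonormal_parseval[OF assms]) (simp add: power2_eq_square ip_commute)
  ultimately show ?thesis
    using Cauchy_Schwarz_ineq_sum[of "\<lambda>i. ip q (\<phi> i)" "\<lambda>i. poly (\<phi> i) x" "{..<n}"]
    by (simp add: mult.commute)
qed

text \<open>Gram-Schmidt by strong induction. Orthogonality is stated against all polynomials of
  smaller degree, so the polynomials chosen for different \<open>n\<close> are automatically
  orthogonal to each other.\<close>

lemma exists_orthogonal_poly:
  "\<exists>\<psi>. degree \<psi> = n \<and> lead_coeff \<psi> > 0 \<and> ip \<psi> \<psi> = 1 \<and> (\<forall>q. degree q < n \<longrightarrow> ip \<psi> q = 0)"
proof (induction n rule: less_induct)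
  case (less n)
  then obtain \<phi> where \<phi>: "\<And>m. m < n \<Longrightarrow> degree (\<phi> m) = m \<and> ip (\<phi> m) (\<phi> m) = 1 \<and>
     (\<forall>q. degree q < m \<longrightarrow> ip (\<phi> m) q = 0)" by metis
  have on: "orthonormal_upto n \<phi>" unfolding orthonormal_upto_def
  proof (intro conjI allI impI)
    fix i j assume "i < n" "j < n"
    then show "ip (\<phi> i) (\<phi> j) = (if i = j then 1 else 0)"
      using \<phi>[of i] \<phi>[of j] by (cases i j rule: linorder_cases) (metis ip_commute nat_neq_iff)+
  qed (use \<phi> in auto)
  define e where "e = monom 1 n - (\<Sum>i<n. smult (ip (monom 1 n) (\<phi> i)) (\<phi> i))"
  have c: "coeff (\<Sum>i<n. smult (ip (monom 1 n) (\<phi> i)) (\<phi> i)) m = 0" if "m \<ge> n" for m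
    using \<phi> that by (auto simp: coeff_sum intro!: sum.neutral coeff_eq_0)
  have "coeff e n = 1" and "\<And>m. m > n \<Longrightarrow> coeff e m = 0" using c by (auto simp: e_def)
  then have deg: "degree e = n" and lc: "lead_coeff e = 1"
    by (metis degree_le le_degree le_antisym zero_neq_one)+
  have e0: "e \<noteq> 0" using lc by auto
  have orth: "ip e q = 0" if "degree q < n" for q
  proof -
    have "ip e (\<phi> j) = 0" if "j < n" for j
      using orthonormal_sum[OF on that] by (simp add: e_def ip_diff ip_sum ip_smult)
    then have "ip q e = 0"
      using orthonormal_parseval[OF on disjI2[OF that], of e] by (simp add: ip_commute[of _ e])
    then show ?thesis by (simp add: ip_commute)
  qed
  define s where "s = 1 / sqrt (ip e e)"
  have s: "s > 0" "s * (s * ip e e) = 1"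
    using ip_pos[OF e0] by (auto simp: s_def)
  show ?case
    by (rule exI[of _ "smult s e"]) (use s deg lc orth in \<open>auto simp: ip_smult ip_smult_right\<close>)
qed

text \<open>Makes \<open>orthonormal_poly\<close> a proper definite description. For uniqueness,
  \<open>\<psi> n\<close> is orthogonal to every \<open>\<phi> i\<close> with \<open>i < n\<close>,
  so it is a multiple of \<open>\<phi> n\<close>; the norm fixes the factor up to sign and the
  leading coefficient fixes the sign.\<close>

lemma ex1_orthonormal:
  "\<exists>!\<phi>. (\<forall>j. degree (\<phi> j) = j \<and> lead_coeff (\<phi> j) > 0) \<and>
        (\<forall>i j. ip (\<phi> i) (\<phi> j) = (if i = j then 1 else 0))"
proof (rule ex_ex1I)
  obtain \<phi> where \<phi>: "\<And>n. degree (\<phi> n) = n \<and> lead_coeff (\<phi> n) > 0 \<and> ip (\<phi> n) (\<phi> n) = 1 \<and>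
     (\<forall>q. degree q < n \<longrightarrow> ip (\<phi> n) q = 0)" using exists_orthogonal_poly by metis
  have "ip (\<phi> i) (\<phi> j) = (if i = j then 1 else 0)" for i j
    using \<phi>[of i] \<phi>[of j] by (cases i j rule: linorder_cases) (metis ip_commute nat_neq_iff)+
  then show "\<exists>\<phi>. (\<forall>j. degree (\<phi> j) = j \<and> lead_coeff (\<phi> j) > 0) \<and>
        (\<forall>i j. ip (\<phi> i) (\<phi> j) = (if i = j then 1 else 0))" using \<phi> by blast
next
  fix \<phi> \<psi> :: "nat \<Rightarrow> real poly"
  assume \<phi>: "(\<forall>j. degree (\<phi> j) = j \<and> lead_coeff (\<phi> j) > 0) \<and>
        (\<forall>i j. ip (\<phi> i) (\<phi> j) = (if i = j then 1 else 0))"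
    and \<psi>: "(\<forall>j. degree (\<psi> j) = j \<and> lead_coeff (\<psi> j) > 0) \<and>
        (\<forall>i j. ip (\<psi> i) (\<psi> j) = (if i = j then 1 else 0))"
  have on: "orthonormal_upto n \<phi>" "orthonormal_upto n \<psi>" for n
    using \<phi> \<psi> by (auto simp: orthonormal_upto_def)
  have "\<phi> n = \<psi> n" for n
  proof -
    have orth: "ip (\<phi> i) (\<psi> n) = 0" if "i < n" for i
      using orthonormal_parseval[OF on(2)[of n], of "\<phi> i" "\<psi> n"] \<phi> \<psi> that by simp
    have "\<psi> n = (\<Sum>i<Suc n. smult (ip (\<psi> n) (\<phi> i)) (\<phi> i))"
      using orthonormal_expansion[OF on(1)[of "Suc n"], of "\<psi> n"] \<psi> by simp
    also have "\<dots> = smult (ip (\<psi> n) (\<phi> n)) (\<phi> n)"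
      using orth by (simp add: ip_commute[of "\<psi> n"])
    finally have eq: "\<psi> n = smult (ip (\<psi> n) (\<phi> n)) (\<phi> n)" .
    define c where "c = ip (\<psi> n) (\<phi> n)"
    have "ip (\<psi> n) (\<psi> n) = c * (c * ip (\<phi> n) (\<phi> n))"
      using eq unfolding c_def[symmetric] by (metis ip_smult ip_smult_right)
    then have "c * c = 1" using \<phi> \<psi> by simp
    moreover have "lead_coeff (\<psi> n) = c * lead_coeff (\<phi> n)"
      using eq unfolding c_def[symmetric] by (metis lead_coeff_smult)
    then have "c > 0" using \<phi> \<psi> by (metis zero_less_mult_pos2)
    ultimately have "c = 1" by (metis abs_of_pos abs_square_eq_1 power2_eq_square)
    then show ?thesis using eq unfolding c_def[symmetric] by simp
  qed
  then show "\<phi> = \<psi>" by blast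
qed

end

section \<open>Interpolation at Chebyshev nodes\<close>

fun cheb :: "nat \<Rightarrow> real poly" where
  "cheb 0 = 1"
| "cheb (Suc 0) = [:0, 1:]"
| "cheb (Suc (Suc n)) = [:0, 2:] * cheb (Suc n) - cheb n"

lemma cos_three_term: "cos (real (Suc (Suc n)) * x) = 2 * cos x * cos (real (Suc n) * x) - cos (real n * x)"
proof -
  have "cos (real (Suc (Suc n)) * x) = cos (real (Suc n) * x + x)"
    and "cos (real n * x) = cos (real (Suc n) * x - x)"
    by (simp_all add: algebra_simps)
  then show ?thesis unfolding cos_add cos_diff by simp
qed

lemma poly_cheb_cos: "poly (cheb n) (cos x) = cos (real n * x)"
proof (induction n rule: cheb.induct)
  case (3 n)
  then show ?case by (simp only: cheb.simps cos_three_term) simp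
qed auto

lemma degree_cheb: "degree (cheb n) \<le> n"
proof (induction n rule: cheb.induct)
  case (3 n)
  have "degree ([:0, 2:] * cheb (Suc n)) \<le> Suc (Suc n)"
    using degree_mult_le[of "[:0, 2:]" "cheb (Suc n)"] 3 by simp
  then show ?case using 3 by (auto intro!: degree_diff_le)
qed auto

lemma abs_sin_nat_mult_le: "\<bar>sin (real n * x)\<bar> \<le> real n * \<bar>sin x\<bar>"
proof (induction n)
  case (Suc n)
  have "\<bar>sin (real (Suc n) * x)\<bar> = \<bar>sin (real n * x) * cos x + cos (real n * x) * sin x\<bar>"
    by (simp add: sin_add distrib_right algebra_simps)
  also have "\<dots> \<le> \<bar>sin (real n * x)\<bar> * \<bar>cos x\<bar> + \<bar>cos (real n * x)\<bar> * \<bar>sin x\<bar>"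
    by (metis abs_mult abs_triangle_ineq)
  also have "\<dots> \<le> \<bar>sin (real n * x)\<bar> * 1 + 1 * \<bar>sin x\<bar>"
    by (intro add_mono mult_mono) auto
  finally show ?case using Suc by (simp add: algebra_simps)
qed auto

text \<open>A difference of cosines is a product of two sines, so the bound for a single sine is
  used twice. This is Markov's inequality for Chebyshev polynomials in Lipschitz form, without
  derivatives.\<close>

lemma cos_nat_mult_lipschitz:
  "\<bar>cos (real n * x) - cos (real n * y)\<bar> \<le> (real n)\<^sup>2 * \<bar>cos x - cos y\<bar>"
proof -
  define a b where "a = (x + y) / 2" and "b = (y - x) / 2"
  have "cos (real n * x) - cos (real n * y) = 2 * sin (real n * a) * sin (real n * b)"
    by (simp add: cos_diff_cos a_def b_def algebra_simps add_divide_distrib diff_divide_distrib)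
  moreover have "cos x - cos y = 2 * sin a * sin b"
    by (simp add: cos_diff_cos a_def b_def)
  moreover have "\<bar>sin (real n * a)\<bar> * \<bar>sin (real n * b)\<bar> \<le> (real n * \<bar>sin a\<bar>) * (real n * \<bar>sin b\<bar>)"
    by (intro mult_mono abs_sin_nat_mult_le) auto
  ultimately show ?thesis by (simp add: abs_mult power2_eq_square algebra_simps)
qed

lemma cheb_bound:
  assumes "\<bar>u\<bar> \<le> 1" shows "\<bar>poly (cheb n) u\<bar> \<le> 1"
  using poly_cheb_cos[of n "arccos u"] assms by (auto simp: cos_arccos abs_le_iff)

lemma cheb_lipschitz:
  assumes "\<bar>u\<bar> \<le> 1" "\<bar>v\<bar> \<le> 1"
  shows "\<bar>poly (cheb n) u - poly (cheb n) v\<bar> \<le> (real n)\<^sup>2 * \<bar>u - v\<bar>"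
proof -
  have "u = cos (arccos u)" "v = cos (arccos v)"
    using assms by (simp_all add: abs_le_iff)
  then show ?thesis by (metis poly_cheb_cos cos_nat_mult_lipschitz)
qed

section \<open>Lagrange polynomials as cosine sums\<close>

definition half0 :: "nat \<Rightarrow> real" where
  "half0 j = (if j = 0 then 1 / 2 else 1)"

lemma half0_bounds: "0 \<le> half0 j" "half0 j \<le> 1" by (auto simp: half0_def)

text \<open>Christoffel-Darboux formula for the Chebyshev polynomials. With
  \<open>M = Suc m\<close>, the right-hand side vanishes when both angles are zeros of cos (M x),
  which gives the values of a cardinal polynomial at the other nodes.\<close>

lemma cos_christoffel_darboux:
  "2 * (cos x - cos y) * (\<Sum>j<Suc m. half0 j * cos (real j * x) * cos (real j * y)) =
   cos (real (Suc m) * x) * cos (real m * y) - cos (real m * x) * cos (real (Suc m) * y)"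
proof (induction m)
  case (Suc m)
  have "2 * (cos x - cos y) * (\<Sum>j<Suc (Suc m). half0 j * cos (real j * x) * cos (real j * y)) =
     2 * (cos x - cos y) * (\<Sum>j<Suc m. half0 j * cos (real j * x) * cos (real j * y)) +
     2 * (cos x - cos y) * cos (real (Suc m) * x) * cos (real (Suc m) * y)"
    by (subst sum.lessThan_Suc) (simp only: distrib_left, simp add: half0_def)
  show ?case unfolding \<open>_ = _ + _\<close> Suc.IH cos_three_term[of m x] cos_three_term[of m y]
    by algebra
qed (simp add: half0_def)

text \<open>The Dirichlet kernel in closed form, for the value of a cardinal polynomial at its own
  node.\<close>

lemma dirichlet_kernel_identity:
  "2 * sin x * (\<Sum>j<Suc m. half0 j * cos (2 * real j * x)) = sin ((2 * real m + 1) * x)"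
proof (induction m)
  case (Suc m)
  have "sin ((2 * real (Suc m) + 1) * x) - sin ((2 * real m + 1) * x) = 2 * sin x * cos (2 * real (Suc m) * x)"
    by (simp add: sin_diff_sin algebra_simps add_divide_distrib diff_divide_distrib)
  then show ?case using Suc by (subst sum.lessThan_Suc) (simp add: half0_def distrib_left)
qed (simp add: half0_def)

definition cheb_angle :: "nat \<Rightarrow> nat \<Rightarrow> real" where
  "cheb_angle M k = (2 * real k - 1) * pi / (2 * real M)"

text \<open>The Christoffel-Darboux kernel of the Chebyshev polynomials with one argument at a node,
  divided by its value there; \<open>half0\<close> corrects for the norm of the constant polynomial.
  As a sum of \<open>M\<close> terms of size at most 2 / M it is visibly bounded by 2 on
  [-1, 1].\<close>

definition cheb_cardinal :: "nat \<Rightarrow> nat \<Rightarrow> real poly" where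
  "cheb_cardinal M k =
     (\<Sum>j<M. smult (2 / real M * half0 j * cos (real j * cheb_angle M k)) (cheb j))"

lemma cheb_angle_bounds:
  assumes "k \<in> {1..M}" shows "0 < cheb_angle M k" "cheb_angle M k < pi"
proof -
  have "2 * real k - 1 < 2 * real M" "0 < real M" using assms by auto
  then show "0 < cheb_angle M k" "cheb_angle M k < pi" using assms
    by (auto simp: cheb_angle_def divide_simps)
qed

lemma cheb_angle_mult: "M > 0 \<Longrightarrow> real M * cheb_angle M k = real k * pi - pi / 2"
  by (simp add: cheb_angle_def field_simps)

lemma cos_cheb_angle_mult: "M > 0 \<Longrightarrow> cos (real M * cheb_angle M k) = 0"
  by (simp add: cheb_angle_mult cos_diff)

lemma cheb_cardinal_node:
  assumes "k \<in> {1..M}" "l \<in> {1..M}"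
  shows "poly (cheb_cardinal M k) (cos (cheb_angle M l)) = (if k = l then 1 else 0)"
proof -
  obtain m where M: "M = Suc m" using assms by (cases M) auto
  let ?x = "cheb_angle M l" and ?y = "cheb_angle M k"
  let ?S = "\<Sum>j<M. half0 j * cos (real j * ?x) * cos (real j * ?y)"
  have eq: "poly (cheb_cardinal M k) (cos ?x) = 2 / real M * ?S"
    by (simp add: cheb_cardinal_def poly_sum poly_cheb_cos sum_distrib_left mult_ac)
  show ?thesis
  proof (cases "k = l")
    case False
    have "?x \<noteq> ?y" using False assms by (auto simp: cheb_angle_def)
    then have "cos ?x \<noteq> cos ?y"
      using cheb_angle_bounds[OF assms(1)] cheb_angle_bounds[OF assms(2)] cos_inj_pi[of ?x ?y] by auto
    moreover have "2 * (cos ?x - cos ?y) * ?S = 0"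
      using cos_christoffel_darboux[of ?x ?y m] cos_cheb_angle_mult[of M] by (simp add: M)
    ultimately have "?S = 0" by simp
    with eq False show ?thesis by simp
  next
    case True
    have s: "sin ?x > 0" using cheb_angle_bounds[OF assms(2)] by (simp add: sin_gt_zero)
    \<comment> \<open>At a node 2 M x is an odd multiple of \<pi>, which collapses the Dirichlet sum
      to 1/2.\<close>
    have "(2 * real m + 1) * ?x = 2 * (real M * ?x) - ?x" by (simp add: M algebra_simps)
    also have "\<dots> = 2 * real l * pi - pi - ?x" using assms by (subst cheb_angle_mult) (auto simp: algebra_simps)
    finally have "sin ((2 * real m + 1) * ?x) = sin (2 * real l * pi - pi - ?x)" by simp
    also have "\<dots> = sin (?x)"
    proof -
      have "sin (2 * real l * pi) = 0" "cos (2 * real l * pi) = 1"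
        using sin_npi[of "2 * l"] cos_npi[of "2 * l"] by simp_all
      then show ?thesis unfolding sin_diff cos_diff by simp
    qed
    finally have "2 * sin ?x * (\<Sum>j<M. half0 j * cos (2 * real j * ?x)) = sin ?x"
      using dirichlet_kernel_identity[of ?x m] by (simp only: M)
    then have "sin ?x * (2 * (\<Sum>j<M. half0 j * cos (2 * real j * ?x))) = sin ?x * 1"
      by (simp only: mult.assoc mult.left_commute mult_1_right)
    then have 1: "2 * (\<Sum>j<M. half0 j * cos (2 * real j * ?x)) = 1"
      using s by (simp only: mult_cancel_left) simp
    have "2 * (half0 j * cos (real j * ?x) * cos (real j * ?x)) = half0 j + half0 j * cos (2 * real j * ?x)" for j
    proof -
      have "cos (2 * real j * ?x) = 2 * (cos (real j * ?x))\<^sup>2 - 1"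
        using cos_double_cos[of "real j * ?x"] by (simp only: mult.assoc)
      then show ?thesis by (simp add: power2_eq_square right_diff_distrib)
    qed
    then have "2 * ?S = (\<Sum>j<M. half0 j + half0 j * cos (2 * real j * ?x))"
      using True by (simp only: sum_distrib_left)
    also have "\<dots> = (\<Sum>j<M. half0 j) + 1 / 2" using 1 by (simp add: sum.distrib)
    also have "(\<Sum>j<M. half0 j) = real M - 1 / 2"
      by (simp add: M sum.lessThan_Suc_shift half0_def del: sum.lessThan_Suc)
    finally show ?thesis using eq True M by simp
  qed
qed

lemma degree_cheb_cardinal: "M > 0 \<Longrightarrow> degree (cheb_cardinal M k) < M"
proof -
  assume M: "M > 0"
  have "degree (smult c (cheb j)) < M" if "j < M" for c j
    using degree_smult_le[of c "cheb j"] degree_cheb[of j] that by linarith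
  then show ?thesis unfolding cheb_cardinal_def using M by (intro degree_sum_less) (auto simp del: degree_smult_eq)
qed

lemma cheb_cardinal_bound:
  assumes "\<bar>u\<bar> \<le> 1" shows "\<bar>poly (cheb_cardinal M k) u\<bar> \<le> 2"
proof (cases "M = 0")
  case False
  have "\<bar>poly (cheb_cardinal M k) u\<bar> \<le> (\<Sum>j<M. 2 / real M * 1 * 1 * 1)"
    unfolding cheb_cardinal_def poly_sum poly_smult
    by (rule order_trans[OF sum_abs], intro sum_mono, unfold abs_mult, intro mult_mono)
       (use assms cheb_bound half0_bounds in \<open>auto simp: half0_def\<close>)
  then show ?thesis using False by simp
qed (simp add: cheb_cardinal_def)

lemma cheb_cardinal_lipschitz:
  assumes "\<bar>u\<bar> \<le> 1" "\<bar>v\<bar> \<le> 1"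
  shows "\<bar>poly (cheb_cardinal M k) u - poly (cheb_cardinal M k) v\<bar> \<le> 2 * (real M)\<^sup>2 * \<bar>u - v\<bar>"
proof (cases "M = 0")
  case False
  let ?c = "\<lambda>j. 2 / real M * half0 j * cos (real j * cheb_angle M k)"
  have "\<bar>?c j * (poly (cheb j) u - poly (cheb j) v)\<bar> \<le> 2 / real M * ((real M)\<^sup>2 * \<bar>u - v\<bar>)"
    if "j < M" for j
  proof -
    have "\<bar>?c j\<bar> \<le> 2 / real M * 1 * 1"
      unfolding abs_mult by (intro mult_mono) (auto simp: half0_def)
    moreover have "(real j)\<^sup>2 \<le> (real M)\<^sup>2" using that by (intro power_mono) auto
    then have "\<bar>poly (cheb j) u - poly (cheb j) v\<bar> \<le> (real M)\<^sup>2 * \<bar>u - v\<bar>"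
      by (intro order_trans[OF cheb_lipschitz[OF assms]] mult_right_mono) auto
    ultimately show ?thesis unfolding abs_mult[of "?c j"] by (intro mult_mono) auto
  qed
  then have "\<bar>\<Sum>j<M. ?c j * (poly (cheb j) u - poly (cheb j) v)\<bar> \<le>
      (\<Sum>j<M. 2 / real M * ((real M)\<^sup>2 * \<bar>u - v\<bar>))"
    by (intro order_trans[OF sum_abs] sum_mono) auto
  moreover have "poly (cheb_cardinal M k) u - poly (cheb_cardinal M k) v =
      (\<Sum>j<M. ?c j * (poly (cheb j) u - poly (cheb j) v))"
    by (simp add: cheb_cardinal_def poly_sum sum_subtractf right_diff_distrib)
  ultimately have "\<bar>poly (cheb_cardinal M k) u - poly (cheb_cardinal M k) v\<bar> \<le>
      (\<Sum>j<M. 2 / real M * ((real M)\<^sup>2 * \<bar>u - v\<bar>))"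
    by simp
  also have "\<dots> = 2 * (real M)\<^sup>2 * \<bar>u - v\<bar>" using False by simp
  finally show ?thesis .
qed (simp add: cheb_cardinal_def)

section \<open>Transplantation to the interval [0, S]\<close>

definition cheb_node :: "nat \<Rightarrow> real \<Rightarrow> nat \<Rightarrow> real" where
  "cheb_node M S k = S * (sin (cheb_angle M k / 2))\<^sup>2"

definition cheb_lagrange :: "nat \<Rightarrow> real \<Rightarrow> nat \<Rightarrow> real poly" where
  "cheb_lagrange M S k = pcompose (cheb_cardinal M k) [:1, - 2 / S:]"

lemma poly_cheb_lagrange: "poly (cheb_lagrange M S k) t = poly (cheb_cardinal M k) (1 - 2 / S * t)"
  by (simp add: cheb_lagrange_def poly_pcompose mult.commute)

text \<open>The substitution u = 1 - 2 t / S reverses the orientation: zeros of the Chebyshev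
  polynomial close to u = 1 become nodes close to 0, and the nodes increase with
  \<open>k\<close>.\<close>

lemma cheb_node_affine: "S > 0 \<Longrightarrow> 1 - 2 / S * cheb_node M S k = cos (cheb_angle M k)"
  unfolding cheb_node_def using cos_double_sin[of "cheb_angle M k / 2"]
  by (simp only: nonzero_mult_div_cancel_left times_divide_eq_right) simp

lemma cheb_node_strict_mono:
  assumes "S > 0" "1 \<le> j" "j < k" "k \<le> M"
  shows "cheb_node M S j < cheb_node M S k"
proof -
  have "cheb_angle M j < cheb_angle M k" unfolding cheb_angle_def
    using assms by (intro divide_strict_right_mono mult_strict_right_mono) auto
  then have "cos (cheb_angle M k) < cos (cheb_angle M j)"
    using cheb_angle_bounds[of j M] cheb_angle_bounds[of k M] assms by (intro cos_monotone_0_pi) auto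
  then have "2 / S * cheb_node M S j < 2 / S * cheb_node M S k"
    unfolding cheb_node_affine[OF assms(1), symmetric] by simp
  then show ?thesis using assms(1) by (elim mult_left_less_imp_less) simp
qed

lemma cheb_node_inj: "S > 0 \<Longrightarrow> inj_on (cheb_node M S) {1..M}"
  by (intro strict_mono_on_imp_inj_on strict_mono_onI cheb_node_strict_mono) auto

lemma cheb_node_range: "S > 0 \<Longrightarrow> cheb_node M S k \<in> {0..S}"
  using abs_sin_le_one[of "cheb_angle M k / 2"]
  by (auto simp: cheb_node_def mult_le_cancel_left1 abs_square_le_1)

lemma cheb_lagrange_node:
  assumes "S > 0" "k \<in> {1..M}" "l \<in> {1..M}"
  shows "poly (cheb_lagrange M S k) (cheb_node M S l) = (if k = l then 1 else 0)"
  using cheb_cardinal_node[OF assms(2,3)] cheb_node_affine[OF assms(1), of M l]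
  by (simp only: poly_cheb_lagrange)

lemma affine_unit: "S > 0 \<Longrightarrow> t \<in> {0..S} \<Longrightarrow> \<bar>1 - 2 / S * t\<bar> \<le> (1::real)"
  using mult_left_mono[of t S "2 / S"] by (auto simp: abs_le_iff)

lemma cheb_lagrange_bound:
  assumes "S > 0" "t \<in> {0..S}"
  shows "\<bar>poly (cheb_lagrange M S k) t\<bar> \<le> 2"
  using cheb_cardinal_bound[OF affine_unit[OF assms]]
  by (simp only: poly_cheb_lagrange)

lemma cheb_lagrange_lipschitz:
  assumes "S > 0" "s \<in> {0..S}" "t \<in> {0..S}"
  shows "\<bar>poly (cheb_lagrange M S k) s - poly (cheb_lagrange M S k) t\<bar> \<le> 4 * (real M)\<^sup>2 / S * \<bar>s - t\<bar>"
proof -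
  have "(1 - 2 / S * s) - (1 - 2 / S * t) = (2 / S) * (t - s)" by (simp only: right_diff_distrib)
  then have "\<bar>(1 - 2 / S * s) - (1 - 2 / S * t)\<bar> = \<bar>2 / S\<bar> * \<bar>t - s\<bar>"
    by (simp only: abs_mult)
  then have "\<bar>(1 - 2 / S * s) - (1 - 2 / S * t)\<bar> = 2 / S * \<bar>s - t\<bar>"
    using assms(1) by (simp only: abs_minus_commute[of t s]) simp
  then have "2 * (real M)\<^sup>2 * \<bar>(1 - 2 / S * s) - (1 - 2 / S * t)\<bar> = 4 * (real M)\<^sup>2 / S * \<bar>s - t\<bar>"
    by simp
  then show ?thesis
  using cheb_cardinal_lipschitz[OF affine_unit[OF assms(1,2)] affine_unit[OF assms(1,3)], of M k]
  by (simp only: poly_cheb_lagrange)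
qed

lemma degree_cheb_lagrange: "M > 0 \<Longrightarrow> degree (cheb_lagrange M S k) < M"
  using degree_pcompose_le[of "cheb_cardinal M k" "[:1, - 2 / S:]"] degree_cheb_cardinal[of M k]
  by (simp add: cheb_lagrange_def split: if_splits)

lemma cheb_interpolation:
  assumes S: "S > 0" and deg: "degree r < M"
  shows "r = (\<Sum>k=1..M. smult (poly r (cheb_node M S k)) (cheb_lagrange M S k))" (is "r = ?s")
proof -
  have "degree ?s < M" using deg
    by (intro degree_sum_less) (auto intro!: le_less_trans[OF degree_smult_le] degree_cheb_lagrange simp del: degree_smult_eq)
  then have "degree (r - ?s) < M" using deg by (intro degree_diff_less)
  moreover have "poly (r - ?s) (cheb_node M S l) = 0" if "l \<in> {1..M}" for l
  proof -
    have "poly ?s (cheb_node M S l) = (\<Sum>k=1..M. if k = l then poly r (cheb_node M S k) else 0)"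
      unfolding poly_sum using that S by (intro sum.cong) (auto simp: cheb_lagrange_node)
    then show ?thesis using that by simp
  qed
  then have "cheb_node M S ` {1..M} \<subseteq> {x. poly (r - ?s) x = 0}" by blast
  then have "r - ?s \<noteq> 0 \<Longrightarrow> M \<le> card {x. poly (r - ?s) x = 0}"
    using card_mono[OF poly_roots_finite, of "r - ?s" "cheb_node M S ` {1..M}"]
      card_image[OF cheb_node_inj[OF S, of M]] by simp
  then have "r - ?s \<noteq> 0 \<Longrightarrow> M \<le> degree (r - ?s)"
    using card_poly_roots_bound[of "r - ?s"] by linarith
  ultimately have "r - ?s = 0" by linarith
  then show ?thesis by (simp only: right_minus_eq)
qed

section \<open>Power weights\<close>

lemma powr_set_integral:
  assumes "a > (-1::real)" "S \<ge> 0"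
  shows "set_integrable lborel {0..S} (\<lambda>t. t powr a)"
    and "(LBINT t:{0..S}. t powr a) = S powr (a + 1) / (a + 1)"
proof -
  have "(\<lambda>t. t powr a) absolutely_integrable_on {0..S}"
    using assms by (intro nonnegative_absolutely_integrable_1 integrable_on_powr_from_0) auto
  then show *: "set_integrable lborel {0..S} (\<lambda>t. t powr a)"
    unfolding set_integrable_def by (subst (asm) integrable_completion) auto
  show "(LBINT t:{0..S}. t powr a) = S powr (a + 1) / (a + 1)"
    using set_borel_integral_eq_integral(2)[OF *] has_integral_powr_from_0[OF assms]
    by (simp add: integral_unique)
qed

text \<open>Domination by \<open>t powr \<nu>\<close> makes every polynomial integrable against
  \<open>w\<close>, and it is shared by the pure power weight and by the tail weight, whose product
  is at most 1. Positivity is asked for in the open interval because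
  \<open>0 powr \<nu> = 0\<close>.\<close>

locale power_weight =
  fixes w :: "real \<Rightarrow> real" and R \<nu> :: real
  assumes R_pos: "R > 0" and nu: "\<nu> > -1"
    and w_measurable [measurable]: "w \<in> borel_measurable borel"
    and w_nonneg: "\<And>t. t \<in> {0..R} \<Longrightarrow> 0 \<le> w t"
    and w_le: "\<And>t. t \<in> {0..R} \<Longrightarrow> w t \<le> t powr \<nu>"
    and w_pos: "\<And>t. t \<in> {0<..<R} \<Longrightarrow> 0 < w t"
begin

definition wip :: "real poly \<Rightarrow> real poly \<Rightarrow> real" where
  "wip p q = (LBINT t:{0..R}. poly p t * poly q t * w t)"

lemma poly_measurable [measurable]: "poly (q :: real poly) \<in> borel_measurable borel"
  by (intro borel_measurable_continuous_onI continuous_on_poly continuous_on_id)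

lemma set_integrable_continuous:
  assumes "continuous_on {0..R} f" and [measurable]: "f \<in> borel_measurable borel"
  shows "set_integrable lborel {0..R} (\<lambda>t. f t * w t)"
proof -
  have "bounded (f ` {0..R})"
    using assms(1) by (intro compact_imp_bounded compact_continuous_image) auto
  then obtain B where B: "\<And>t. t \<in> {0..R} \<Longrightarrow> \<bar>f t\<bar> \<le> B"
    unfolding bounded_iff by (metis imageI real_norm_def)
  show ?thesis
  proof (rule set_integrable_bound)
    show "set_integrable lborel {0..R} (\<lambda>t. B * t powr \<nu>)"
      using powr_set_integral(1)[OF nu, of R] R_pos by simp
    show "AE t in lborel. t \<in> {0..R} \<longrightarrow> norm (f t * w t) \<le> norm (B * t powr \<nu>)"
    proof (rule AE_I2, rule impI)
      fix t assume t: "t \<in> {0..R}"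
      have "\<bar>f t\<bar> * \<bar>w t\<bar> \<le> \<bar>B\<bar> * t powr \<nu>"
        using B[OF t] w_nonneg[OF t] w_le[OF t] by (intro mult_mono) auto
      then show "norm (f t * w t) \<le> norm (B * t powr \<nu>)" by (simp add: abs_mult)
    qed
  qed (auto simp: set_borel_measurable_def)
qed

lemma set_integrable_poly: "set_integrable lborel {0..R} (\<lambda>t. poly q t * w t)"
  by (intro set_integrable_continuous continuous_intros) auto

lemma set_integrable_poly2: "set_integrable lborel {0..R} (\<lambda>t. poly p t * poly q t * w t)"
  using set_integrable_poly[of "p * q"] by simp

lemma wip_pos:
  assumes "q \<noteq> 0" shows "wip q q > 0"
proof -
  let ?f = "\<lambda>t. indicator {0..R} t *\<^sub>R (poly q t * poly q t * w t)"
  have int: "integrable lborel ?f" using set_integrable_poly2[of q q] by (simp add: set_integrable_def)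
  have nn: "0 \<le> ?f t" for t using w_nonneg[of t] by (auto simp: indicator_def)
  have "wip q q \<ge> 0" unfolding wip_def set_lebesgue_integral_def
    by (intro integral_nonneg_AE AE_I2 nn)
  moreover have "wip q q \<noteq> 0"
  proof
    assume "wip q q = 0"
    then have "AE t in lborel. ?f t = 0"
      using integral_nonneg_eq_0_iff_AE[OF int AE_I2[OF nn]]
      by (simp add: wip_def set_lebesgue_integral_def)
    moreover have "AE t in lborel. t \<notin> {t. poly q t = 0}"
      using poly_roots_finite[OF assms] by (intro AE_not_in finite_imp_null_set_lborel)
    ultimately have "AE t in lborel. t \<notin> {0<..<R}"
    proof eventually_elim
      case (elim t)
      then show ?case using w_pos[of t] by (auto simp: indicator_def split: if_splits)
    qed
    then have "{0<..<R} \<in> null_sets lborel"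
      by (subst AE_iff_null_sets) auto
    then show False using R_pos by (auto simp: null_sets_def)
  qed
  ultimately show ?thesis by linarith
qed

sublocale poly_inner wip
proof
  fix p q r :: "real poly" and a :: real
  show "wip (p + q) r = wip p r + wip q r"
    unfolding wip_def using set_integrable_poly2[of p r] set_integrable_poly2[of q r]
    by (simp add: distrib_right)
  show "wip (smult a p) r = a * wip p r"
    unfolding wip_def by (simp add: mult.assoc)
  show "wip p q = wip q p" unfolding wip_def by (simp add: mult.commute)
  show "p \<noteq> 0 \<Longrightarrow> wip p p > 0" by (rule wip_pos)
qed

lemma is_orthonormal_polys_iff:
  "is_orthonormal_polys 0 R w \<phi> \<longleftrightarrow> (\<forall>j. degree (\<phi> j) = j \<and> lead_coeff (\<phi> j) > 0) \<and>
     (\<forall>i j. wip (\<phi> i) (\<phi> j) = (if i = j then 1 else 0))"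
  by (simp only: is_orthonormal_polys_def wip_def)

lemma orthonormal_upto_orthonormal_poly: "orthonormal_upto n (orthonormal_poly 0 R w)"
proof -
  have "\<exists>!\<phi>. is_orthonormal_polys 0 R w \<phi>"
    unfolding is_orthonormal_polys_iff by (rule ex1_orthonormal)
  then have "is_orthonormal_polys 0 R w (orthonormal_poly 0 R w)"
    unfolding orthonormal_poly_def by (rule theI')
  then show ?thesis by (auto simp: is_orthonormal_polys_iff orthonormal_upto_def)
qed

end

section \<open>Inequalities of Markov and Nikolskii type\<close>

lemma power_weight_powr: "S > 0 \<Longrightarrow> \<nu> > -1 \<Longrightarrow> power_weight (\<lambda>t. t powr \<nu>) S \<nu>"
  by standard auto

text \<open>Interpolation adds up \<open>M\<close> Lipschitz constants of order M^2 / S. Markov's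
  inequality would save one factor \<open>M\<close>; any fixed power of \<open>M\<close> serves
  here.\<close>

lemma cheb_interp_lipschitz:
  assumes S: "S > 0" and deg: "degree r < M" and B: "\<And>t. t \<in> {0..S} \<Longrightarrow> \<bar>poly r t\<bar> \<le> B"
    and st: "s \<in> {0..S}" "t \<in> {0..S}"
  shows "\<bar>poly r s - poly r t\<bar> \<le> 4 * (real M) ^ 3 / S * B * \<bar>s - t\<bar>"
proof -
  have B0: "B \<ge> 0" using B[OF st(1)] by linarith
  have "poly r s - poly r t =
     (\<Sum>k=1..M. poly r (cheb_node M S k) * (poly (cheb_lagrange M S k) s - poly (cheb_lagrange M S k) t))"
    by (subst (1 2) cheb_interpolation[OF S deg]) (simp add: poly_sum sum_subtractf right_diff_distrib)
  also have "\<bar>\<dots>\<bar> \<le> (\<Sum>k=1..M. B * (4 * (real M)\<^sup>2 / S * \<bar>s - t\<bar>))"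
    by (rule order_trans[OF sum_abs], intro sum_mono, unfold abs_mult, intro mult_mono)
       (use B cheb_node_range[OF S] B0 cheb_lagrange_lipschitz[OF S st] in auto)
  also have "\<dots> = 4 * (real M) ^ 3 / S * B * \<bar>s - t\<bar>" by (simp add: power3_eq_cube power2_eq_square)
  finally show ?thesis .
qed

text \<open>The exponent \<open>\<bar>\<nu>\<bar>\<close> treats both signs at once: for positive
  \<open>\<nu>\<close> the power is smallest at the left end \<open>\<delta> * S\<close>, for
  negative \<open>\<nu>\<close> at \<open>S\<close>.\<close>

lemma powr_lower_bound:
  fixes t :: real
  assumes "0 < \<delta>" "\<delta> \<le> 1" "0 < S" "\<delta> * S \<le> t" "t \<le> S"
  shows "S powr \<nu> * \<delta> powr \<bar>\<nu>\<bar> \<le> t powr \<nu>"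
proof -
  define u where "u = t / S"
  have u1: "\<delta> \<le> u" unfolding u_def using assms by (simp only: pos_le_divide_eq)
  then have u: "\<delta> \<le> u" "u \<le> 1" "0 < u" using assms by (auto simp: u_def)
  have "\<delta> powr \<bar>\<nu>\<bar> \<le> u powr \<nu>"
  proof (cases "\<nu> \<ge> 0")
    case True
    then show ?thesis using assms u by (auto intro: powr_mono2)
  next
    case False
    have "\<delta> powr \<bar>\<nu>\<bar> \<le> 1" using assms by (intro powr_le1) auto
    also have "1 \<le> u powr \<nu>" using u False powr_mono2'[of \<nu> u 1] by simp
    finally show ?thesis .
  qed
  then have "S powr \<nu> * \<delta> powr \<bar>\<nu>\<bar> \<le> S powr \<nu> * u powr \<nu>" by (intro mult_left_mono) auto
  also have "\<dots> = t powr \<nu>" using u assms by (subst powr_mult[symmetric]) (auto simp: u_def)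
  finally show ?thesis .
qed

text \<open>By the Lipschitz bound the polynomial keeps half of its maximum on an interval of length
  \<open>\<delta> * S\<close>, and the weight is bounded below there, so the integral over that
  interval already controls the maximum.\<close>

theorem poly_sup_le_L2:
  assumes S: "S > 0" and nu: "\<nu> > -1" and deg: "degree r < M" and t: "t \<in> {0..S}"
  shows "(poly r t)\<^sup>2 \<le> 4 * (16 * real M ^ 3) powr (1 + \<bar>\<nu>\<bar>) / S powr (\<nu> + 1) *
           (LBINT s:{0..S}. (poly r s)\<^sup>2 * s powr \<nu>)"
proof -
  interpret power_weight "\<lambda>t. t powr \<nu>" S \<nu> by (rule power_weight_powr[OF S nu])
  have M1: "M \<ge> 1" using deg by linarith
  have "\<exists>x\<in>{0..S}. \<forall>y\<in>{0..S}. \<bar>poly r y\<bar> \<le> \<bar>poly r x\<bar>"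
    using S by (intro continuous_attains_sup continuous_intros) auto
  then obtain t0 where t0: "t0 \<in> {0..S}" and max: "\<And>y. y \<in> {0..S} \<Longrightarrow> \<bar>poly r y\<bar> \<le> \<bar>poly r t0\<bar>"
    by blast
  define B where "B = \<bar>poly r t0\<bar>"
  \<comment> \<open>The 16 makes the Lipschitz bound over a distance
    \<open>2 * (\<delta> * S)\<close> equal to half the maximum.\<close>
  define \<delta> where "\<delta> = 1 / (16 * real M ^ 3)"
  have M3: "real M ^ 3 \<ge> 1" using M1 by (intro one_le_power) auto
  have \<delta>: "0 < \<delta>" "\<delta> \<le> 1 / 16" using M3 M1 by (auto simp: \<delta>_def divide_simps)
  \<comment> \<open>The interval lies on the side of \<open>t0\<close> that faces the middle of
    [0, S], so it stays at distance at least \<open>\<delta> * S\<close> from 0, as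
    \<open>powr_lower_bound\<close> demands.\<close>
  define u where "u = (if t0 \<le> S / 2 then t0 + \<delta> * S else t0 - \<delta> * S)"
  have \<delta>S: "0 < \<delta> * S" "\<delta> * S \<le> S / 16" using \<delta> S mult_right_mono[OF \<delta>(2), of S] by auto
  have J: "\<delta> * S \<le> s \<and> s \<le> S \<and> \<bar>s - t0\<bar> \<le> 2 * (\<delta> * S)" if "s \<in> {u..u + \<delta> * S}" for s
    using that t0 \<delta>S by (simp only: u_def atLeastAtMost_iff split: if_splits) linarith+
  have low: "B / 2 \<le> \<bar>poly r s\<bar>" if "s \<in> {u..u + \<delta> * S}" for s
  proof -
    have "s \<in> {0..S}" using J[OF that] \<delta>S by auto
    then have "\<bar>poly r s - poly r t0\<bar> \<le> 4 * (real M) ^ 3 / S * B * \<bar>s - t0\<bar>"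
      using cheb_interp_lipschitz[OF S deg max _ t0, of s] by (simp add: B_def)
    also have "\<dots> \<le> 4 * (real M) ^ 3 / S * B * (2 * (\<delta> * S))"
      using J[OF that] S by (intro mult_left_mono) (auto simp: B_def)
    also have "\<dots> = B / 2" using S M1 by (simp add: \<delta>_def)
    finally show ?thesis unfolding B_def by linarith
  qed
  define c where "c = (B / 2)\<^sup>2 * (S powr \<nu> * \<delta> powr \<bar>\<nu>\<bar>)"
  have "c * (\<delta> * S) = (LBINT s:{u..u + \<delta> * S}. c)"
    using \<delta>S by (simp add: set_lebesgue_integral_def)
  also have "\<dots> \<le> (LBINT s:{0..S}. (poly r s)\<^sup>2 * s powr \<nu>)"
    unfolding set_lebesgue_integral_def
  proof (rule integral_mono)
    show "integrable lborel (\<lambda>s. indicator {0..S} s *\<^sub>R ((poly r s)\<^sup>2 * s powr \<nu>))"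
      using set_integrable_poly2[of r r] by (simp add: set_integrable_def power2_eq_square)
    have "integrable lborel (indicat_real {u..u + \<delta> * S})"
      by (intro integrable_real_indicator) (auto simp: emeasure_lborel_Icc_eq)
    then show "integrable lborel (\<lambda>s. indicator {u..u + \<delta> * S} s *\<^sub>R c)" by simp
    fix s
    show "indicator {u..u + \<delta> * S} s *\<^sub>R c \<le> indicator {0..S} s *\<^sub>R ((poly r s)\<^sup>2 * s powr \<nu>)"
    proof (cases "s \<in> {u..u + \<delta> * S}")
      case True
      then have "s \<in> {0..S}" using J[OF True] \<delta>S by auto
      moreover have "(B / 2)\<^sup>2 \<le> \<bar>poly r s\<bar>\<^sup>2" using low[OF True]
        by (intro power_mono) (auto simp: B_def)
      then have "c \<le> \<bar>poly r s\<bar>\<^sup>2 * s powr \<nu>" unfolding c_def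
        using J[OF True] S \<delta> by (intro mult_mono powr_lower_bound) auto
      ultimately show ?thesis using True by simp
    qed auto
  qed
  finally have main: "c * (\<delta> * S) \<le> (LBINT s:{0..S}. (poly r s)\<^sup>2 * s powr \<nu>)" .
  have "B\<^sup>2 = 4 * (16 * real M ^ 3) powr (1 + \<bar>\<nu>\<bar>) / S powr (\<nu> + 1) * (c * (\<delta> * S))"
  proof -
    have "(16 * real M ^ 3) powr (1 + \<bar>\<nu>\<bar>) = (1 / \<delta>) powr (1 + \<bar>\<nu>\<bar>)" by (simp add: \<delta>_def)
    also have "\<dots> = 1 / (\<delta> * \<delta> powr \<bar>\<nu>\<bar>)" using \<delta> by (simp add: powr_divide powr_add)
    finally have *: "(16 * real M ^ 3) powr (1 + \<bar>\<nu>\<bar>) = 1 / (\<delta> * \<delta> powr \<bar>\<nu>\<bar>)" .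
    have "\<delta> powr \<bar>\<nu>\<bar> \<noteq> 0" "S powr \<nu> \<noteq> 0" using \<delta> S by auto
    then show ?thesis unfolding * c_def using \<delta> S by (simp add: powr_add power2_eq_square)
  qed
  also have "\<dots> \<le> 4 * (16 * real M ^ 3) powr (1 + \<bar>\<nu>\<bar>) / S powr (\<nu> + 1) *
           (LBINT s:{0..S}. (poly r s)\<^sup>2 * s powr \<nu>)"
    by (intro mult_left_mono main) auto
  finally have "B\<^sup>2 \<le> \<dots>" .
  moreover have "(poly r t)\<^sup>2 \<le> B\<^sup>2" using max[OF t] by (simp add: B_def abs_le_square_iff)
  ultimately show ?thesis by linarith
qed

section \<open>Jacobi polynomials and their kernel\<close>

text \<open>Coefficients of 2F1(-n, n + \<nu> + 1; \<nu> + 1; v), that is, of the Jacobi polynomial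
  with parameters (\<nu>, 0) in the variable 1 - 2 v, normalized to the value 1 at v = 0.\<close>

definition jac_coeff :: "real \<Rightarrow> nat \<Rightarrow> nat \<Rightarrow> real" where
  "jac_coeff \<nu> n k = (-1) ^ k * real (n choose k) * pochhammer (real n + \<nu> + 1) k / pochhammer (\<nu> + 1) k"

definition jac :: "real \<Rightarrow> real \<Rightarrow> nat \<Rightarrow> real poly" where
  "jac \<nu> S n = (\<Sum>k\<le>n. monom (jac_coeff \<nu> n k / S ^ k) k)"

lemma pochhammer_pos_nu: "\<nu> > -1 \<Longrightarrow> pochhammer (\<nu> + 1) k > (0::real)"
  by (intro pochhammer_pos) auto

lemma coeff_jac: "coeff (jac \<nu> S n) k = (if k \<le> n then jac_coeff \<nu> n k / S ^ k else 0)"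
  unfolding jac_def coeff_sum coeff_monom by (simp add: sum.delta)

lemma poly_jac: "poly (jac \<nu> S n) t = (\<Sum>k\<le>n. jac_coeff \<nu> n k * (t / S) ^ k)"
  by (simp add: jac_def poly_sum poly_monom power_divide)

lemma degree_jac:
  assumes "\<nu> > -1" "S > 0" shows "degree (jac \<nu> S n) = n"
proof (rule antisym)
  show "degree (jac \<nu> S n) \<le> n" by (rule degree_le) (simp add: coeff_jac)
  have "pochhammer (real n + \<nu> + 1) n > 0" using assms by (intro pochhammer_pos) auto
  then have "coeff (jac \<nu> S n) n \<noteq> 0" using assms pochhammer_pos_nu[OF assms(1), of n]
    by (simp add: coeff_jac jac_coeff_def)
  then show "n \<le> degree (jac \<nu> S n)" by (rule le_degree)
qed

lemma prod_differences:
  assumes "k \<le> n"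
  shows "(\<Prod>l\<in>{..n} - {k}. (real l - real k)) = (-1) ^ k * fact k * fact (n - k)"
proof -
  have eq: "{..n} - {k} = {..<k} \<union> {k<..n}" using assms by auto
  have "(\<Prod>l\<in>{..n} - {k}. (real l - real k)) =
      (\<Prod>l<k. (real l - real k)) * (\<Prod>l\<in>{k<..n}. (real l - real k))"
    unfolding eq by (rule prod.union_disjoint) auto
  also have "(\<Prod>l<k. (real l - real k)) = (\<Prod>l<k. - real (k - l))"
    by (intro prod.cong) auto
  also have "\<dots> = (-1) ^ k * (\<Prod>l<k. real (k - l))"
    by (subst prod_uminus) simp
  also have "(\<Prod>l<k. real (k - l)) = fact k"
    by (simp add: fact_prod_rev lessThan_atLeast0)
  also have "(\<Prod>l\<in>{k<..n}. (real l - real k)) = (\<Prod>i\<in>{1..n-k}. real i)"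
    by (rule prod.reindex_bij_witness[of _ "\<lambda>i. i + k" "\<lambda>l. l - k"]) auto
  also have "\<dots> = fact (n - k)" by (simp add: fact_prod)
  finally show ?thesis .
qed

text \<open>The left-hand side is the Mellin transform of a Jacobi polynomial, so its zeros at
  \<open>s = 0, \<dots>, n - 1\<close> are the orthogonality relations.\<close>

lemma jac_partial_fractions:
  assumes nu: "\<nu> > -1" and s: "s \<ge> 0"
  shows "(\<Sum>k\<le>n. jac_coeff \<nu> n k / (s + real k + \<nu> + 1)) =
    (-1) ^ n * fact n / pochhammer (\<nu> + 1) n * (\<Prod>i<n. s - real i) / (\<Prod>k\<le>n. s + real k + \<nu> + 1)"
proof -
  define c where "c = (-1) ^ n * fact n / pochhammer (\<nu> + 1) n"
  \<comment> \<open>Multiplied by the common denominator, both sides are polynomials in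
    \<open>s\<close> of degree at most \<open>n\<close>. They are compared at the
    \<open>n + 1\<close> poles, where only one summand of \<open>A\<close> survives.\<close>
  define A where "A = (\<Sum>k\<le>n. smult (jac_coeff \<nu> n k) (\<Prod>l\<in>{..n} - {k}. [:real l + \<nu> + 1, 1:]))"
  define B where "B = smult c (\<Prod>i<n. [:- real i, 1:])"
  have "A = B"
  proof (rule poly_eqI_degree)
    fix x assume "x \<in> (\<lambda>k. - \<nu> - 1 - real k) ` {..n}"
    then obtain k where k: "k \<le> n" and x: "x = - \<nu> - 1 - real k" by blast
    have "poly A x = (\<Sum>j\<le>n. if j = k then jac_coeff \<nu> n k * (\<Prod>l\<in>{..n} - {k}. (real l - real k)) else 0)"
      unfolding A_def poly_sum
    proof (intro sum.cong refl)
      fix j assume "j \<in> {..n}"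
      show "poly (smult (jac_coeff \<nu> n j) (\<Prod>l\<in>{..n} - {j}. [:real l + \<nu> + 1, 1:])) x =
        (if j = k then jac_coeff \<nu> n k * (\<Prod>l\<in>{..n} - {k}. (real l - real k)) else 0)"
      proof (cases "j = k")
        case True
        then show ?thesis by (simp add: poly_prod x)
      next
        case False
        then have "(\<Prod>l\<in>{..n} - {j}. poly [:real l + \<nu> + 1, 1:] x) = 0"
          using k by (intro prod_zero bexI[of _ k]) (auto simp: x)
        then show ?thesis using False by (simp only: poly_smult poly_prod) simp
      qed
    qed
    also have "\<dots> = jac_coeff \<nu> n k * ((-1) ^ k * fact k * fact (n - k))"
      using k by (simp add: prod_differences)
    also have "\<dots> = fact n * pochhammer (real n + \<nu> + 1) k / pochhammer (\<nu> + 1) k"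
    proof -
      have "fact k * fact (n - k) * (n choose k) = fact n" by (rule binomial_fact_lemma[OF k])
      then have "fact k * fact (n - k) * real (n choose k) = fact n"
        by (metis of_nat_fact of_nat_mult)
      moreover have "(-1) ^ k * (-1) ^ k = (1 :: real)" by (simp flip: power_mult_distrib)
      moreover have "jac_coeff \<nu> n k * ((-1) ^ k * fact k * fact (n - k)) =
        ((-1) ^ k * (-1) ^ k) * (fact k * fact (n - k) * real (n choose k)) *
        (pochhammer (real n + \<nu> + 1) k / pochhammer (\<nu> + 1) k)"
        unfolding jac_coeff_def by (simp only: mult_ac times_divide_eq_right times_divide_eq_left)
      ultimately show ?thesis by simp
    qed
    also have "\<dots> = fact n * pochhammer (\<nu> + 1 + real k) n / pochhammer (\<nu> + 1) n"
    proof -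
      \<comment> \<open>Both products are the Pochhammer symbol of length \<open>n + k\<close>,
        split in two ways.\<close>
      have "pochhammer (\<nu> + 1) n * pochhammer (\<nu> + 1 + real n) k = pochhammer (\<nu> + 1) k * pochhammer (\<nu> + 1 + real k) n"
        by (metis pochhammer_product' add.commute)
      then show ?thesis using pochhammer_pos_nu[OF nu, of n] pochhammer_pos_nu[OF nu, of k]
        by (simp add: field_simps)
    qed
    also have "\<dots> = c * (\<Prod>i<n. - (\<nu> + 1 + real k + real i))"
    proof -
      have "(\<Prod>i<n. - (\<nu> + 1 + real k + real i)) = (-1) ^ n * pochhammer (\<nu> + 1 + real k) n"
        by (subst prod_uminus) (simp add: pochhammer_prod lessThan_atLeast0)
      then show ?thesis by (simp add: c_def flip: power_mult_distrib)
    qed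
    also have "\<dots> = poly B x"
    proof -
      have "(\<Prod>i<n. - (\<nu> + 1 + real k + real i)) = (\<Prod>i<n. poly [:- real i, 1:] x)"
        by (intro prod.cong) (auto simp: x)
      then show ?thesis by (simp only: B_def poly_smult poly_prod)
    qed
    finally show "poly A x = poly B x" .
  next
    have inj: "inj_on (\<lambda>k. - \<nu> - 1 - real k) {..n}" by (auto simp: inj_on_def)
    have card: "card ((\<lambda>k. - \<nu> - 1 - real k) ` {..n}) = Suc n" by (simp add: card_image[OF inj])
    have "degree (\<Prod>l\<in>{..n} - {k}. [:real l + \<nu> + 1, 1:]) \<le> n" if "k \<le> n" for k
      using degree_prod_sum_le[of "{..n} - {k}" "\<lambda>l. [:real l + \<nu> + 1, 1:]"] that by simp
    then have "degree A \<le> n" unfolding A_def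
      by (intro degree_sum_le) (auto intro!: order_trans[OF degree_smult_le] simp del: degree_smult_eq)
    moreover have "degree (\<Prod>i<n. [:- real i, 1:]) \<le> n"
      using degree_prod_sum_le[of "{..<n}" "\<lambda>i. [:- real i, 1:]"] by simp
    then have "degree B \<le> n" unfolding B_def by (rule order_trans[OF degree_smult_le])
    ultimately show "degree A < card ((\<lambda>k. - \<nu> - 1 - real k) ` {..n})"
      "degree B < card ((\<lambda>k. - \<nu> - 1 - real k) ` {..n})" unfolding card by auto
  qed
  then have "poly A s = poly B s" by simp
  moreover have "poly B s = c * (\<Prod>i<n. s - real i)" by (simp add: B_def poly_prod)
  moreover have "poly A s = (\<Prod>k\<le>n. s + real k + \<nu> + 1) * (\<Sum>k\<le>n. jac_coeff \<nu> n k / (s + real k + \<nu> + 1))"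
    unfolding A_def poly_sum poly_smult poly_prod sum_distrib_left
  proof (intro sum.cong refl)
    fix k assume k: "k \<in> {..n}"
    have "(\<Prod>k\<le>n. s + real k + \<nu> + 1) = (s + real k + \<nu> + 1) * (\<Prod>l\<in>{..n}-{k}. s + real l + \<nu> + 1)"
      using k by (intro prod.remove) auto
    moreover have "(\<Prod>l\<in>{..n}-{k}. poly [:real l + \<nu> + 1, 1:] s) = (\<Prod>l\<in>{..n}-{k}. s + real l + \<nu> + 1)"
      by (intro prod.cong) auto
    moreover have "s + real k + \<nu> + 1 \<noteq> 0" using nu s by auto
    ultimately show "jac_coeff \<nu> n k * (\<Prod>l\<in>{..n}-{k}. poly [:real l + \<nu> + 1, 1:] s) =
       (\<Prod>k\<le>n. s + real k + \<nu> + 1) * (jac_coeff \<nu> n k / (s + real k + \<nu> + 1))"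
      by simp
  qed
  moreover have "(\<Prod>k\<le>n. s + real k + \<nu> + 1) > 0" using nu s by (intro prod_pos) auto
  ultimately show ?thesis unfolding c_def[symmetric] by (intro eq_divide_imp) (simp_all only: mult.commute)
qed

text \<open>The reciprocal of the squared norm of \<open>jac \<nu> 1 n\<close>; passing to [0, S]
  multiplies the squared norm by \<open>S powr (\<nu> + 1)\<close>.\<close>

definition jac_norm :: "real \<Rightarrow> nat \<Rightarrow> real" where
  "jac_norm \<nu> n = (2 * real n + \<nu> + 1) * (pochhammer (\<nu> + 1) n / fact n)\<^sup>2"

definition jac_kernel :: "real \<Rightarrow> real \<Rightarrow> nat \<Rightarrow> real \<Rightarrow> real \<Rightarrow> real" where
  "jac_kernel \<nu> S M x y =
     (\<Sum>i<M. jac_norm \<nu> i / S powr (\<nu> + 1) * poly (jac \<nu> S i) x * poly (jac \<nu> S i) y)"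

locale jacobi =
  fixes \<nu> S :: real
  assumes S_pos: "S > 0" and nu_gt: "\<nu> > -1"
begin

sublocale power_weight "\<lambda>t. t powr \<nu>" S \<nu>
  by (rule power_weight_powr[OF S_pos nu_gt])

lemma wip_monom: "wip (monom 1 j) (monom 1 k) = S powr (real (j + k) + \<nu> + 1) / (real (j + k) + \<nu> + 1)"
proof -
  have "wip (monom 1 j) (monom 1 k) = (LBINT t:{0..S}. t powr (real (j + k) + \<nu>))"
    unfolding wip_def
  proof (rule set_lebesgue_integral_cong)
    show "\<forall>t. t \<in> {0..S} \<longrightarrow> poly (monom 1 j) t * poly (monom 1 k) t * t powr \<nu> = t powr (real (j + k) + \<nu>)"
    proof (intro allI impI)
      fix t assume "t \<in> {0..S}"
      then show "poly (monom 1 j) t * poly (monom 1 k) t * t powr \<nu> = t powr (real (j + k) + \<nu>)"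
        by (cases "t = 0") (auto simp: poly_monom powr_add powr_realpow power_add simp flip: of_nat_add)
    qed
  qed auto
  also have "\<dots> = S powr (real (j + k) + \<nu> + 1) / (real (j + k) + \<nu> + 1)"
    using nu_gt S_pos by (intro powr_set_integral) auto
  finally show ?thesis .
qed

lemma wip_sum_right: "wip r (\<Sum>i\<in>A. f i) = (\<Sum>i\<in>A. wip r (f i))"
  by (simp add: ip_commute[of r] ip_sum)

text \<open>Term by term the integral is the partial fraction sum at \<open>s = j\<close>. The
  product over \<open>i < n\<close> vanishes exactly for \<open>j < n\<close>, and its value at
  \<open>j = n\<close> gives the norm.\<close>

lemma wip_monom_jac:
  "wip (monom 1 j) (jac \<nu> S n) = S powr (real j + \<nu> + 1) *
     ((-1) ^ n * fact n / pochhammer (\<nu> + 1) n * (\<Prod>i<n. real j - real i) / (\<Prod>k\<le>n. real j + real k + \<nu> + 1))"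
proof -
  have "jac \<nu> S n = (\<Sum>k\<le>n. smult (jac_coeff \<nu> n k / S ^ k) (monom 1 k))"
    by (simp add: jac_def smult_monom)
  then have "wip (monom 1 j) (jac \<nu> S n) =
      (\<Sum>k\<le>n. jac_coeff \<nu> n k / S ^ k * (S powr (real (j + k) + \<nu> + 1) / (real (j + k) + \<nu> + 1)))"
    by (simp only: wip_sum_right ip_smult_right wip_monom)
  also have "\<dots> = (\<Sum>k\<le>n. S powr (real j + \<nu> + 1) * (jac_coeff \<nu> n k / (real j + real k + \<nu> + 1)))"
  proof (intro sum.cong refl)
    fix k
    have "S powr (real (j + k) + \<nu> + 1) = S powr ((real j + \<nu> + 1) + real k)" by (simp add: add_ac)
    also have "\<dots> = S powr (real j + \<nu> + 1) * S ^ k" using S_pos by (subst powr_add) (simp add: powr_realpow)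
    finally have *: "S powr (real (j + k) + \<nu> + 1) = S powr (real j + \<nu> + 1) * S ^ k" .
    show "jac_coeff \<nu> n k / S ^ k * (S powr (real (j + k) + \<nu> + 1) / (real (j + k) + \<nu> + 1)) =
      S powr (real j + \<nu> + 1) * (jac_coeff \<nu> n k / (real j + real k + \<nu> + 1))"
      unfolding * using S_pos by simp
  qed
  also have "\<dots> = S powr (real j + \<nu> + 1) *
     ((-1) ^ n * fact n / pochhammer (\<nu> + 1) n * (\<Prod>i<n. real j - real i) / (\<Prod>k\<le>n. real j + real k + \<nu> + 1))"
    unfolding sum_distrib_left[symmetric] by (subst jac_partial_fractions) (use nu_gt in auto)
  finally show ?thesis .
qed

lemma wip_jac_less: "m < n \<Longrightarrow> wip (jac \<nu> S m) (jac \<nu> S n) = 0"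
proof -
  assume mn: "m < n"
  have "jac \<nu> S m = (\<Sum>k\<le>m. smult (jac_coeff \<nu> m k / S ^ k) (monom 1 k))"
    by (simp add: jac_def smult_monom)
  then have "wip (jac \<nu> S m) (jac \<nu> S n) =
      (\<Sum>k\<le>m. jac_coeff \<nu> m k / S ^ k * wip (monom 1 k) (jac \<nu> S n))"
    by (simp only: ip_sum ip_smult)
  also have "\<dots> = 0"
  proof (intro sum.neutral ballI)
    fix k assume "k \<in> {..m}"
    then have "(\<Prod>i<n. real k - real i) = 0" using mn by (intro prod_zero) auto
    then show "jac_coeff \<nu> m k / S ^ k * wip (monom 1 k) (jac \<nu> S n) = 0"
      by (simp add: wip_monom_jac)
  qed
  finally show ?thesis .
qed

lemma wip_jac_self: "wip (jac \<nu> S n) (jac \<nu> S n) = S powr (\<nu> + 1) / jac_norm \<nu> n"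
proof -
  have "jac \<nu> S n = (\<Sum>k\<le>n. smult (jac_coeff \<nu> n k / S ^ k) (monom 1 k))"
    by (simp add: jac_def smult_monom)
  then have "wip (jac \<nu> S n) (jac \<nu> S n) =
      (\<Sum>k\<le>n. jac_coeff \<nu> n k / S ^ k * wip (monom 1 k) (jac \<nu> S n))"
    by (metis (no_types, lifting) ip_sum ip_smult sum.cong)
  also have "\<dots> = (\<Sum>k\<le>n. if k = n then jac_coeff \<nu> n n / S ^ n * wip (monom 1 n) (jac \<nu> S n) else 0)"
  proof (intro sum.cong refl)
    fix k assume "k \<in> {..n}"
    then have "k \<noteq> n \<Longrightarrow> (\<Prod>i<n. real k - real i) = 0" by (intro prod_zero) auto
    then show "jac_coeff \<nu> n k / S ^ k * wip (monom 1 k) (jac \<nu> S n) =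
      (if k = n then jac_coeff \<nu> n n / S ^ n * wip (monom 1 n) (jac \<nu> S n) else 0)"
      by (auto simp: wip_monom_jac)
  qed
  also have "\<dots> = jac_coeff \<nu> n n / S ^ n * wip (monom 1 n) (jac \<nu> S n)" by simp
  also have "wip (monom 1 n) (jac \<nu> S n) = S ^ n * S powr (\<nu> + 1) *
     ((-1) ^ n * fact n / pochhammer (\<nu> + 1) n * fact n /
      (pochhammer (real n + \<nu> + 1) n * (2 * real n + \<nu> + 1)))"
  proof -
    have "(\<Prod>i<n. real n - real i) = (\<Prod>i<n. real (n - i))" by (intro prod.cong) auto
    also have "\<dots> = fact n" by (simp add: fact_prod_rev lessThan_atLeast0)
    finally have 1: "(\<Prod>i<n. real n - real i) = fact n" .
    have "(\<Prod>k\<le>n. real n + real k + \<nu> + 1) = (\<Prod>k\<le>n. real n + \<nu> + 1 + real k)"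
      by (intro prod.cong) auto
    also have "\<dots> = (\<Prod>k<n. real n + \<nu> + 1 + real k) * (2 * real n + \<nu> + 1)"
      by (simp add: lessThan_Suc_atMost[symmetric])
    also have "(\<Prod>k<n. real n + \<nu> + 1 + real k) = pochhammer (real n + \<nu> + 1) n"
      by (simp add: pochhammer_prod lessThan_atLeast0)
    finally have 2: "(\<Prod>k\<le>n. real n + real k + \<nu> + 1) = pochhammer (real n + \<nu> + 1) n * (2 * real n + \<nu> + 1)" .
    have "S powr (real n + (\<nu> + 1)) = S ^ n * S powr (\<nu> + 1)"
      using S_pos by (subst powr_add) (simp add: powr_realpow)
    then show ?thesis unfolding wip_monom_jac 1 2 by (simp add: add.assoc)
  qed
  finally have eq: "wip (jac \<nu> S n) (jac \<nu> S n) = jac_coeff \<nu> n n / S ^ n * (S ^ n * S powr (\<nu> + 1) *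
     ((-1) ^ n * fact n / pochhammer (\<nu> + 1) n * fact n /
      (pochhammer (real n + \<nu> + 1) n * (2 * real n + \<nu> + 1))))" .
  have "pochhammer (real n + \<nu> + 1) n > 0" using nu_gt by (intro pochhammer_pos) auto
  then show ?thesis
    unfolding eq jac_coeff_def jac_norm_def using S_pos pochhammer_pos_nu[OF nu_gt, of n]
    by (cases "even n") (simp_all add: power2_eq_square mult_ac)
qed

lemma jac_norm_pos: "jac_norm \<nu> n > 0"
  using nu_gt pochhammer_pos_nu[OF nu_gt, of n] by (auto simp: jac_norm_def intro!: mult_pos_pos)

definition jac_on :: "nat \<Rightarrow> real poly" where
  "jac_on n = smult (sqrt (jac_norm \<nu> n / S powr (\<nu> + 1))) (jac \<nu> S n)"

lemma degree_jac_on: "degree (jac_on n) = n"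
  using jac_norm_pos[of n] S_pos nu_gt by (simp add: jac_on_def degree_jac)

lemma orthonormal_jac_on: "orthonormal_upto M jac_on"
proof -
  have "wip (jac_on i) (jac_on i) = 1" for i
  proof -
    have "jac_norm \<nu> i / S powr (\<nu> + 1) \<ge> 0" using jac_norm_pos[of i] by simp
    then have "sqrt (jac_norm \<nu> i / S powr (\<nu> + 1)) * (sqrt (jac_norm \<nu> i / S powr (\<nu> + 1)) * z)
       = jac_norm \<nu> i / S powr (\<nu> + 1) * z" for z by (simp only: mult.assoc[symmetric] real_sqrt_mult_self abs_of_nonneg)
    then show ?thesis using wip_jac_self[of i] jac_norm_pos[of i] S_pos
      by (simp only: jac_on_def ip_smult ip_smult_right) simp
  qed
  moreover have "wip (jac_on i) (jac_on j) = 0" if "i \<noteq> j" for i j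
    using that wip_jac_less[of i j] wip_jac_less[of j i] ip_commute[of "jac \<nu> S i" "jac \<nu> S j"]
    by (cases i j rule: linorder_cases) (auto simp: jac_on_def ip_smult ip_smult_right)
  ultimately have "wip (jac_on i) (jac_on j) = (if i = j then 1 else 0)" for i j by simp
  then show ?thesis by (simp add: orthonormal_upto_def degree_jac_on)
qed

lemma jac_kernel_eq: "jac_kernel \<nu> S M x y = (\<Sum>i<M. poly (jac_on i) x * poly (jac_on i) y)"
  unfolding jac_kernel_def
proof (intro sum.cong refl)
  fix i
  have "sqrt (jac_norm \<nu> i / S powr (\<nu> + 1)) * sqrt (jac_norm \<nu> i / S powr (\<nu> + 1)) = jac_norm \<nu> i / S powr (\<nu> + 1)"
    using jac_norm_pos[of i] by simp
  then show "jac_norm \<nu> i / S powr (\<nu> + 1) * poly (jac \<nu> S i) x * poly (jac \<nu> S i) y =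
      poly (jac_on i) x * poly (jac_on i) y"
    unfolding jac_on_def poly_smult by (metis mult.assoc mult.left_commute)
qed

lemma jac_kernel_bound:
  assumes "q = 0 \<or> degree q < M"
  shows "(poly q x)\<^sup>2 \<le> jac_kernel \<nu> S M x x * wip q q"
  using eval_bound[OF orthonormal_jac_on assms, of x] by (simp add: jac_kernel_eq power2_eq_square)

lemma wip_eq: "wip q q = (LBINT s:{0..S}. (poly q s)\<^sup>2 * s powr \<nu>)"
  by (simp add: wip_def power2_eq_square)

end

section \<open>The scaling limit of the Jacobi kernel\<close>

text \<open>The entire part of the Bessel function: \<open>J\<^sub>\<nu>(a) = (a / 2) powr \<nu> / \<Gamma>(\<nu> + 1) * bess_e \<nu> (a\<^sup>2 / 4)\<close>.\<close>

definition bess_e :: "real \<Rightarrow> real \<Rightarrow> real" where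
  "bess_e \<nu> u = (\<Sum>k. (- u) ^ k / (fact k * pochhammer (\<nu> + 1) k))"

text \<open>Only the first factor \<open>\<nu> + 1\<close> can be below 1. With this bound the
  exponential series majorizes both \<open>bess_e\<close> and the Jacobi polynomials.\<close>

lemma pochhammer_lower:
  assumes "\<nu> > (-1::real)" shows "min 1 (\<nu> + 1) \<le> pochhammer (\<nu> + 1) k"
proof (induction k)
  case (Suc k)
  show ?case
  proof (cases "k = 0")
    case False
    then have "real k \<ge> 1" by simp
    then have "pochhammer (\<nu> + 1) k * 1 \<le> pochhammer (\<nu> + 1) k * (\<nu> + 1 + real k)"
      using pochhammer_pos_nu[OF assms, of k] assms by (intro mult_left_mono) linarith+
    then show ?thesis using Suc by (simp add: pochhammer_Suc)
  qed simp
qed simp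

lemma bess_term_bound:
  assumes "\<nu> > (-1::real)" "\<bar>a\<bar> \<le> X ^ k" "X \<ge> 0"
  shows "\<bar>a / (fact k * pochhammer (\<nu> + 1) k)\<bar> \<le> X ^ k / fact k / min 1 (\<nu> + 1)"
proof -
  have "\<bar>a / (fact k * pochhammer (\<nu> + 1) k)\<bar> = \<bar>a\<bar> / (fact k * pochhammer (\<nu> + 1) k)"
    using pochhammer_pos_nu[OF assms(1), of k] by (simp add: abs_mult)
  also have "\<dots> \<le> X ^ k / (fact k * min 1 (\<nu> + 1))"
    using assms pochhammer_lower[OF assms(1), of k]
    by (intro frac_le mult_left_mono mult_pos_pos) auto
  finally show ?thesis by (simp add: mult.commute)
qed

lemma summable_bess_bound: "summable (\<lambda>k. X ^ k / fact k / c :: real)"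
  using summable_divide[OF summable_exp[of X], of c] by (simp add: field_simps)

lemma suminf_bess_bound: "(\<Sum>k. X ^ k / fact k / c) = exp X / (c :: real)"
proof -
  have "summable (\<lambda>k. X ^ k / fact k)" using summable_bess_bound[of X 1] by simp
  then have "(\<Sum>k. X ^ k / fact k / c) = (\<Sum>k. X ^ k / fact k) / c"
    by (rule suminf_divide)
  then show ?thesis by (simp add: exp_def scaleR_conv_of_real divide_inverse mult.commute)
qed

lemma summable_bess_e:
  assumes "\<nu> > (-1::real)"
  shows "summable (\<lambda>k. (- u) ^ k / (fact k * pochhammer (\<nu> + 1) k))"
proof (rule summable_comparison_test'[OF summable_bess_bound[of "\<bar>u\<bar>" "min 1 (\<nu> + 1)"]])
  fix k
  show "norm ((- u) ^ k / (fact k * pochhammer (\<nu> + 1) k)) \<le> \<bar>u\<bar> ^ k / fact k / min 1 (\<nu> + 1)"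
    using bess_term_bound[OF assms, of "(- u) ^ k" "\<bar>u\<bar>" k] by (simp add: power_abs)
qed

section \<open>Mehler-Heine asymptotics of the Jacobi polynomials\<close>

definition jsum :: "real \<Rightarrow> nat \<Rightarrow> real \<Rightarrow> real" where
  "jsum \<nu> n v = (\<Sum>k\<le>n. jac_coeff \<nu> n k * v ^ k)"

lemma poly_jac_jsum: "poly (jac \<nu> S n) t = jsum \<nu> n (t / S)"
  by (simp add: poly_jac jsum_def)

text \<open>A product of \<open>k\<close> factors suits the scaling n^2 v -> u: each factor tends to
  - u, and for l < n it is at most n (n + \<nu> + 1) \<bar>v\<bar> in modulus, since (n - l)(n +
  \<nu> + 1 + l) = n (n + \<nu> + 1) - l (\<nu> + 1 + l).\<close>

lemma jac_coeff_prod: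
  assumes "\<nu> > -1"
  shows "jac_coeff \<nu> n k * v ^ k =
     (\<Prod>l<k. - ((real n - real l) * (real n + \<nu> + 1 + real l) * v)) / (fact k * pochhammer (\<nu> + 1) k)"
proof -
  have "real (n choose k) * fact k = (\<Prod>l<k. real n - real l)"
    by (simp add: binomial_gbinomial gbinomial_prod_rev lessThan_atLeast0)
  moreover have "pochhammer (real n + \<nu> + 1) k = (\<Prod>l<k. real n + \<nu> + 1 + real l)"
    by (simp add: pochhammer_prod lessThan_atLeast0)
  ultimately have "(\<Prod>l<k. - ((real n - real l) * (real n + \<nu> + 1 + real l) * v)) =
     (-1) ^ k * (real (n choose k) * fact k) * pochhammer (real n + \<nu> + 1) k * v ^ k"
    by (subst prod_uminus) (simp add: prod.distrib)
  then show ?thesis using pochhammer_pos_nu[OF assms, of k]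
    by (simp add: jac_coeff_def)
qed

lemma jac_coeff_eq_0: "k > n \<Longrightarrow> jac_coeff \<nu> n k = 0"
  by (simp add: jac_coeff_def binomial_eq_0)

lemma jac_coeff_bound:
  assumes nu: "\<nu> > -1" and X: "real n * (real n + \<nu> + 1) * \<bar>v\<bar> \<le> X"
  shows "\<bar>jac_coeff \<nu> n k * v ^ k\<bar> \<le> X ^ k / fact k / min 1 (\<nu> + 1)"
proof -
  have X0: "X \<ge> 0" using X nu by (intro order_trans[OF _ X] mult_nonneg_nonneg) auto
  show ?thesis
  proof (cases "k > n")
    case True
    then show ?thesis using X0 nu by (simp add: jac_coeff_eq_0)
  next
    case False
    have "\<bar>\<Prod>l<k. - ((real n - real l) * (real n + \<nu> + 1 + real l) * v)\<bar> \<le> (\<Prod>l<k. X)"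
      unfolding abs_prod
    proof (intro prod_mono conjI)
      fix l assume "l \<in> {..<k}"
      then have l: "real l < real n" using False by simp
      have "0 \<le> real l * (\<nu> + 1 + real l)" using nu by (intro mult_nonneg_nonneg) auto
      then have le: "(real n - real l) * (real n + \<nu> + 1 + real l) \<le> real n * (real n + \<nu> + 1)"
        by (simp add: algebra_simps)
      have "0 \<le> (real n - real l) * (real n + \<nu> + 1 + real l)"
        using l nu by (intro mult_nonneg_nonneg) auto
      then have "\<bar>- ((real n - real l) * (real n + \<nu> + 1 + real l) * v)\<bar> =
         (real n - real l) * (real n + \<nu> + 1 + real l) * \<bar>v\<bar>" by (simp only: abs_minus_cancel abs_mult[of _ v] abs_of_nonneg)
      also have "\<dots> \<le> real n * (real n + \<nu> + 1) * \<bar>v\<bar>" by (intro mult_right_mono le) auto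
      finally show "\<bar>- ((real n - real l) * (real n + \<nu> + 1 + real l) * v)\<bar> \<le> X" using X by linarith
    qed auto
    then show ?thesis unfolding jac_coeff_prod[OF nu]
      by (intro bess_term_bound[OF nu _ X0]) simp
  qed
qed

lemma jsum_bound:
  assumes nu: "\<nu> > -1" and X: "real n * (real n + \<nu> + 1) * \<bar>v\<bar> \<le> X"
  shows "\<bar>jsum \<nu> n v\<bar> \<le> exp X / min 1 (\<nu> + 1)"
proof -
  have X0: "X \<ge> 0" using X nu by (intro order_trans[OF _ X] mult_nonneg_nonneg) auto
  have "\<bar>jsum \<nu> n v\<bar> \<le> (\<Sum>k\<le>n. X ^ k / fact k / min 1 (\<nu> + 1))"
    unfolding jsum_def by (intro order_trans[OF sum_abs] sum_mono jac_coeff_bound[OF nu X])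
  also have "\<dots> \<le> (\<Sum>k. X ^ k / fact k / min 1 (\<nu> + 1))"
    using X0 nu by (intro sum_le_suminf summable_bess_bound) auto
  also have "\<dots> = exp X / min 1 (\<nu> + 1)" by (rule suminf_bess_bound)
  finally show ?thesis .
qed

text \<open>Tannery's theorem with an exponential majorant. The hypotheses on \<open>i * v\<close>
  and \<open>v\<close> remove the lower-order terms of (i - l)(i + \<nu> + 1 + l) v.\<close>

lemma jsum_limit:
  assumes nu: "\<nu> > -1"
    and u: "(\<lambda>j. (real (i j))\<^sup>2 * v j) \<longlonglongrightarrow> u"
    and v1: "(\<lambda>j. real (i j) * v j) \<longlonglongrightarrow> 0" and v0: "v \<longlonglongrightarrow> 0"
  shows "(\<lambda>j. jsum \<nu> (i j) (v j)) \<longlonglongrightarrow> bess_e \<nu> u"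
proof -
  have "(\<lambda>j. (real (i j))\<^sup>2 * v j + (\<nu> + 1) * (real (i j) * v j)) \<longlonglongrightarrow> u + (\<nu> + 1) * 0"
    by (intro tendsto_intros u v1)
  then have "Bseq (\<lambda>j. (real (i j))\<^sup>2 * v j + (\<nu> + 1) * (real (i j) * v j))"
    by (intro convergent_imp_Bseq convergentI)
  then obtain X where X: "\<And>j. \<bar>(real (i j))\<^sup>2 * v j + (\<nu> + 1) * (real (i j) * v j)\<bar> \<le> X"
    by (auto simp: Bseq_def)
  have X': "real (i j) * (real (i j) + \<nu> + 1) * \<bar>v j\<bar> \<le> X" for j
  proof -
    have "real (i j) * (real (i j) + \<nu> + 1) * \<bar>v j\<bar> = \<bar>real (i j) * (real (i j) + \<nu> + 1) * v j\<bar>"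
      using nu by (simp add: abs_mult)
    also have "real (i j) * (real (i j) + \<nu> + 1) * v j = (real (i j))\<^sup>2 * v j + (\<nu> + 1) * (real (i j) * v j)"
      by (simp add: power2_eq_square algebra_simps)
    finally show ?thesis using X[of j] by simp
  qed
  have "((\<lambda>j. \<Sum>k. jac_coeff \<nu> (i j) k * v j ^ k) \<longlongrightarrow> bess_e \<nu> u) sequentially"
    unfolding bess_e_def
  proof (rule tannerys_theorem[THEN conjunct2, THEN conjunct2])
    fix k
    have "(\<lambda>j. - ((real (i j) - real l) * (real (i j) + \<nu> + 1 + real l) * v j)) \<longlonglongrightarrow> - u" for l
    proof -
      have "(\<lambda>j. - ((real (i j))\<^sup>2 * v j + (\<nu> + 1) * (real (i j) * v j) - real l * (\<nu> + 1 + real l) * v j)) \<longlonglongrightarrow>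
         - (u + (\<nu> + 1) * 0 - real l * (\<nu> + 1 + real l) * 0)"
        by (intro tendsto_intros u v1 v0)
      then show ?thesis by (simp add: power2_eq_square algebra_simps)
    qed
    then have "(\<lambda>j. \<Prod>l<k. - ((real (i j) - real l) * (real (i j) + \<nu> + 1 + real l) * v j)) \<longlonglongrightarrow> (\<Prod>l<k. - u)"
      by (intro tendsto_prod)
    then show "(\<lambda>j. jac_coeff \<nu> (i j) k * v j ^ k) \<longlonglongrightarrow> (- u) ^ k / (fact k * pochhammer (\<nu> + 1) k)"
      unfolding jac_coeff_prod[OF nu] using pochhammer_pos_nu[OF nu, of k]
      by (intro tendsto_divide tendsto_const) (auto simp: prod_constant)
  next
    show "\<forall>\<^sub>F (k, j) in sequentially \<times>\<^sub>F sequentially.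
       norm (jac_coeff \<nu> (i j) k * v j ^ k) \<le> X ^ k / fact k / min 1 (\<nu> + 1)"
      using jac_coeff_bound[OF nu X'] by (intro always_eventually) auto
  qed (use summable_bess_bound[of X "min 1 (\<nu> + 1)"] in simp_all)
  moreover have "(\<Sum>k. jac_coeff \<nu> n k * w ^ k) = jsum \<nu> n w" for n w
    unfolding jsum_def by (intro suminf_finite) (auto simp: jac_coeff_eq_0)
  ultimately show ?thesis by simp
qed

text \<open>Gauss's limit for the reciprocal Gamma function. The denominator has
  \<open>n + 1\<close> in place of \<open>n\<close> so that the quotient is meaningful at
  \<open>n = 0\<close>, the first summand of the kernel.\<close>

lemma pochhammer_ratio_limit:
  assumes nu: "\<nu> > -1"
  shows "(\<lambda>n. pochhammer (\<nu> + 1) n / fact n / (real n + 1) powr \<nu>) \<longlonglongrightarrow> rGamma (\<nu> + 1)"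
proof -
  have 1: "(\<lambda>n. rGamma_series (\<nu> + 1) n) \<longlonglongrightarrow> rGamma (\<nu> + 1)" by (rule rGamma_series_LIMSEQ)
  have "(\<lambda>n. 1 / (1 + c * inverse (real n))) \<longlonglongrightarrow> 1 / (1 + c * 0)" for c
    by (intro tendsto_intros lim_inverse_n) auto
  moreover have "\<forall>\<^sub>F n in sequentially. 1 / (1 + c * inverse (real n)) = real n / (real n + c)" for c
    using eventually_gt_at_top[of 0] by eventually_elim (simp add: field_simps)
  ultimately have quot: "(\<lambda>n. real n / (real n + c)) \<longlonglongrightarrow> 1" for c
    by (auto intro: Lim_transform_eventually)
  have 2: "(\<lambda>n. real n / (real n + \<nu> + 1)) \<longlonglongrightarrow> 1" using quot[of "\<nu> + 1"] by (simp add: add.assoc)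
  have 3: "(\<lambda>n. (real n / (real n + 1)) powr \<nu>) \<longlonglongrightarrow> 1 powr \<nu>"
    by (intro tendsto_powr tendsto_const quot) auto
  have "(\<lambda>n. rGamma_series (\<nu> + 1) n * (real n / (real n + \<nu> + 1)) * (real n / (real n + 1)) powr \<nu>)
      \<longlonglongrightarrow> rGamma (\<nu> + 1) * 1 * 1 powr \<nu>"
    by (intro tendsto_mult 1 2 3)
  moreover have "\<forall>\<^sub>F n in sequentially. rGamma_series (\<nu> + 1) n * (real n / (real n + \<nu> + 1)) * (real n / (real n + 1)) powr \<nu>
     = pochhammer (\<nu> + 1) n / fact n / (real n + 1) powr \<nu>"
    using eventually_gt_at_top[of 0]
  proof eventually_elim
    case (elim n)
    have pos: "real n + \<nu> + 1 > 0" using elim nu by (simp add: add_pos_nonneg)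
    have "exp ((\<nu> + 1) * ln (real n)) = real n powr \<nu> * real n"
      using elim by (simp add: powr_def exp_add distrib_right)
    then have "rGamma_series (\<nu> + 1) n = pochhammer (\<nu> + 1) n * (real n + \<nu> + 1) / (fact n * (real n powr \<nu> * real n))"
      by (simp add: rGamma_series_def pochhammer_Suc add_ac)
    moreover have "(real n / (real n + 1)) powr \<nu> = real n powr \<nu> / (real n + 1) powr \<nu>"
      by (rule powr_divide)
    moreover have "P * c / (f * (A * m)) * (m / c) * (A / B) = P / f / B"
      if "c > 0" "m > 0" "A > 0" for P c f A m B :: real
      using that by simp
    ultimately show ?case using pos elim by simp
  qed
  ultimately show ?thesis by (auto intro: Lim_transform_eventually)
qed

section \<open>Kernel sums as integrals of step functions\<close>

lemma has_integral_step:
  fixes g :: "nat \<Rightarrow> real"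
  assumes M: "M > 0"
  shows "((\<lambda>s. g (nat \<lfloor>s * real M\<rfloor>)) has_integral (\<Sum>i<m. g i / real M)) {0..real m / real M}"
proof (induction m)
  case (Suc m)
  let ?a = "real m / real M" and ?b = "real (Suc m) / real M"
  have ab: "?a \<le> ?b" using M by (simp add: divide_right_mono)
  have "((\<lambda>_. g m) has_integral (?b - ?a) * g m) {?a..?b}"
    using has_integral_const_real[of "g m" ?a ?b] ab by simp
  then have "((\<lambda>s. g (nat \<lfloor>s * real M\<rfloor>)) has_integral (?b - ?a) * g m) {?a..?b}"
  \<comment> \<open>At the right end point the floor has already jumped, so that point is taken
    out.\<close>
  proof (rule has_integral_spike_finite[of "{?b}", rotated 2])
    fix s assume s: "s \<in> {?a..?b} - {?b}"
    then have "real m \<le> s * real M" "s * real M < real m + 1" using M by (auto simp: field_simps)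
    then have "\<lfloor>s * real M\<rfloor> = int m" by (intro floor_unique) auto
    then show "g (nat \<lfloor>s * real M\<rfloor>) = g m" by simp
  qed auto
  moreover have "(?b - ?a) * g m = g m / real M"
    by (simp add: diff_divide_distrib[symmetric])
  ultimately have "((\<lambda>s. g (nat \<lfloor>s * real M\<rfloor>)) has_integral (\<Sum>i<m. g i / real M) + g m / real M) {0..?b}"
    using Suc ab M by (intro has_integral_combine[of 0 ?a ?b]) auto
  then show ?case by simp
qed (simp add: has_integral_refl)

text \<open>Up to the factors collected in \<open>bess_kernel_int\<close>, this is 1/4 times the
  integral over 0 < \<tau> < 1 of J(sqrt (\<tau> x)) J(sqrt (\<tau> y)), J of order \<nu>, after the
  substitution \<tau> = s^2.\<close>

definition bess_int :: "real \<Rightarrow> real \<Rightarrow> real \<Rightarrow> real" where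
  "bess_int \<nu> x y =
     integral {0<..<1} (\<lambda>s. 2 * s powr (2 * \<nu> + 1) * bess_e \<nu> (s\<^sup>2 * x / 4) * bess_e \<nu> (s\<^sup>2 * y / 4))"

lemma integrable_powr_bound:
  assumes "\<nu> > (-1::real)"
  shows "(\<lambda>s::real. C * (1 + s powr (2 * \<nu> + 1))) integrable_on {0<..<1}"
proof -
  have "(\<lambda>s::real. C * (1 + s powr (2 * \<nu> + 1))) integrable_on {0..1}"
    using assms by (intro integrable_on_mult_right integrable_add integrable_on_powr_from_0) auto
  then show ?thesis by (simp add: integrable_on_open_interval_real)
qed

lemma Bseq_bound:
  assumes "(f :: nat \<Rightarrow> real) \<longlonglongrightarrow> l" obtains B where "B > 0" "\<And>n. \<bar>f n\<bar> \<le> B"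
proof -
  have "Bseq f" using assms by (intro convergent_imp_Bseq convergentI)
  then show ?thesis using that by (auto simp: Bseq_def)
qed

text \<open>The exponent will be \<open>2 * \<nu> + 1\<close>, which may be negative, and
  \<open>z\<close> will be \<open>s\<close> rounded up to a multiple of 1 / M. The bound is then
  integrable over (0, 1) and independent of \<open>M\<close>.\<close>

lemma powr_unit_bound:
  fixes s z a :: real
  assumes "0 < s" "s \<le> z" "z \<le> 1" shows "z powr a \<le> 1 + s powr a"
proof (cases "a \<ge> 0")
  case True
  then have "z powr a \<le> 1" using assms by (intro powr_le1) auto
  then show ?thesis using powr_ge_zero[of s a] by linarith
next
  case False
  then have "z powr a \<le> s powr a" using assms by (intro powr_mono2') auto
  then show ?thesis by simp
qed

text \<open>The kernel is the integral over \<open>0 < s < 1\<close> of the step function that takes the \<open>i\<close>-th summand,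
  \<open>i = \<lfloor>s M\<rfloor>\<close>; each Jacobi polynomial converges to \<open>bess_e\<close> by the Mehler-Heine asymptotics.\<close>

theorem jac_kernel_limit:
  fixes M :: "nat \<Rightarrow> nat" and S x y :: "nat \<Rightarrow> real"
  assumes nu: "\<nu> > -1" and M1: "\<And>j. M j \<ge> 1" and S0: "\<And>j. S j > 0"
    and Mlim: "filterlim M at_top sequentially"
    and Slim: "(\<lambda>j. S j / (4 * (real (M j))\<^sup>2)) \<longlonglongrightarrow> \<gamma>" and \<gamma>: "\<gamma> > 0"
    and x: "x \<longlonglongrightarrow> x0" and y: "y \<longlonglongrightarrow> y0"
  shows "(\<lambda>j. jac_kernel \<nu> (S j) (M j) (x j) (y j)) \<longlonglongrightarrow>
     (1 / (4 * \<gamma>)) powr (\<nu> + 1) * (rGamma (\<nu> + 1))\<^sup>2 * bess_int \<nu> (x0 / \<gamma>) (y0 / \<gamma>)"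
proof -
  define b where "b = (\<lambda>n. pochhammer (\<nu> + 1) n / fact n / (real n + 1) powr \<nu>)"
  define D where "D = (\<lambda>j. (real (M j))\<^sup>2 / S j)"
  define ii where "ii = (\<lambda>j s. nat \<lfloor>s * real (M j)\<rfloor>)"
  \<comment> \<open>This is \<open>M\<close> times the i-th summand of the kernel, with the powers
    of \<open>M\<close> and \<open>S\<close> distributed so that every factor converges along i =
    \<lfloor>s M\<rfloor>.\<close>
  define F where "F = (\<lambda>j i. D j powr (\<nu> + 1) * ((2 * real i + \<nu> + 1) / real (M j)) *
      (b i)\<^sup>2 * ((real i + 1) / real (M j)) powr (2 * \<nu>) * (jsum \<nu> i (x j / S j) * jsum \<nu> i (y j / S j)))"
  have Mpos: "real (M j) > 0" for j using M1[of j] by simp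
  have Dpos: "D j > 0" for j using Mpos S0 by (simp add: D_def)
  have Mreal: "filterlim (\<lambda>j. real (M j)) at_top sequentially"
    by (rule filterlim_compose[OF filterlim_real_sequentially Mlim])
  have D: "D \<longlonglongrightarrow> 1 / (4 * \<gamma>)"
  proof -
    have "(\<lambda>j. 1 / (4 * (S j / (4 * (real (M j))\<^sup>2)))) \<longlonglongrightarrow> 1 / (4 * \<gamma>)"
      using \<gamma> by (intro tendsto_intros Slim) auto
    moreover have "1 / (4 * (S j / (4 * (real (M j))\<^sup>2))) = D j" for j by (simp add: D_def)
    ultimately show ?thesis by simp
  qed
  have invM: "(\<lambda>j. 1 / real (M j)) \<longlonglongrightarrow> 0"
    using tendsto_inverse_0_at_top[OF Mreal] by (simp add: inverse_eq_divide)
  have b: "b \<longlonglongrightarrow> rGamma (\<nu> + 1)" unfolding b_def by (rule pochhammer_ratio_limit[OF nu])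
  have kernel_eq: "jac_kernel \<nu> (S j) (M j) (x j) (y j) = (\<Sum>i<M j. F j i / real (M j))" for j
    unfolding jac_kernel_def poly_jac_jsum
  proof (intro sum.cong refl)
    fix i
    have bi: "pochhammer (\<nu> + 1) i / fact i = b i * (real i + 1) powr \<nu>" by (simp add: b_def)
    have sq: "z powr (2 * \<nu>) = (z powr \<nu>)\<^sup>2" for z :: real
      by (simp add: power2_eq_square flip: powr_add)
    have n: "jac_norm \<nu> i = (2 * real i + \<nu> + 1) * (b i)\<^sup>2 * (real i + 1) powr (2 * \<nu>)"
      by (simp only: jac_norm_def bi power_mult_distrib sq mult.assoc)
    have "D j powr (\<nu> + 1) * ((real i + 1) / real (M j)) powr (2 * \<nu>) / real (M j) / real (M j)
       = (real i + 1) powr (2 * \<nu>) / S j powr (\<nu> + 1)"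
    proof -
      have "((real (M j))\<^sup>2) powr (\<nu> + 1) = (real (M j) powr (\<nu> + 1))\<^sup>2"
        by (simp add: power2_eq_square powr_mult)
      also have "\<dots> = real (M j) powr (2 * \<nu>) * real (M j) * real (M j)"
        using Mpos[of j] by (simp add: powr_add sq power_mult_distrib) (simp add: power2_eq_square)
      finally have "((real (M j))\<^sup>2) powr (\<nu> + 1) = real (M j) powr (2 * \<nu>) * real (M j) * real (M j)" .
      then show ?thesis using Mpos[of j] S0[of j]
        by (simp add: D_def powr_divide)
    qed
    moreover have arrange: "A * (c / m) * d * Z * J / m = c * d * J * r" if "A * Z / m / m = r" for A c m d Z J r :: real
      unfolding that[symmetric] by simp
    ultimately have "F j i / real (M j) = (2 * real i + \<nu> + 1) * (b i)\<^sup>2 * (jsum \<nu> i (x j / S j) * jsum \<nu> i (y j / S j)) *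
      ((real i + 1) powr (2 * \<nu>) / S j powr (\<nu> + 1))"
      unfolding F_def by (intro arrange)
    then show "jac_norm \<nu> i / S j powr (\<nu> + 1) * jsum \<nu> i (x j / S j) * jsum \<nu> i (y j / S j) = F j i / real (M j)"
      by (simp add: n mult_ac)
  qed
  have int_eq: "((\<lambda>s. F j (ii j s)) has_integral jac_kernel \<nu> (S j) (M j) (x j) (y j)) {0<..<1}" for j
    using has_integral_step[of "M j" "F j" "M j"] M1[of j] unfolding kernel_eq ii_def
    by (simp add: has_integral_open_interval[of _ _ 0 "1::real", simplified])
  obtain BD where BD: "BD > 0" "\<And>j. \<bar>D j\<bar> \<le> BD" using Bseq_bound[OF D] by blast
  obtain Bb where Bb: "Bb > 0" "\<And>j. \<bar>b j\<bar> \<le> Bb" using Bseq_bound[OF b] by blast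
  obtain Bx where Bx: "Bx > 0" "\<And>j. \<bar>x j\<bar> \<le> Bx" using Bseq_bound[OF x] by blast
  obtain By where By: "By > 0" "\<And>j. \<bar>y j\<bar> \<le> By" using Bseq_bound[OF y] by blast
  have jb: "\<bar>jsum \<nu> i (v / S j)\<bar> \<le> exp (BD * (2 + \<nu>) * B) / min 1 (\<nu> + 1)"
    if "i < M j" "\<bar>v\<bar> \<le> B" for i j v B
  proof (rule jsum_bound[OF nu])
    have "real i * (real i + \<nu> + 1) \<le> real (M j) * (real (M j) * (2 + \<nu>))"
    proof (intro mult_mono)
      have "real i + (\<nu> + 1) \<le> real (M j) + real (M j) * (\<nu> + 1)"
        using that M1[of j] nu by (intro add_mono) (auto simp: mult_le_cancel_right1)
      then show "real i + \<nu> + 1 \<le> real (M j) * (2 + \<nu>)" by (simp add: algebra_simps)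
    qed (use that nu in auto)
    then have "real i * (real i + \<nu> + 1) * \<bar>v / S j\<bar> \<le> (real (M j) * (real (M j) * (2 + \<nu>))) * \<bar>v / S j\<bar>"
      by (intro mult_right_mono) auto
    also have "\<dots> = D j * (2 + \<nu>) * \<bar>v\<bar>" using S0[of j] by (simp add: D_def power2_eq_square)
    also have "\<dots> \<le> BD * (2 + \<nu>) * B"
      using BD(2)[of j] Dpos[of j] that nu by (intro mult_mono) auto
    finally show "real i * (real i + \<nu> + 1) * \<bar>v / S j\<bar> \<le> BD * (2 + \<nu>) * B" .
  qed
  define C where "C = BD powr (\<nu> + 1) * (3 + \<nu>) * Bb\<^sup>2 *
     (exp (BD * (2 + \<nu>) * Bx) / min 1 (\<nu> + 1) * (exp (BD * (2 + \<nu>) * By) / min 1 (\<nu> + 1)))"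
  have bound: "norm (F j (ii j s)) \<le> C * (1 + s powr (2 * \<nu> + 1))" if s: "s \<in> {0<..<1}" for j s
  proof -
    define i where "i = ii j s"
    have "real i \<le> s * real (M j)" "s * real (M j) < real i + 1"
      using s Mpos[of j] by (auto simp: i_def ii_def)
    moreover have "s * real (M j) < 1 * real (M j)" using s Mpos[of j] by (intro mult_strict_right_mono) auto
    ultimately have iM: "i < M j" and is1: "s * real (M j) < real i + 1" by auto
    define z where "z = (real i + 1) / real (M j)"
    have z: "s \<le> z" "z \<le> 1" "0 < z" using is1 iM Mpos[of j] by (auto simp: z_def field_simps)
    have "(2 * real i + \<nu> + 1) / real (M j) \<le> (3 + \<nu>) * z"
    proof -
      have "0 \<le> (\<nu> + 1) * real i" using nu by simp
      then have "2 * real i + \<nu> + 1 \<le> (3 + \<nu>) * (real i + 1)"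
        by (simp add: algebra_simps)
      then show ?thesis unfolding z_def times_divide_eq_right using Mpos[of j] by (intro divide_right_mono) auto
    qed
    then have "norm (F j i) \<le> BD powr (\<nu> + 1) * ((3 + \<nu>) * z) * Bb\<^sup>2 * z powr (2 * \<nu>) *
      (exp (BD * (2 + \<nu>) * Bx) / min 1 (\<nu> + 1) * (exp (BD * (2 + \<nu>) * By) / min 1 (\<nu> + 1)))"
      unfolding F_def real_norm_def abs_mult z_def[symmetric]
      using BD(2)[of j] Dpos[of j] nu jb[OF iM Bx(2)] jb[OF iM By(2)] z Bb(2)[of i]
      by (intro mult_mono) (auto intro!: powr_mono2 power_mono simp: power2_abs abs_le_square_iff[symmetric] Mpos less_imp_le)
    also have "\<dots> = C * z powr (2 * \<nu> + 1)" using z by (simp add: C_def powr_add)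
    also have "\<dots> \<le> C * (1 + s powr (2 * \<nu> + 1))"
      using s z nu by (intro mult_left_mono powr_unit_bound) (auto simp: C_def)
    finally show ?thesis by (simp only: i_def)
  qed
  have lim: "(\<lambda>j. F j (ii j s)) \<longlonglongrightarrow> (1 / (4 * \<gamma>)) powr (\<nu> + 1) * (2 * s) * (rGamma (\<nu> + 1))\<^sup>2 * s powr (2 * \<nu>) *
      (bess_e \<nu> (s\<^sup>2 * (x0 / \<gamma>) / 4) * bess_e \<nu> (s\<^sup>2 * (y0 / \<gamma>) / 4))" if s: "s \<in> {0<..<1}" for s
  proof -
    have i: "real (ii j s) \<le> s * real (M j)" "s * real (M j) - 1 \<le> real (ii j s)" for j
      using s Mpos[of j] by (auto simp: ii_def)
    have iM: "(\<lambda>j. real (ii j s) / real (M j)) \<longlonglongrightarrow> s"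
    proof (rule tendsto_sandwich)
      show "(\<lambda>j. s - 1 / real (M j)) \<longlonglongrightarrow> s"
        using tendsto_diff[OF tendsto_const invM, of s] by simp
      show "\<forall>\<^sub>F j in sequentially. s - 1 / real (M j) \<le> real (ii j s) / real (M j)"
      proof (intro always_eventually allI)
        fix j
        have "(s * real (M j) - 1) / real (M j) \<le> real (ii j s) / real (M j)"
          by (intro divide_right_mono i) auto
        then show "s - 1 / real (M j) \<le> real (ii j s) / real (M j)"
          using Mpos[of j] by (simp add: diff_divide_distrib)
      qed
      show "\<forall>\<^sub>F j in sequentially. real (ii j s) / real (M j) \<le> s"
        using i(1) Mpos by (intro always_eventually allI) (simp only: pos_divide_le_eq)
    qed auto
    have "filterlim (\<lambda>j. s * real (M j) - 1) at_top sequentially"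
      using s by (intro filterlim_tendsto_add_at_top[of "\<lambda>_. -1" "-1", simplified]
         filterlim_tendsto_pos_mult_at_top[OF tendsto_const _ Mreal]) auto
    then have "filterlim (\<lambda>j. real (ii j s)) at_top sequentially"
      by (rule filterlim_at_top_mono) (use i(2) in auto)
    then have itop: "filterlim (\<lambda>j. ii j s) sequentially sequentially"
      by (simp add: filterlim_sequentially_iff_filterlim_real)
    have 1: "(\<lambda>j. D j powr (\<nu> + 1)) \<longlonglongrightarrow> (1 / (4 * \<gamma>)) powr (\<nu> + 1)"
      using \<gamma> by (intro tendsto_powr D tendsto_const) auto
    have "(\<lambda>j. 2 * (real (ii j s) / real (M j)) + (\<nu> + 1) * (1 / real (M j))) \<longlonglongrightarrow> 2 * s + (\<nu> + 1) * 0"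
      by (intro tendsto_intros iM invM)
    then have 2: "(\<lambda>j. (2 * real (ii j s) + \<nu> + 1) / real (M j)) \<longlonglongrightarrow> 2 * s"
      by (simp add: add_divide_distrib add.assoc)
    have 3: "(\<lambda>j. b (ii j s)) \<longlonglongrightarrow> rGamma (\<nu> + 1)"
      by (rule filterlim_compose[OF b itop])
    have "(\<lambda>j. real (ii j s) / real (M j) + 1 / real (M j)) \<longlonglongrightarrow> s + 0" by (intro tendsto_intros iM invM)
    then have "(\<lambda>j. (real (ii j s) + 1) / real (M j)) \<longlonglongrightarrow> s" by (simp add: add_divide_distrib)
    then have 4: "(\<lambda>j. ((real (ii j s) + 1) / real (M j)) powr (2 * \<nu>)) \<longlonglongrightarrow> s powr (2 * \<nu>)"
      using s by (intro tendsto_powr tendsto_const) auto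
    have J: "(\<lambda>j. jsum \<nu> (ii j s) (v j / S j)) \<longlonglongrightarrow> bess_e \<nu> (s\<^sup>2 * (v0 / \<gamma>) / 4)" if v: "v \<longlonglongrightarrow> v0" for v v0
    proof (rule jsum_limit[OF nu])
      have "(\<lambda>j. (real (ii j s) / real (M j))\<^sup>2 * (D j * v j)) \<longlonglongrightarrow> s\<^sup>2 * (1 / (4 * \<gamma>) * v0)"
        by (intro tendsto_intros iM D v)
      then show "(\<lambda>j. (real (ii j s))\<^sup>2 * (v j / S j)) \<longlonglongrightarrow> s\<^sup>2 * (v0 / \<gamma>) / 4"
        using Mpos by (simp add: D_def power_divide less_imp_neq[symmetric] mult_ac)
      have "(\<lambda>j. (real (ii j s) / real (M j)) * (D j * v j) * (1 / real (M j))) \<longlonglongrightarrow> s * (1 / (4 * \<gamma>) * v0) * 0"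
        by (intro tendsto_intros iM D v invM)
      then show "(\<lambda>j. real (ii j s) * (v j / S j)) \<longlonglongrightarrow> 0"
        using Mpos by (simp add: D_def power2_eq_square less_imp_neq[symmetric] mult_ac)
      have "(\<lambda>j. (D j * v j) * (1 / real (M j)) * (1 / real (M j))) \<longlonglongrightarrow> (1 / (4 * \<gamma>) * v0) * 0 * 0"
        by (intro tendsto_intros D v invM)
      then show "(\<lambda>j. v j / S j) \<longlonglongrightarrow> 0"
        using Mpos by (simp add: D_def power2_eq_square less_imp_neq[symmetric] mult_ac)
    qed
    show ?thesis unfolding F_def by (intro tendsto_mult tendsto_power 1 2 3 4 J x y)
  qed
  have "(\<lambda>j. integral {0<..<1} (\<lambda>s. F j (ii j s))) \<longlonglongrightarrow>
     integral {0<..<1} (\<lambda>s. (1 / (4 * \<gamma>)) powr (\<nu> + 1) * (2 * s) * (rGamma (\<nu> + 1))\<^sup>2 * s powr (2 * \<nu>) *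
      (bess_e \<nu> (s\<^sup>2 * (x0 / \<gamma>) / 4) * bess_e \<nu> (s\<^sup>2 * (y0 / \<gamma>) / 4)))"
    by (rule dominated_convergence(2)[OF _ integrable_powr_bound[OF nu] bound lim])
       (use int_eq in \<open>auto simp: has_integral_integrable\<close>)
  also have "integral {0<..<1} (\<lambda>s. (1 / (4 * \<gamma>)) powr (\<nu> + 1) * (2 * s) * (rGamma (\<nu> + 1))\<^sup>2 * s powr (2 * \<nu>) *
      (bess_e \<nu> (s\<^sup>2 * (x0 / \<gamma>) / 4) * bess_e \<nu> (s\<^sup>2 * (y0 / \<gamma>) / 4))) =
     integral {0<..<1} (\<lambda>s. ((1 / (4 * \<gamma>)) powr (\<nu> + 1) * (rGamma (\<nu> + 1))\<^sup>2) * (2 * s powr (2 * \<nu> + 1) *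
      bess_e \<nu> (s\<^sup>2 * (x0 / \<gamma>) / 4) * bess_e \<nu> (s\<^sup>2 * (y0 / \<gamma>) / 4)))"
  proof (rule integral_cong)
    fix s :: real assume "s \<in> {0<..<1}"
    then have "s powr (2 * \<nu> + 1) = s * s powr (2 * \<nu>)" by (simp add: powr_add)
    then show "(1 / (4 * \<gamma>)) powr (\<nu> + 1) * (2 * s) * (rGamma (\<nu> + 1))\<^sup>2 * s powr (2 * \<nu>) *
      (bess_e \<nu> (s\<^sup>2 * (x0 / \<gamma>) / 4) * bess_e \<nu> (s\<^sup>2 * (y0 / \<gamma>) / 4)) =
      ((1 / (4 * \<gamma>)) powr (\<nu> + 1) * (rGamma (\<nu> + 1))\<^sup>2) * (2 * s powr (2 * \<nu> + 1) *
      bess_e \<nu> (s\<^sup>2 * (x0 / \<gamma>) / 4) * bess_e \<nu> (s\<^sup>2 * (y0 / \<gamma>) / 4))" by (simp only: mult_ac)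
  qed
  also have "\<dots> = (1 / (4 * \<gamma>)) powr (\<nu> + 1) * (rGamma (\<nu> + 1))\<^sup>2 * bess_int \<nu> (x0 / \<gamma>) (y0 / \<gamma>)"
    by (simp only: integral_mult_right bess_int_def)
  finally show ?thesis by (simp only: integral_unique[OF int_eq])
qed

section \<open>The Bessel kernel\<close>

definition bess_e' :: "real \<Rightarrow> real \<Rightarrow> real" where
  "bess_e' \<nu> u = (\<Sum>k. diffs (\<lambda>k. (-1) ^ k / (fact k * pochhammer (\<nu> + 1) k)) k * u ^ k)"

lemma bess_e_powser: "bess_e \<nu> u = (\<Sum>k. (-1) ^ k / (fact k * pochhammer (\<nu> + 1) k) * u ^ k)"
  unfolding bess_e_def by (simp add: power_minus[of u])

lemma summable_bess_powser:
  assumes "\<nu> > (-1::real)"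
  shows "summable (\<lambda>k. (-1) ^ k / (fact k * pochhammer (\<nu> + 1) k) * u ^ k)"
  using summable_bess_e[OF assms, of u] by (simp add: power_minus[of u])

lemma DERIV_bess_e:
  assumes "\<nu> > -1" shows "(bess_e \<nu> has_field_derivative bess_e' \<nu> u) (at u)"
  unfolding bess_e_powser[abs_def] bess_e'_def
  by (rule termdiffs_strong_converges_everywhere) (rule summable_bess_powser[OF assms])

text \<open>The power series coefficients satisfy (k + 1)(k + \<nu> + 1) c_(k+1) = - c_k, which is
  this equation read coefficientwise. It is Bessel's equation in the variable u = a^2 / 4.\<close>

lemma bess_ode:
  assumes nu: "\<nu> > -1"
  shows "\<exists>e''. (bess_e' \<nu> has_field_derivative e'') (at u) \<and>
     u * e'' + (\<nu> + 1) * bess_e' \<nu> u + bess_e \<nu> u = 0"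
proof -
  let ?c = "\<lambda>k. (-1) ^ k / (fact k * pochhammer (\<nu> + 1) k) :: real"
  have s0: "summable (\<lambda>k. ?c k * u ^ k)" for u by (rule summable_bess_powser[OF nu])
  have s1: "summable (\<lambda>k. diffs ?c k * u ^ k)" for u
    by (rule termdiff_converges_all[OF s0])
  have s2: "summable (\<lambda>k. diffs (diffs ?c) k * u ^ k)" for u
    by (rule termdiff_converges_all[OF s1])
  define e'' where "e'' = (\<Sum>k. diffs (diffs ?c) k * u ^ k)"
  have d: "(bess_e' \<nu> has_field_derivative e'') (at u)"
    unfolding bess_e'_def[abs_def] e''_def
    by (rule termdiffs_strong_converges_everywhere) (rule s1)
  \<comment> \<open>The series of \<open>u * e''\<close> is that of \<open>h\<close> shifted by one
    index; nothing is lost since \<open>h 0 = 0\<close>.\<close>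
  define h where "h = (\<lambda>k. real k * diffs ?c k * u ^ k)"
  have eq: "u * (diffs (diffs ?c) k * u ^ k) = h (Suc k)" for k
    by (simp add: h_def diffs_def[of "diffs ?c"] mult_ac)
  have "summable (\<lambda>k. h (Suc k))"
    using summable_mult[OF s2[of u], of u] by (simp only: eq)
  then have sk: "summable h" by (simp only: summable_Suc_iff)
  have "u * e'' = (\<Sum>k. h (Suc k))"
    unfolding e''_def suminf_mult[OF s2, symmetric] eq ..
  also have "\<dots> = (\<Sum>k. h k)" using suminf_split_head[OF sk] by (simp add: h_def)
  finally have t1: "u * e'' = (\<Sum>k. h k)" .
  have "u * e'' + (\<nu> + 1) * bess_e' \<nu> u + bess_e \<nu> u =
     (\<Sum>k. h k + (\<nu> + 1) * (diffs ?c k * u ^ k) + ?c k * u ^ k)"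
    unfolding t1 bess_e'_def bess_e_powser suminf_mult[OF s1, symmetric]
    by (simp only: suminf_add sk s0 s1 summable_mult summable_add)
  also have "\<dots> = (\<Sum>k. 0)"
  proof (rule suminf_cong)
    fix k
    have "pochhammer (\<nu> + 1) k > 0" "\<nu> + 1 + real k > 0" using pochhammer_pos_nu[OF nu] nu by auto
    then have "(real k + \<nu> + 1) * diffs ?c k = - ?c k"
      by (simp add: diffs_def pochhammer_Suc add_ac)
    then have "((real k + \<nu> + 1) * diffs ?c k + ?c k) * u ^ k = 0" by simp
    then show "h k + (\<nu> + 1) * (diffs ?c k * u ^ k) + ?c k * u ^ k = 0"
      by (simp add: h_def algebra_simps)
  qed
  finally show ?thesis using d by auto
qed

lemma continuous_bess_e: "\<nu> > -1 \<Longrightarrow> continuous_on A (bess_e \<nu>)"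
  by (intro continuous_at_imp_continuous_on ballI DERIV_isCont[OF DERIV_bess_e])

lemma continuous_bess_e':
  assumes "\<nu> > -1" shows "continuous_on A (bess_e' \<nu>)"
proof (intro continuous_at_imp_continuous_on ballI)
  fix u show "isCont (bess_e' \<nu>) u"
    using bess_ode[OF assms, of u] by (elim exE conjE) (rule DERIV_isCont)
qed

text \<open>Lommel's integral: the right-hand side is the boundary term at \<open>s = 1\<close> of an antiderivative of
  Wronskian type.\<close>

lemma bess_wronskian_integral:
  assumes nu: "\<nu> > -1" and ab: "a \<noteq> b"
  shows "integral {0<..<1} (\<lambda>s. 2 * s powr (2 * \<nu> + 1) * bess_e \<nu> (s\<^sup>2 * a) * bess_e \<nu> (s\<^sup>2 * b)) =
     (bess_e \<nu> a * (b * bess_e' \<nu> b) - bess_e \<nu> b * (a * bess_e' \<nu> a)) / (a - b)"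
proof -
  \<comment> \<open>On differentiation this power cancels the first-order terms of
    \<open>bess_ode\<close>; since \<open>2 * \<nu> + 2 > 0\<close>, it also removes the boundary
    term at 0.\<close>
  define W where "W = (\<lambda>s::real. s powr (2 * \<nu> + 2) *
    (bess_e \<nu> (s\<^sup>2 * a) * (b * bess_e' \<nu> (s\<^sup>2 * b)) - bess_e \<nu> (s\<^sup>2 * b) * (a * bess_e' \<nu> (s\<^sup>2 * a))))"
  define f where "f = (\<lambda>s. 2 * s powr (2 * \<nu> + 1) * bess_e \<nu> (s\<^sup>2 * a) * bess_e \<nu> (s\<^sup>2 * b))"
  have cont: "continuous_on {0..1} W"
  proof -
    have c1: "continuous_on {0..1} (\<lambda>s. bess_e \<nu> (s\<^sup>2 * c))" for c
      by (rule continuous_on_compose2[OF continuous_bess_e[OF nu, of UNIV]]) (auto intro!: continuous_intros)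
    have c2: "continuous_on {0..1} (\<lambda>s. bess_e' \<nu> (s\<^sup>2 * c))" for c
      by (rule continuous_on_compose2[OF continuous_bess_e'[OF nu, of UNIV]]) (auto intro!: continuous_intros)
    have c3: "continuous_on {0..1} (\<lambda>s::real. s powr (2 * \<nu> + 2))"
      using nu by (intro continuous_on_powr') (auto intro!: continuous_intros)
    show ?thesis unfolding W_def by (intro continuous_intros c1 c2 c3)
  qed
  have der: "(W has_vector_derivative (a - b) * f s) (at s)" if s: "s \<in> {0<..<1}" for s
  proof -
    obtain ea where ea: "(bess_e' \<nu> has_field_derivative ea) (at (s\<^sup>2 * a))"
      "s\<^sup>2 * a * ea + (\<nu> + 1) * bess_e' \<nu> (s\<^sup>2 * a) + bess_e \<nu> (s\<^sup>2 * a) = 0" using bess_ode[OF nu] by blast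
    obtain eb where eb: "(bess_e' \<nu> has_field_derivative eb) (at (s\<^sup>2 * b))"
      "s\<^sup>2 * b * eb + (\<nu> + 1) * bess_e' \<nu> (s\<^sup>2 * b) + bess_e \<nu> (s\<^sup>2 * b) = 0" using bess_ode[OF nu] by blast
    have sq: "((\<lambda>s. s\<^sup>2 * c) has_field_derivative 2 * s * c) (at s)" for c
      by (auto intro!: derivative_eq_intros)
    have d1: "((\<lambda>s. bess_e \<nu> (s\<^sup>2 * c)) has_field_derivative bess_e' \<nu> (s\<^sup>2 * c) * (2 * s * c)) (at s)" for c
      by (rule DERIV_chain2[OF DERIV_bess_e[OF nu] sq])
    have da: "((\<lambda>s. bess_e' \<nu> (s\<^sup>2 * a)) has_field_derivative ea * (2 * s * a)) (at s)"
      by (rule DERIV_chain2[OF ea(1) sq])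
    have db: "((\<lambda>s. bess_e' \<nu> (s\<^sup>2 * b)) has_field_derivative eb * (2 * s * b)) (at s)"
      by (rule DERIV_chain2[OF eb(1) sq])
    have dp: "((\<lambda>s. s powr (2 * \<nu> + 2)) has_field_derivative (2 * \<nu> + 2) * s powr (2 * \<nu> + 1)) (at s)"
      using has_real_derivative_powr[of s "2 * \<nu> + 2"] s by (simp add: add.commute)
    define A A' B B' p where "A = bess_e \<nu> (s\<^sup>2 * a)" and "A' = bess_e' \<nu> (s\<^sup>2 * a)"
      and "B = bess_e \<nu> (s\<^sup>2 * b)" and "B' = bess_e' \<nu> (s\<^sup>2 * b)" and "p = s powr (2 * \<nu> + 1)"
    have "(W has_field_derivative (2 * \<nu> + 2) * s powr (2 * \<nu> + 1) * (A * (b * B') - B * (a * A')) +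
       (A' * (2 * s * a) * (b * B') + b * (eb * (2 * s * b)) * A -
       (B' * (2 * s * b) * (a * A') + a * (ea * (2 * s * a)) * B)) * s powr (2 * \<nu> + 2)) (at s)"
      unfolding W_def A_def A'_def B_def B'_def
      by (intro DERIV_mult DERIV_diff dp d1 DERIV_cmult da db)
    also have "s powr (2 * \<nu> + 2) = s * p"
      using s by (simp add: p_def powr_add power2_eq_square)
    also have "(2 * \<nu> + 2) * s powr (2 * \<nu> + 1) * (A * (b * B') - B * (a * A')) +
       (A' * (2 * s * a) * (b * B') + b * (eb * (2 * s * b)) * A -
       (B' * (2 * s * b) * (a * A') + a * (ea * (2 * s * a)) * B)) * (s * p) = (a - b) * (2 * p * A * B)"
    proof -
      have 1: "s\<^sup>2 * a * ea = - (\<nu> + 1) * A' - A" and 2: "s\<^sup>2 * b * eb = - (\<nu> + 1) * B' - B"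
        using ea(2) eb(2) by (simp_all add: A_def A'_def B_def B'_def algebra_simps)
      have "(2 * \<nu> + 2) * p * (A * (b * B') - B * (a * A')) +
       (A' * (2 * s * a) * (b * B') + b * (eb * (2 * s * b)) * A -
       (B' * (2 * s * b) * (a * A') + a * (ea * (2 * s * a)) * B)) * (s * p) =
       (2 * \<nu> + 2) * p * (A * (b * B') - B * (a * A')) + 2 * p * b * A * (s\<^sup>2 * b * eb) - 2 * p * a * B * (s\<^sup>2 * a * ea)"
        by (simp add: algebra_simps power2_eq_square)
      also have "\<dots> = (a - b) * (2 * p * A * B)" unfolding 1 2 by (simp add: algebra_simps)
      finally show ?thesis by (simp only: p_def)
    qed
    finally show ?thesis by (simp add: has_real_derivative_iff_has_vector_derivative f_def A_def B_def p_def)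
  qed
  have "((\<lambda>s. (a - b) * f s) has_integral (W 1 - W 0)) {0..1}"
    by (rule fundamental_theorem_of_calculus_interior[OF _ cont der]) auto
  then have "((\<lambda>s. (a - b) * f s) has_integral (W 1 - W 0)) {0<..<1}"
    by (simp add: has_integral_open_interval[of _ _ 0 "1::real", simplified])
  then have "integral {0<..<1} (\<lambda>s. (a - b) * f s) = W 1 - W 0" by (rule integral_unique)
  then have "(a - b) * integral {0<..<1} f = W 1 - W 0" by (simp only: integral_mult_right)
  moreover have "W 0 = 0" by (simp add: W_def)
  moreover have "W 1 = bess_e \<nu> a * (b * bess_e' \<nu> b) - bess_e \<nu> b * (a * bess_e' \<nu> a)"
    by (simp add: W_def)
  ultimately have "(a - b) * integral {0<..<1} f = bess_e \<nu> a * (b * bess_e' \<nu> b) - bess_e \<nu> b * (a * bess_e' \<nu> a)"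
    by simp
  then have "integral {0<..<1} f = (bess_e \<nu> a * (b * bess_e' \<nu> b) - bess_e \<nu> b * (a * bess_e' \<nu> a)) / (a - b)"
    using ab by (intro eq_divide_imp) (simp_all add: mult.commute)
  then show ?thesis unfolding f_def .
qed

section \<open>From the entire part back to Bessel functions\<close>

lemma Bessel_J_eq:
  assumes nu: "\<nu> > -1" and a: "a > 0"
  shows "Bessel_J \<nu> a = (a / 2) powr \<nu> * rGamma (\<nu> + 1) * bess_e \<nu> (a\<^sup>2 / 4)"
proof -
  have tm: "(-1) ^ k * rGamma (real k + \<nu> + 1) / fact k * (a / 2) powr (2 * real k + \<nu>) =
     (a / 2) powr \<nu> * rGamma (\<nu> + 1) * ((- (a\<^sup>2 / 4)) ^ k / (fact k * pochhammer (\<nu> + 1) k))" for k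
  proof -
    have "pochhammer (\<nu> + 1) k > 0" by (rule pochhammer_pos_nu[OF nu])
    moreover have "rGamma (\<nu> + 1) = pochhammer (\<nu> + 1) k * rGamma (\<nu> + 1 + real k)"
      by (rule pochhammer_rGamma)
    ultimately have 1: "rGamma (real k + \<nu> + 1) = rGamma (\<nu> + 1) / pochhammer (\<nu> + 1) k"
      by (simp add: add_ac)
    have "(a / 2) powr (2 * real k + \<nu>) = (a / 2) powr \<nu> * (a / 2) powr real (2 * k)"
      by (simp add: powr_add mult.commute)
    also have "(a / 2) powr real (2 * k) = (a\<^sup>2 / 4) ^ k"
      using a by (subst powr_realpow) (simp_all add: power_mult power_divide)
    finally have 2: "(a / 2) powr (2 * real k + \<nu>) = (a / 2) powr \<nu> * (a\<^sup>2 / 4) ^ k" .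
    show ?thesis unfolding 1 2 power_minus[of "a\<^sup>2 / 4"] by (simp add: mult_ac)
  qed
  show ?thesis unfolding Bessel_J_def tm bess_e_def
    by (rule suminf_mult[OF summable_bess_e[OF nu]])
qed

text \<open>Stated for a J'(a), the combination that occurs in the kernel. Its part
  \<open>\<nu> * Bessel_J \<nu> a\<close> cancels there by antisymmetry, so only the derivative of
  the entire part remains.\<close>

lemma deriv_Bessel_J:
  assumes nu: "\<nu> > -1" and a: "a > 0"
  shows "a * deriv (Bessel_J \<nu>) a = \<nu> * Bessel_J \<nu> a +
     (a / 2) powr \<nu> * rGamma (\<nu> + 1) * (2 * (a\<^sup>2 / 4 * bess_e' \<nu> (a\<^sup>2 / 4)))"
proof -
  let ?g = "\<lambda>a. (a / 2) powr \<nu> * rGamma (\<nu> + 1) * bess_e \<nu> (a\<^sup>2 / 4)"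
  have d1: "((\<lambda>a. (a / 2) powr \<nu>) has_field_derivative \<nu> * (a / 2) powr (\<nu> - 1) * (1 / 2)) (at a)"
    using a by (intro DERIV_chain2[where f = "\<lambda>z. z powr \<nu>" and g = "\<lambda>a. a / 2"] has_real_derivative_powr)
       (auto intro!: derivative_eq_intros)
  have d2: "((\<lambda>a. bess_e \<nu> (a\<^sup>2 / 4)) has_field_derivative bess_e' \<nu> (a\<^sup>2 / 4) * (a / 2)) (at a)"
    by (rule DERIV_chain2[OF DERIV_bess_e[OF nu]]) (auto intro!: derivative_eq_intros)
  have "(?g has_field_derivative \<nu> * (a / 2) powr (\<nu> - 1) * (1 / 2) * rGamma (\<nu> + 1) * bess_e \<nu> (a\<^sup>2 / 4) +
     bess_e' \<nu> (a\<^sup>2 / 4) * (a / 2) * ((a / 2) powr \<nu> * rGamma (\<nu> + 1))) (at a)"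
    by (intro DERIV_mult d2 DERIV_cmult_right d1)
  then have "(Bessel_J \<nu> has_field_derivative \<nu> * (a / 2) powr (\<nu> - 1) * (1 / 2) * rGamma (\<nu> + 1) * bess_e \<nu> (a\<^sup>2 / 4) +
     bess_e' \<nu> (a\<^sup>2 / 4) * (a / 2) * ((a / 2) powr \<nu> * rGamma (\<nu> + 1))) (at a)"
  proof (rule has_field_derivative_transform_within_open[of _ _ _ "{0<..}"])
    show "\<And>x. x \<in> {0<..} \<Longrightarrow> ?g x = Bessel_J \<nu> x" using Bessel_J_eq[OF nu] by simp
  qed (use a in auto)
  then have d: "deriv (Bessel_J \<nu>) a = \<nu> * (a / 2) powr (\<nu> - 1) * (1 / 2) * rGamma (\<nu> + 1) * bess_e \<nu> (a\<^sup>2 / 4) +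
     bess_e' \<nu> (a\<^sup>2 / 4) * (a / 2) * ((a / 2) powr \<nu> * rGamma (\<nu> + 1))" by (rule DERIV_imp_deriv)
  have p: "(a / 2) powr (\<nu> - 1) = (a / 2) powr \<nu> / (a / 2)" using a by (simp add: powr_diff)
  show ?thesis unfolding d p Bessel_J_eq[OF nu a] using a by (simp add: field_simps power2_eq_square)
qed

text \<open>Unlike the Wronskian quotient, this form of the Bessel kernel has no singularity at
  \<open>x = y\<close>, so its continuity needs no separate treatment of the diagonal.\<close>

definition bess_kernel_int :: "real \<Rightarrow> real \<Rightarrow> real \<Rightarrow> real" where
  "bess_kernel_int \<nu> x y =
     (x * y) powr (\<nu> / 2) * (1 / 4) powr (\<nu> + 1) * (rGamma (\<nu> + 1))\<^sup>2 * bess_int \<nu> x y"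

lemma Bessel_kernel_offdiag_eq:
  assumes nu: "\<nu> > -1" and x: "x > 0" and y: "y > 0" and ne: "x \<noteq> y"
  shows "Bessel_kernel_offdiag \<nu> x y = bess_kernel_int \<nu> x y"
proof -
  define P Q c where "P = (sqrt x / 2) powr \<nu>" and "Q = (sqrt y / 2) powr \<nu>" and "c = rGamma (\<nu> + 1)"
  define A A' B B' where "A = bess_e \<nu> (x / 4)" and "A' = bess_e' \<nu> (x / 4)"
    and "B = bess_e \<nu> (y / 4)" and "B' = bess_e' \<nu> (y / 4)"
  have jx: "Bessel_J \<nu> (sqrt x) = P * c * A" and jy: "Bessel_J \<nu> (sqrt y) = Q * c * B"
    using Bessel_J_eq[OF nu, of "sqrt x"] Bessel_J_eq[OF nu, of "sqrt y"] x y
    by (auto simp: P_def Q_def A_def B_def c_def)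
  have dx: "sqrt x * deriv (Bessel_J \<nu>) (sqrt x) = \<nu> * (P * c * A) + P * c * (2 * (x / 4 * A'))"
    using deriv_Bessel_J[OF nu, of "sqrt x"] x jx by (auto simp: P_def A'_def c_def)
  have dy: "sqrt y * deriv (Bessel_J \<nu>) (sqrt y) = \<nu> * (Q * c * B) + Q * c * (2 * (y / 4 * B'))"
    using deriv_Bessel_J[OF nu, of "sqrt y"] y jy by (auto simp: Q_def B'_def c_def)
  have "Bessel_kernel_offdiag \<nu> x y =
    (P * c * A * (\<nu> * (Q * c * B) + Q * c * (2 * (y / 4 * B'))) - Q * c * B * (\<nu> * (P * c * A) + P * c * (2 * (x / 4 * A')))) / (2 * (x - y))"
    unfolding Bessel_kernel_offdiag_def mult.assoc[of _ "sqrt x"] mult.assoc[of _ "sqrt y"] dx dy jx jy by simp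
  also have "\<dots> = (P * Q / 4) * c\<^sup>2 * ((A * (y / 4 * B') - B * (x / 4 * A')) / (x / 4 - y / 4))"
    using ne by (simp add: divide_simps power2_eq_square) (simp add: algebra_simps)
  also have "(A * (y / 4 * B') - B * (x / 4 * A')) / (x / 4 - y / 4) = bess_int \<nu> x y"
    using bess_wronskian_integral[OF nu, of "x / 4" "y / 4"] ne
    by (simp add: bess_int_def A_def A'_def B_def B'_def)
  also have "P * Q / 4 = (x * y) powr (\<nu> / 2) * (1 / 4) powr (\<nu> + 1)"
  proof -
    have "P * Q = (sqrt x * sqrt y) powr \<nu> * (1 / 4) powr \<nu>"
      unfolding P_def Q_def by (simp flip: powr_mult)
    also have "(sqrt x * sqrt y) powr \<nu> = (x * y) powr (\<nu> / 2)"
    proof -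
      have "sqrt x * sqrt y = (x * y) powr (1 / 2)" using x y by (simp add: powr_half_sqrt real_sqrt_mult)
      then show ?thesis by (simp only: powr_powr) simp
    qed
    finally show ?thesis by (simp add: powr_add)
  qed
  finally show ?thesis by (simp add: bess_kernel_int_def c_def)
qed

lemma bess_e_bound:
  assumes "\<nu> > -1" "\<bar>u\<bar> \<le> X" shows "\<bar>bess_e \<nu> u\<bar> \<le> exp X / min 1 (\<nu> + 1)"
proof -
  have "norm (bess_e \<nu> u) \<le> (\<Sum>k. X ^ k / fact k / min 1 (\<nu> + 1))"
    unfolding bess_e_def
  proof (rule norm_suminf_le[OF _ summable_bess_bound])
    fix k
    have "\<bar>(- u) ^ k\<bar> \<le> X ^ k" using assms by (simp add: power_abs power_mono)
    then show "norm ((- u) ^ k / (fact k * pochhammer (\<nu> + 1) k)) \<le> X ^ k / fact k / min 1 (\<nu> + 1)"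
      using bess_term_bound[OF assms(1), of "(- u) ^ k" X k] assms(2) by simp
  qed
  then show ?thesis by (simp only: suminf_bess_bound real_norm_def)
qed

text \<open>Joint continuity, used three times: for the diagonal value of
  \<open>Bessel_kernel\<close>, for letting the dilation tend to 1, and for the uniformity of the
  final limit.\<close>

lemma bess_int_limit:
  assumes nu: "\<nu> > -1" and x: "x \<longlonglongrightarrow> x0" and y: "y \<longlonglongrightarrow> y0"
  shows "(\<lambda>j::nat. bess_int \<nu> (x j) (y j)) \<longlonglongrightarrow> bess_int \<nu> x0 y0"
proof -
  obtain Bx where Bx: "Bx > 0" "\<And>j. \<bar>x j\<bar> \<le> Bx" using Bseq_bound[OF x] by blast
  obtain By where By: "By > 0" "\<And>j. \<bar>y j\<bar> \<le> By" using Bseq_bound[OF y] by blast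
  let ?f = "\<lambda>x y s. 2 * s powr (2 * \<nu> + 1) * bess_e \<nu> (s\<^sup>2 * x / 4) * bess_e \<nu> (s\<^sup>2 * y / 4)"
  define C where "C = 2 * (exp Bx / min 1 (\<nu> + 1)) * (exp By / min 1 (\<nu> + 1))"
  have eb: "\<bar>bess_e \<nu> (s\<^sup>2 * v / 4)\<bar> \<le> exp B / min 1 (\<nu> + 1)" if "s \<in> {0<..<1}" "\<bar>v\<bar> \<le> B" for s v B
  proof (rule bess_e_bound[OF nu])
    have "s\<^sup>2 * \<bar>v\<bar> \<le> 1 * B" using that by (intro mult_mono) (auto simp: power_le_one)
    then show "\<bar>s\<^sup>2 * v / 4\<bar> \<le> B" using that by (simp add: abs_mult)
  qed
  have bound: "norm (?f v w s) \<le> C * (1 + s powr (2 * \<nu> + 1))"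
    if "s \<in> {0<..<1}" "\<bar>v\<bar> \<le> Bx" "\<bar>w\<bar> \<le> By" for s v w
  proof -
    have "norm (?f v w s) \<le> 2 * s powr (2 * \<nu> + 1) * (exp Bx / min 1 (\<nu> + 1)) * (exp By / min 1 (\<nu> + 1))"
      unfolding real_norm_def abs_mult using eb[OF that(1,2)] eb[OF that(1,3)] nu
      by (intro mult_mono) auto
    also have "\<dots> = C * s powr (2 * \<nu> + 1)" by (simp add: C_def)
    also have "\<dots> \<le> C * (1 + s powr (2 * \<nu> + 1))" using nu by (intro mult_left_mono) (auto simp: C_def)
    finally show ?thesis .
  qed
  have c: "isCont (bess_e \<nu>) u" for u using DERIV_bess_e[OF nu] by (rule DERIV_isCont)
  have int: "?f v w integrable_on {0<..<1}" if "\<bar>v\<bar> \<le> Bx" "\<bar>w\<bar> \<le> By" for v w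
  proof (rule measurable_bounded_by_integrable_imp_integrable_real)
    have cc: "continuous_on {0<..<1} (\<lambda>s::real. bess_e \<nu> (s\<^sup>2 * v / 4))" for v
      by (rule continuous_on_compose2[OF continuous_bess_e[OF nu, of UNIV]]) (auto intro!: continuous_intros)
    show "?f v w \<in> borel_measurable (lebesgue_on {0<..<1})"
      by (intro continuous_imp_measurable_on_sets_lebesgue continuous_intros cc) auto
    show "(\<lambda>s. C * (1 + s powr (2 * \<nu> + 1))) integrable_on {0<..<1}" by (rule integrable_powr_bound[OF nu])
    show "\<And>s. s \<in> {0<..<1} \<Longrightarrow> \<bar>?f v w s\<bar> \<le> C * (1 + s powr (2 * \<nu> + 1))"
      using bound[OF _ that] by simp
  qed auto
  show ?thesis unfolding bess_int_def
  proof (rule dominated_convergence(2)[OF int integrable_powr_bound[OF nu] bound])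
    fix s :: real
    show "(\<lambda>j. ?f (x j) (y j) s) \<longlonglongrightarrow> ?f x0 y0 s"
      by (intro tendsto_intros isCont_tendsto_compose[OF c] x y) simp_all
  qed (use Bx By in auto)
qed

lemma bess_kernel_int_limit:
  assumes nu: "\<nu> > -1" and x: "x \<longlonglongrightarrow> x0" and y: "y \<longlonglongrightarrow> y0" and pos: "x0 > 0" "y0 > 0"
  shows "(\<lambda>j::nat. bess_kernel_int \<nu> (x j) (y j)) \<longlonglongrightarrow> bess_kernel_int \<nu> x0 y0"
  unfolding bess_kernel_int_def using pos
  by (intro tendsto_intros bess_int_limit[OF nu] x y) auto

theorem Bessel_kernel_eq:
  assumes nu: "\<nu> > -1" and x: "x > 0" and y: "y > 0"
  shows "Bessel_kernel \<nu> x y = bess_kernel_int \<nu> x y"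
proof (cases "x = y")
  case False
  then show ?thesis using Bessel_kernel_offdiag_eq[OF assms] by (simp add: Bessel_kernel_def)
next
  case True
  let ?U = "{(s, t). 0 < s \<and> 0 < t \<and> s \<noteq> (t::real)}"
  have "((\<lambda>(s, t). Bessel_kernel_offdiag \<nu> s t) \<longlongrightarrow> bess_kernel_int \<nu> x x) (at (x, x) within ?U)"
    unfolding tendsto_at_iff_sequentially
  proof (intro allI impI)
    fix X :: "nat \<Rightarrow> real \<times> real" assume X: "\<forall>i. X i \<in> ?U - {(x, x)}" and lim: "X \<longlonglongrightarrow> (x, x)"
    have lim': "(\<lambda>j. bess_kernel_int \<nu> (fst (X j)) (snd (X j))) \<longlonglongrightarrow> bess_kernel_int \<nu> x x"
      using tendsto_fst[OF lim] tendsto_snd[OF lim] x by (intro bess_kernel_int_limit[OF nu]) auto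
    have Xj: "((\<lambda>(s, t). Bessel_kernel_offdiag \<nu> s t) \<circ> X) j = bess_kernel_int \<nu> (fst (X j)) (snd (X j))" for j
    proof -
      have "X j \<in> ?U" by (rule DiffD1[OF X[rule_format]])
      then show ?thesis
        by (cases "X j") (simp add: Bessel_kernel_offdiag_eq[OF nu])
    qed
    have "((\<lambda>(s, t). Bessel_kernel_offdiag \<nu> s t) \<circ> X) = (\<lambda>j. bess_kernel_int \<nu> (fst (X j)) (snd (X j)))"
      by (rule ext) (rule Xj)
    then show "((\<lambda>(s, t). Bessel_kernel_offdiag \<nu> s t) \<circ> X) \<longlonglongrightarrow> bess_kernel_int \<nu> x x"
      using lim' by (simp only:)
  qed
  \<comment> \<open>\<open>Lim\<close> singles out the limit only along a nontrivial filter, so (x,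
    x) has to be an accumulation point of the off-diagonal quadrant.\<close>
  moreover have "at (x, x) within ?U \<noteq> bot"
  proof -
    have "(x, x) islimpt ?U" unfolding islimpt_sequential
    proof (intro exI conjI allI)
      fix n
      show "(x + 1 / real (Suc n), x) \<in> ?U - {(x, x)}" using x by (auto simp: add_pos_pos)
      have "(\<lambda>n. x + 1 / real (Suc n)) \<longlonglongrightarrow> x + 0"
        by (intro tendsto_intros LIMSEQ_Suc[OF lim_1_over_n])
      then show "(\<lambda>n. (x + 1 / real (Suc n), x)) \<longlonglongrightarrow> (x, x)"
        by (intro tendsto_Pair tendsto_const) auto
    qed
    then show ?thesis by (simp add: trivial_limit_within)
  qed
  ultimately have "Lim (at (x, x) within ?U) (\<lambda>(s, t). Bessel_kernel_offdiag \<nu> s t) = bess_kernel_int \<nu> x x"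
    by (intro tendsto_Lim) auto
  then show ?thesis using True by (simp add: Bessel_kernel_def)
qed

section \<open>Tail products\<close>

text \<open>Equivalently 1 - u \<le> (1 - v) exp (v - u): replacing \<open>u\<close> by the smaller
  \<open>v\<close> gains at least the factor exp (u - v). The form without logarithms admits
  \<open>u = 1\<close>, which occurs when \<open>t\<close> is the first zero of a product.\<close>

lemma one_minus_mult_exp_mono:
  fixes u v :: real
  assumes "0 \<le> v" "v \<le> u"
  shows "(1 - u) * exp u \<le> (1 - v) * exp v"
proof -
  have "((\<lambda>x. (1 - x) * exp x) has_real_derivative - x * exp x) (at x)" for x :: real
    by (auto intro!: derivative_eq_intros simp: algebra_simps)
  then show ?thesis using assms
    by (intro DERIV_nonpos_imp_nonincreasing[of v u "\<lambda>x. (1 - x) * exp x"]) (auto intro!: exI)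
qed

lemma one_minus_ge_exp:
  fixes w :: real
  assumes "0 \<le> w" "w \<le> 1 / 2"
  shows "exp (- (2 * w)) \<le> 1 - w"
proof -
  have "exp (- (2 * w)) = 1 / exp (2 * w)" by (simp add: exp_minus inverse_eq_divide)
  also have "\<dots> \<le> 1 / (1 + 2 * w)"
    using assms exp_ge_add_one_self[of "2 * w"] by (intro divide_left_mono mult_pos_pos) auto
  also have "\<dots> \<le> 1 - w"
  proof -
    have "0 \<le> w * (1 - 2 * w)" using assms by simp
    then have "1 \<le> (1 - w) * (1 + 2 * w)" by (simp add: algebra_simps)
    then show ?thesis using assms by (simp add: pos_divide_le_eq)
  qed
  finally show ?thesis .
qed

text \<open>The pairs \<open>u\<close>, \<open>v\<close> earn the exponential of the sum of
  \<open>u i - v i\<close>, and the additional factors \<open>1 - w j\<close> cost at most the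
  exponential of twice the sum of \<open>w\<close>. Both domination results are instances.\<close>

lemma prod_compare:
  fixes u v w :: "nat \<Rightarrow> real"
  assumes "finite I" "finite J"
    and uv: "\<And>i. i \<in> I \<Longrightarrow> 0 \<le> v i \<and> v i \<le> u i \<and> u i \<le> 1"
    and w: "\<And>j. j \<in> J \<Longrightarrow> 0 \<le> w j \<and> w j \<le> 1 / 2"
    and sum: "2 * (\<Sum>j\<in>J. w j) \<le> (\<Sum>i\<in>I. u i - v i)"
  shows "(\<Prod>i\<in>I. 1 - u i) \<le> (\<Prod>i\<in>I. 1 - v i) * (\<Prod>j\<in>J. 1 - w j)"
proof -
  have "(\<Prod>i\<in>I. 1 - u i) \<le> (\<Prod>i\<in>I. (1 - v i) * exp (v i - u i))"
  proof (intro prod_mono conjI)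
    fix i assume i: "i \<in> I"
    then have "(1 - u i) * exp (u i) * exp (- u i) \<le> (1 - v i) * exp (v i) * exp (- u i)"
      using uv[OF i] by (intro mult_right_mono one_minus_mult_exp_mono) auto
    then show "1 - u i \<le> (1 - v i) * exp (v i - u i)"
      by (simp add: mult.assoc exp_add[symmetric] del: exp_add)
  qed (use uv in auto)
  also have "\<dots> = (\<Prod>i\<in>I. 1 - v i) * exp (- (\<Sum>i\<in>I. u i - v i))"
    using assms(1) by (simp add: prod.distrib exp_sum sum_negf[symmetric])
  also have "\<dots> \<le> (\<Prod>i\<in>I. 1 - v i) * exp (- (2 * (\<Sum>j\<in>J. w j)))"
    using sum uv by (intro mult_left_mono prod_nonneg) force+
  also have "exp (- (2 * (\<Sum>j\<in>J. w j))) = (\<Prod>j\<in>J. exp (- (2 * w j)))"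
    using assms(2) by (simp add: exp_sum sum_distrib_left sum_negf[symmetric])
  also have "(\<Prod>i\<in>I. 1 - v i) * (\<Prod>j\<in>J. exp (- (2 * w j))) \<le> (\<Prod>i\<in>I. 1 - v i) * (\<Prod>j\<in>J. 1 - w j)"
    using uv w by (intro mult_left_mono prod_mono prod_nonneg conjI one_minus_ge_exp) force+
  finally show ?thesis .
qed

text \<open>Weierstrass's product inequality. It shows that tail products and node polynomials are 1
  + O(t / N) at fixed \<open>t\<close>.\<close>

lemma prod_one_minus_ge:
  fixes a :: "nat \<Rightarrow> real"
  assumes "finite I" "\<And>i. i \<in> I \<Longrightarrow> 0 \<le> a i \<and> a i \<le> 1"
  shows "1 - (\<Sum>i\<in>I. a i) \<le> (\<Prod>i\<in>I. 1 - a i) \<and> (\<Prod>i\<in>I. 1 - a i) \<le> 1"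
  using assms
proof (induction I)
  case (insert i I)
  have IH: "1 - (\<Sum>i\<in>I. a i) \<le> (\<Prod>i\<in>I. 1 - a i)" "(\<Prod>i\<in>I. 1 - a i) \<le> 1" using insert by auto
  have nn: "0 \<le> (\<Prod>i\<in>I. 1 - a i)" using insert by (intro prod_nonneg) auto
  have "a i * (\<Prod>i\<in>I. 1 - a i) \<le> a i * 1" using IH insert by (intro mult_left_mono) auto
  moreover have "0 \<le> a i * (\<Prod>i\<in>I. 1 - a i)" using nn insert by simp
  ultimately show ?case using IH insert by (simp add: left_diff_distrib)
qed simp

lemma sum_inverse_squares_le:
  assumes "N \<ge> 1"
  shows "(\<Sum>k\<in>{N<..n}. 1 / (real k)\<^sup>2) \<le> 1 / real N"
proof -
  \<comment> \<open>The induction needs the telescoped bound; the claim drops the subtracted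
    term.\<close>
  have "(\<Sum>k\<in>{N<..n}. 1 / (real k)\<^sup>2) \<le> 1 / real N - (if n \<ge> N then 1 / real n else 0)"
  proof (induction n)
    case (Suc n)
    show ?case
    proof (cases "Suc n \<le> N")
      case True
      then have "{N<..Suc n} = {}" by auto
      then show ?thesis using True assms by auto
    next
      case False
      then have n: "n \<ge> N" "real n > 0" using assms by auto
      have "{N<..Suc n} = insert (Suc n) {N<..n}" using False by auto
      then have "(\<Sum>k\<in>{N<..Suc n}. 1 / (real k)\<^sup>2) = 1 / (real (Suc n))\<^sup>2 + (\<Sum>k\<in>{N<..n}. 1 / (real k)\<^sup>2)"
        by simp
      also have "\<dots> \<le> 1 / (real (Suc n))\<^sup>2 + (1 / real N - 1 / real n)" using Suc n by simp
      also have "1 / (real (Suc n))\<^sup>2 \<le> 1 / (real n * real (Suc n))"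
        using n by (intro divide_left_mono) (auto simp: power2_eq_square)
      also have "1 / (real n * real (Suc n)) = 1 / real n - 1 / real (Suc n)"
        using n by (simp add: field_simps)
      finally show ?thesis using False by simp
    qed
  qed simp
  also have "\<dots> \<le> 1 / real N" by simp
  finally show ?thesis .
qed

lemma sum_inverse_squares_ge:
  assumes "N \<le> n"
  shows "1 / real (Suc N) - 1 / real (Suc n) \<le> (\<Sum>k\<in>{N<..n}. 1 / (real k)\<^sup>2)"
  using assms
proof (induction rule: dec_induct)
  case (step n)
  have "{N<..Suc n} = insert (Suc n) {N<..n}" using step by auto
  then have "(\<Sum>k\<in>{N<..Suc n}. 1 / (real k)\<^sup>2) = 1 / (real (Suc n))\<^sup>2 + (\<Sum>k\<in>{N<..n}. 1 / (real k)\<^sup>2)"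
    by simp
  moreover have "1 / real (Suc n) - 1 / real (Suc (Suc n)) \<le> 1 / (real (Suc n))\<^sup>2"
  proof -
    have "1 / real (Suc n) - 1 / real (Suc (Suc n)) = 1 / (real (Suc n) * real (Suc (Suc n)))"
      by (simp add: field_simps)
    also have "\<dots> \<le> 1 / (real (Suc n))\<^sup>2"
      by (intro divide_left_mono) (auto simp: power2_eq_square)
    finally show ?thesis .
  qed
  ultimately show ?case using step by linarith
qed simp

section \<open>Location of the Chebyshev nodes\<close>

lemma sin_ge_cubic:
  fixes x :: real
  assumes "0 \<le> x" shows "x * (1 - x\<^sup>2 / 6) \<le> sin x"
proof -
  have 1: "1 - y\<^sup>2 / 2 \<le> cos y" if "0 \<le> y" for y :: real
  proof -
    have "((\<lambda>x. cos x + x\<^sup>2 / 2) has_real_derivative - sin z + z) (at z)" for z :: real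
      by (auto intro!: derivative_eq_intros)
    moreover have "0 \<le> - sin z + z" if "0 \<le> z" for z :: real using sin_x_le_x[OF that] by simp
    ultimately have "cos 0 + 0\<^sup>2 / 2 \<le> cos y + y\<^sup>2 / (2::real)"
      by (intro DERIV_nonneg_imp_nondecreasing[of 0 y "\<lambda>x. cos x + x\<^sup>2 / 2"] that) blast
    then show ?thesis by simp
  qed
  have "((\<lambda>x. sin x - x + x ^ 3 / 6) has_real_derivative cos z - 1 + z\<^sup>2 / 2) (at z)" for z :: real
    by (auto intro!: derivative_eq_intros)
  moreover have "0 \<le> cos z - 1 + z\<^sup>2 / 2" if "0 \<le> z" for z :: real using 1[OF that] by simp
  ultimately have "sin 0 - 0 + 0 ^ 3 / 6 \<le> sin x - x + x ^ 3 / 6"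
    by (intro DERIV_nonneg_imp_nondecreasing[of 0 x "\<lambda>x. sin x - x + x ^ 3 / 6"] assms) blast
  then show ?thesis by (simp add: power3_eq_cube power2_eq_square algebra_simps)
qed

lemma cheb_node_le:
  assumes "k \<in> {1..M}"
  shows "cheb_node M (4 * (real M)\<^sup>2 * c\<^sup>2) k \<le> c\<^sup>2 * pi\<^sup>2 * (real k)\<^sup>2"
proof -
  have M: "real M > 0" using assms by auto
  have a: "0 \<le> cheb_angle M k / 2" using cheb_angle_bounds[OF assms] by simp
  have "\<bar>sin (cheb_angle M k / 2)\<bar> \<le> \<bar>cheb_angle M k / 2\<bar>" by (rule abs_sin_x_le_abs_x)
  also have "\<dots> \<le> real k * pi / (2 * real M)"
    using a M by (simp add: cheb_angle_def divide_right_mono field_simps)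
  finally have "(sin (cheb_angle M k / 2))\<^sup>2 \<le> (real k * pi / (2 * real M))\<^sup>2"
    by (metis abs_le_square_iff abs_ge_zero abs_of_nonneg order_trans)
  then have "4 * (real M)\<^sup>2 * c\<^sup>2 * (sin (cheb_angle M k / 2))\<^sup>2 \<le> 4 * (real M)\<^sup>2 * c\<^sup>2 * (real k * pi / (2 * real M))\<^sup>2"
    by (intro mult_left_mono) auto
  also have "\<dots> = c\<^sup>2 * pi\<^sup>2 * (real k)\<^sup>2" using M by (simp add: power_mult_distrib power_divide)
  finally show ?thesis by (simp add: cheb_node_def)
qed

text \<open>The slope \<open>b\<close> of the lower bound for the sine is a parameter: 1/3 serves
  all nodes, while a value close to 1 serves the nodes with small angle.\<close>

lemma cheb_node_ge_aux:
  assumes "k \<in> {1..M}" "0 \<le> b" "b * (cheb_angle M k / 2) \<le> sin (cheb_angle M k / 2)"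
  shows "b\<^sup>2 * c\<^sup>2 * pi\<^sup>2 * (real k - 1 / 2)\<^sup>2 \<le> cheb_node M (4 * (real M)\<^sup>2 * c\<^sup>2) k"
proof -
  have M: "real M > 0" using assms by auto
  have a: "0 \<le> cheb_angle M k / 2" using cheb_angle_bounds[OF assms(1)] by simp
  have "b\<^sup>2 * c\<^sup>2 * pi\<^sup>2 * (real k - 1 / 2)\<^sup>2 = 4 * (real M)\<^sup>2 * c\<^sup>2 * (b * (cheb_angle M k / 2))\<^sup>2"
    using M by (simp add: cheb_angle_def power_mult_distrib power_divide) (simp add: power2_eq_square field_simps)
  also have "\<dots> \<le> 4 * (real M)\<^sup>2 * c\<^sup>2 * (sin (cheb_angle M k / 2))\<^sup>2"
    using assms a by (intro mult_left_mono power_mono) auto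
  finally show ?thesis by (simp add: cheb_node_def)
qed

text \<open>Crude, but valid up to \<open>k = M\<close>: the half angle stays below 2, where the
  sine is at least a third of its argument; k - 1/2 \<ge> k / 2 and \<pi> > 3 do the rest.\<close>

lemma cheb_node_ge:
  assumes "k \<in> {1..M}"
  shows "c\<^sup>2 * (real k)\<^sup>2 / 4 \<le> cheb_node M (4 * (real M)\<^sup>2 * c\<^sup>2) k"
proof -
  let ?a = "cheb_angle M k / 2"
  have a: "0 \<le> ?a" "?a < 2" using cheb_angle_bounds[OF assms] pi_less_4 by auto
  then have "?a\<^sup>2 \<le> 2\<^sup>2" by (intro power_mono) auto
  then have "1 / 3 * ?a \<le> ?a * (1 - ?a\<^sup>2 / 6)" using a by (subst mult.commute) (intro mult_left_mono, auto)
  also have "\<dots> \<le> sin ?a" by (rule sin_ge_cubic[OF a(1)])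
  finally have "(1 / 3)\<^sup>2 * c\<^sup>2 * pi\<^sup>2 * (real k - 1 / 2)\<^sup>2 \<le> cheb_node M (4 * (real M)\<^sup>2 * c\<^sup>2) k"
    by (intro cheb_node_ge_aux assms) auto
  moreover have "c\<^sup>2 * (real k)\<^sup>2 / 4 \<le> (1 / 3)\<^sup>2 * c\<^sup>2 * pi\<^sup>2 * (real k - 1 / 2)\<^sup>2"
  proof -
    have "(real k / 2)\<^sup>2 \<le> (real k - 1 / 2)\<^sup>2" using assms by (intro power_mono) auto
    moreover have "3\<^sup>2 \<le> pi\<^sup>2" using pi_gt3 by (intro power_mono) auto
    ultimately have "3\<^sup>2 * (real k / 2)\<^sup>2 \<le> pi\<^sup>2 * (real k - 1 / 2)\<^sup>2" by (intro mult_mono) auto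
    then have "c\<^sup>2 / 9 * (3\<^sup>2 * (real k / 2)\<^sup>2) \<le> c\<^sup>2 / 9 * (pi\<^sup>2 * (real k - 1 / 2)\<^sup>2)"
      by (intro mult_left_mono) auto
    then show ?thesis by (simp add: power_divide mult_ac)
  qed
  ultimately show ?thesis by linarith
qed

section \<open>The tail product of the sequence\<close>

definition tail_prod :: "(nat \<Rightarrow> real) \<Rightarrow> real \<Rightarrow> real \<Rightarrow> real" where
  "tail_prod p R t = (\<Prod>n. if 1 \<le> n \<and> p n > R then (1 - t / p n)\<^sup>2 else 1)"

lemma tail_weight_eq: "tail_weight p \<nu> R t = t powr \<nu> * tail_prod p R t"
  by (simp add: tail_weight_def tail_prod_def)

locale bessel_like =
  fixes p :: "nat \<Rightarrow> real"
  assumes p_pos: "\<And>n. n \<ge> 1 \<Longrightarrow> p n > 0"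
    and p_mono: "strict_mono_on {1..} p"
    and p_lim: "(\<lambda>n. p n / (real n)\<^sup>2) \<longlonglongrightarrow> pi\<^sup>2"
begin

lemma p_less: "1 \<le> m \<Longrightarrow> m < n \<Longrightarrow> p m < p n"
  using p_mono by (auto simp: strict_mono_on_def)

lemma p_le: "1 \<le> m \<Longrightarrow> m \<le> n \<Longrightarrow> p m \<le> p n"
  using p_less[of m n] by (cases "m = n") auto

lemma eventually_p_ge: "\<theta> < 1 \<Longrightarrow> \<forall>\<^sub>F n in sequentially. \<theta> * pi\<^sup>2 * (real n)\<^sup>2 \<le> p n"
proof -
  assume "\<theta> < 1"
  then have "\<theta> * pi\<^sup>2 < pi\<^sup>2" by simp
  from order_tendstoD(1)[OF p_lim this] eventually_gt_at_top[of 0]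
  show ?thesis by eventually_elim (simp add: pos_less_divide_eq less_imp_le)
qed

lemma eventually_p_le: "\<theta> > 1 \<Longrightarrow> \<forall>\<^sub>F n in sequentially. p n \<le> \<theta> * pi\<^sup>2 * (real n)\<^sup>2"
proof -
  assume "\<theta> > 1"
  then have "pi\<^sup>2 < \<theta> * pi\<^sup>2" by simp
  from order_tendstoD(2)[OF p_lim this] eventually_gt_at_top[of 0]
  show ?thesis by eventually_elim (simp add: pos_divide_less_eq less_imp_le)
qed

lemma eventually_p_ge_square: "\<forall>\<^sub>F n in sequentially. (real n)\<^sup>2 \<le> p n"
  using eventually_p_ge[of "1/2", simplified]
proof eventually_elim
  case (elim n)
  have "3\<^sup>2 \<le> pi\<^sup>2" using pi_gt3 by (intro power_mono) auto
  then have "1 * (real n)\<^sup>2 \<le> pi\<^sup>2 / 2 * (real n)\<^sup>2" by (intro mult_right_mono) auto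
  then show ?case using elim by simp
qed

lemma p_at_top: "filterlim p at_top sequentially"
proof (rule filterlim_at_top_mono[OF filterlim_real_sequentially])
  show "\<forall>\<^sub>F n in sequentially. real n \<le> p n"
    using eventually_p_ge_square eventually_ge_at_top[of 1]
  proof eventually_elim
    case (elim n)
    then have "real n * 1 \<le> real n * real n" by (intro mult_left_mono) auto
    also have "\<dots> \<le> p n" using elim(1) by (simp only: power2_eq_square)
    finally show ?case by simp
  qed
qed

text \<open>As \<open>p\<close> increases, the counted indices form an initial segment. Hence the
  tail product runs exactly over the indices beyond \<open>count_upto p R\<close>.\<close>

lemma p_le_iff_count: "1 \<le> n \<Longrightarrow> p n \<le> R \<longleftrightarrow> n \<le> count_upto p R"
proof -
  assume n: "1 \<le> n"
  define A where "A = {n. 1 \<le> n \<and> p n \<le> R}"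
  have "\<forall>\<^sub>F n in sequentially. R + 1 \<le> p n" using p_at_top by (auto simp: filterlim_at_top)
  then obtain m where m: "\<And>n. n \<ge> m \<Longrightarrow> R + 1 \<le> p n" by (auto simp: eventually_sequentially)
  have Am: "A \<subseteq> {..m}"
  proof
    fix k assume "k \<in> A"
    then show "k \<in> {..m}" using m[of k] by (cases "k \<le> m") (auto simp: A_def)
  qed
  then have fin: "finite A" using finite_subset by blast
  have inj: "inj_on p A" using p_mono strict_mono_on_imp_inj_on by (intro inj_on_subset[of p "{1..}" A]) (auto simp: A_def)
  have "p ` {1..} \<inter> {0..R} = p ` A" using p_pos by (auto simp: A_def less_imp_le)
  then have cnt: "count_upto p R = card A" by (simp add: count_upto_def card_image[OF inj])
  have down: "{1..k} \<subseteq> A" if "k \<in> A" for k using that p_le[of _ k] by (force simp: A_def)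
  show ?thesis
  proof
    assume "p n \<le> R"
    then have "{1..n} \<subseteq> A" using down[of n] n by (auto simp: A_def)
    from card_mono[OF fin this] show "n \<le> count_upto p R" by (simp add: cnt)
  next
    assume le: "n \<le> count_upto p R"
    show "p n \<le> R"
    proof (rule ccontr)
      assume "\<not> p n \<le> R"
      have "A \<subseteq> {1..<n}"
      proof
        fix k assume "k \<in> A"
        then show "k \<in> {1..<n}" using p_le[OF n, of k] \<open>\<not> p n \<le> R\<close>
          by (cases "n \<le> k") (auto simp: A_def)
      qed
      then have "card A \<le> n - 1" using card_mono[of "{1..<n}" A] by simp
      then show False using le cnt n by linarith
    qed
  qed
qed

lemma count_at_top: "filterlim (count_upto p) at_top at_top"
  unfolding filterlim_at_top
proof
  fix Z
  show "\<forall>\<^sub>F R in at_top. Z \<le> count_upto p R"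
    using eventually_ge_at_top[of "p (Suc Z)"]
  proof eventually_elim
    case (elim R)
    then show ?case using p_le_iff_count[of "Suc Z" R] by simp
  qed
qed

lemma summable_inverse_p: "summable (\<lambda>n. 1 / p n)"
proof (rule summable_comparison_test_ev)
  show "summable (\<lambda>n. 1 / (real n)\<^sup>2)" using inverse_power_summable[of 2] by (simp add: inverse_eq_divide)
  show "\<forall>\<^sub>F n in sequentially. norm (1 / p n) \<le> 1 / (real n)\<^sup>2"
    using eventually_p_ge_square eventually_ge_at_top[of 1]
    by eventually_elim (use p_pos in \<open>auto intro!: divide_left_mono mult_pos_pos simp: less_imp_le\<close>)
qed

lemma convergent_tail_prod: "convergent_prod (\<lambda>n. if 1 \<le> n \<and> p n > R then (1 - t / p n)\<^sup>2 else 1)"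
proof (rule abs_convergent_prod_imp_convergent_prod, unfold abs_convergent_prod_conv_summable,
       rule summable_comparison_test_ev)
  show "summable (\<lambda>n. (2 * \<bar>t\<bar> + t\<^sup>2) * (1 / p n))" by (intro summable_mult summable_inverse_p)
  show "\<forall>\<^sub>F n in sequentially. norm (norm ((if 1 \<le> n \<and> p n > R then (1 - t / p n)\<^sup>2 else 1) - 1)) \<le> (2 * \<bar>t\<bar> + t\<^sup>2) * (1 / p n)"
    using eventually_p_ge_square eventually_ge_at_top[of 1]
  proof eventually_elim
    case (elim n)
    then have "1 \<le> (real n)\<^sup>2" by (simp add: one_le_power)
    then have p1: "p n \<ge> 1" using elim by linarith
    have "\<bar>(1 - t / p n)\<^sup>2 - 1\<bar> = \<bar>- 2 * t * (1 / p n) + t\<^sup>2 * (1 / p n) * (1 / p n)\<bar>"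
      by (simp add: power2_eq_square algebra_simps)
    also have "\<dots> \<le> \<bar>- 2 * t * (1 / p n)\<bar> + \<bar>t\<^sup>2 * (1 / p n) * (1 / p n)\<bar>" by (rule abs_triangle_ineq)
    also have "\<dots> = 2 * \<bar>t\<bar> * (1 / p n) + t\<^sup>2 * (1 / p n) * (1 / p n)" using p1 by (simp add: abs_mult)
    also have "t\<^sup>2 * (1 / p n) * (1 / p n) \<le> t\<^sup>2 * (1 / p n) * 1"
      using p1 by (intro mult_left_mono) auto
    finally have "\<bar>(1 - t / p n)\<^sup>2 - 1\<bar> \<le> (2 * \<bar>t\<bar> + t\<^sup>2) * (1 / p n)" by (simp add: algebra_simps)
    then show ?case using p1 by auto
  qed
qed

text \<open>Lets every comparison be carried out between finite products, for all large
  \<open>n\<close>.\<close>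

lemma tail_prod_LIMSEQ:
  "(\<lambda>n. (\<Prod>k\<in>{count_upto p R<..n}. 1 - t / p k)\<^sup>2) \<longlonglongrightarrow> tail_prod p R t"
proof -
  have "(\<Prod>i\<le>n. if 1 \<le> i \<and> p i > R then (1 - t / p i)\<^sup>2 else 1) =
      (\<Prod>k\<in>{count_upto p R<..n}. 1 - t / p k)\<^sup>2" for n
  proof -
    have "(\<Prod>i\<le>n. if 1 \<le> i \<and> p i > R then (1 - t / p i)\<^sup>2 else 1) =
      (\<Prod>i\<in>{count_upto p R<..n}. (1 - t / p i)\<^sup>2)"
    proof (rule prod.mono_neutral_cong_right)
      show "\<forall>i\<in>{..n} - {count_upto p R<..n}. (if 1 \<le> i \<and> p i > R then (1 - t / p i)\<^sup>2 else 1) = 1"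
        using p_le_iff_count[of _ R] by (auto simp: not_le[symmetric] simp del: not_le)
      fix i assume "i \<in> {count_upto p R<..n}"
      then show "(if 1 \<le> i \<and> p i > R then (1 - t / p i)\<^sup>2 else 1) = (1 - t / p i)\<^sup>2"
        using p_le_iff_count[of i R] by auto
    qed auto
    then show ?thesis by (simp add: prod_power_distrib)
  qed
  then show ?thesis using convergent_prod_LIMSEQ[OF convergent_tail_prod, of R t]
    by (simp only: tail_prod_def)
qed

lemma tail_factor:
  assumes "t \<in> {0..R}" "k > count_upto p R"
  shows "0 \<le> t / p k \<and> t / p k < 1"
proof -
  have "p k > R" "p k > 0" using assms p_le_iff_count[of k R] p_pos[of k] by auto
  then show ?thesis using assms by auto
qed

lemma tail_prod_pos: "t \<in> {0..R} \<Longrightarrow> 0 < tail_prod p R t"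
proof -
  assume t: "t \<in> {0..R}"
  have "(if 1 \<le> i \<and> p i > R then (1 - t / p i)\<^sup>2 else 1) \<noteq> 0" for i
    using tail_factor[OF t, of i] p_le_iff_count[of i R] by auto
  then have "tail_prod p R t \<noteq> 0" unfolding tail_prod_def
    by (intro prodinf_nonzero convergent_tail_prod)
  moreover have "0 \<le> tail_prod p R t" by (rule LIMSEQ_le_const[OF tail_prod_LIMSEQ]) auto
  ultimately show ?thesis by linarith
qed

lemma tail_prod_le:
  assumes t: "t \<in> {0..R}" and h: "h \<ge> 0"
    and le: "\<forall>\<^sub>F n in sequentially. (\<Prod>k\<in>{count_upto p R<..n}. 1 - t / p k) \<le> h"
  shows "tail_prod p R t \<le> h\<^sup>2"
proof (rule tendsto_upperbound[OF tail_prod_LIMSEQ])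
  show "\<forall>\<^sub>F n in sequentially. (\<Prod>k\<in>{count_upto p R<..n}. 1 - t / p k)\<^sup>2 \<le> h\<^sup>2"
    using le by eventually_elim
      (use tail_factor[OF t] in \<open>auto intro!: power_mono prod_nonneg simp: less_imp_le\<close>)
qed auto

lemma tail_prod_ge:
  assumes h: "h \<ge> 0"
    and le: "\<forall>\<^sub>F n in sequentially. h \<le> (\<Prod>k\<in>{count_upto p R<..n}. 1 - t / p k)"
  shows "h\<^sup>2 \<le> tail_prod p R t"
proof (rule tendsto_lowerbound[OF tail_prod_LIMSEQ])
  show "\<forall>\<^sub>F n in sequentially. h\<^sup>2 \<le> (\<Prod>k\<in>{count_upto p R<..n}. 1 - t / p k)\<^sup>2"
    using le by eventually_elim (use h in \<open>auto intro!: power_mono\<close>)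
qed auto

lemma tail_prod_le_1: "t \<in> {0..R} \<Longrightarrow> tail_prod p R t \<le> 1"
proof -
  assume t: "t \<in> {0..R}"
  have "(\<Prod>k\<in>{count_upto p R<..n}. 1 - t / p k) \<le> 1" for n
    using tail_factor[OF t] by (intro prod_one_minus_ge[THEN conjunct2]) (auto simp: less_imp_le)
  then show ?thesis using tail_prod_le[OF t, of 1] by simp
qed

lemma tail_prod_measurable: "tail_prod p R \<in> borel_measurable borel"
  by (rule borel_measurable_LIMSEQ_real[OF tail_prod_LIMSEQ]) simp

lemma power_weight_tail:
  assumes "R > 0" "\<nu> > -1" shows "power_weight (tail_weight p \<nu> R) R \<nu>"
proof
  have "(\<lambda>t. t powr \<nu> * tail_prod p R t) \<in> borel_measurable borel"
    using tail_prod_measurable by (intro borel_measurable_times) auto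
  then show "tail_weight p \<nu> R \<in> borel_measurable borel"
    by (simp add: tail_weight_eq[abs_def])
  fix t
  show "t \<in> {0..R} \<Longrightarrow> 0 \<le> tail_weight p \<nu> R t"
    using tail_prod_pos[of t R] by (simp add: tail_weight_eq)
  show "t \<in> {0..R} \<Longrightarrow> tail_weight p \<nu> R t \<le> t powr \<nu>"
    using tail_prod_le_1[of t R] by (simp add: tail_weight_eq mult_left_le)
  show "t \<in> {0<..<R} \<Longrightarrow> 0 < tail_weight p \<nu> R t"
    using tail_prod_pos[of t R] by (simp add: tail_weight_eq)
qed (use assms in auto)

text \<open>The sum of \<open>t / p k\<close> over \<open>k > N\<close> is at most t / N, since
  \<open>p k\<close> is eventually at least k^2. So at fixed \<open>t\<close> the product in the
  weight tends to 1, and the square root in the kernel contributes only a power of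
  \<open>x * y\<close>.\<close>

lemma tail_prod_near_1:
  "\<forall>\<^sub>F R in at_top. \<forall>t\<in>{0..R}. (1 - t / real (count_upto p R) \<ge> 0 \<longrightarrow> (1 - t / real (count_upto p R))\<^sup>2 \<le> tail_prod p R t)"
proof -
  obtain m where m: "\<And>n. n \<ge> m \<Longrightarrow> (real n)\<^sup>2 \<le> p n"
    using eventually_p_ge_square by (auto simp: eventually_sequentially)
  have "\<forall>\<^sub>F R in at_top. max 1 m \<le> count_upto p R"
    using count_at_top unfolding filterlim_at_top by (rule spec)
  then show ?thesis
  proof eventually_elim
    case (elim R)
    let ?N = "count_upto p R"
    show ?case
    proof (intro ballI impI tail_prod_ge)
      fix t assume t: "t \<in> {0..R}"
      have "1 - t / real ?N \<le> (\<Prod>k\<in>{?N<..n}. 1 - t / p k)" for n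
      proof -
        have "(\<Sum>k\<in>{?N<..n}. t / p k) \<le> (\<Sum>k\<in>{?N<..n}. t * (1 / (real k)\<^sup>2))"
        proof (intro sum_mono)
          fix k assume "k \<in> {?N<..n}"
          then have "(real k)\<^sup>2 \<le> p k" "0 < (real k)\<^sup>2" using m[of k] elim by auto
          then have "t / p k \<le> t / (real k)\<^sup>2" using t p_pos[of k] \<open>k \<in> _\<close> by (intro divide_left_mono mult_pos_pos) auto
          then show "t / p k \<le> t * (1 / (real k)\<^sup>2)" by simp
        qed
        also have "\<dots> \<le> t * (1 / real ?N)" unfolding sum_distrib_left[symmetric]
          using t elim by (intro mult_left_mono sum_inverse_squares_le) auto
        finally have "1 - t / real ?N \<le> 1 - (\<Sum>k\<in>{?N<..n}. t / p k)" by simp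
        also have "\<dots> \<le> (\<Prod>k\<in>{?N<..n}. 1 - t / p k)"
          using tail_factor[OF t] by (intro prod_one_minus_ge[THEN conjunct1]) (auto simp: less_imp_le)
        finally show ?thesis .
      qed
      then show "\<forall>\<^sub>F n in sequentially. 1 - t / real ?N \<le> (\<Prod>k\<in>{?N<..n}. 1 - t / p k)" by simp
    qed
  qed
qed

end

section \<open>Comparison with the Jacobi kernel\<close>

lemma set_integral_mono_subset:
  fixes f g :: "real \<Rightarrow> real"
  assumes "set_integrable lborel A f" "set_integrable lborel B g" "A \<subseteq> B"
    and "\<And>x. x \<in> A \<Longrightarrow> f x \<le> g x" "\<And>x. x \<in> B \<Longrightarrow> 0 \<le> g x"
  shows "(LBINT x:A. f x) \<le> (LBINT x:B. g x)"
  unfolding set_lebesgue_integral_def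
  by (rule integral_mono) (use assms in \<open>auto simp: set_integrable_def indicator_def\<close>)

definition node_poly :: "(nat \<Rightarrow> real) \<Rightarrow> nat set \<Rightarrow> real poly" where
  "node_poly z I = (\<Prod>k\<in>I. [:1, - (1 / z k):])"

lemma poly_node_poly: "poly (node_poly z I) t = (\<Prod>k\<in>I. 1 - t / z k)"
  by (simp add: node_poly_def poly_prod)

lemma degree_linear_le: "degree [:1, c:] \<le> Suc 0"
  by (rule degree_le) (auto simp: coeff_pCons split: nat.split)

lemma degree_linear_power_le: "degree ([:1, c:] ^ d) \<le> d"
  using degree_power_le[of "[:1, c:]" d] mult_right_mono[OF degree_linear_le[of c], of d] by linarith

lemma degree_node_poly: "degree (node_poly z I) \<le> card I"
proof (cases "finite I")
  case True
  have "degree (node_poly z I) \<le> (\<Sum>k\<in>I. 1)" unfolding node_poly_def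
    by (rule order_trans[OF degree_prod_sum_le[OF True]])
       (simp only: o_def, intro sum_mono, simp only: degree_linear_le One_nat_def)
  then show ?thesis by simp
qed (simp add: node_poly_def)

text \<open>The factor theorem, one node at a time. The exact degree matters: a polynomial of degree
  below \<open>M\<close> that vanishes at \<open>M - N\<close> nodes leaves a quotient of degree
  below \<open>N\<close>.\<close>

lemma node_poly_quotient:
  assumes "finite I" "inj_on z I" "\<And>k. k \<in> I \<Longrightarrow> z k \<noteq> 0" "\<And>k. k \<in> I \<Longrightarrow> poly G (z k) = 0"
    and "G \<noteq> 0"
  shows "\<exists>q. G = q * node_poly z I \<and> degree q + card I = degree G"
  using assms
proof (induction I)
  case empty
  show ?case by (rule exI[of _ G]) (simp add: node_poly_def)
next
  case (insert j I)
  have "\<exists>q. G = q * node_poly z I \<and> degree q + card I = degree G"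
  proof (rule insert.IH)
    show "inj_on z I" using insert.prems(1) by (rule inj_on_subset) auto
  qed (use insert.prems in blast)+
  then obtain q where q: "G = q * node_poly z I" "degree q + card I = degree G" by blast
  have "poly (node_poly z I) (z j) \<noteq> 0"
  proof -
    have "1 - z j / z k \<noteq> 0" if "k \<in> I" for k
    proof
      assume "1 - z j / z k = 0"
      then have "z j = z k" using insert.prems(2)[OF insertI2[OF that]] by (simp only: right_minus_eq) (simp add: divide_eq_eq)
      then have "j = k" by (rule inj_onD[OF insert.prems(1)]) (use that in auto)
      then show False using that insert.hyps(2) by simp
    qed
    then show ?thesis using insert.hyps(1) by (simp only: poly_node_poly prod_zero_iff) blast
  qed
  moreover have "poly q (z j) * poly (node_poly z I) (z j) = 0"
    using insert.prems(3)[of j] q(1) by (metis insertI1 poly_mult)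
  ultimately have "poly q (z j) = 0" by simp
  then obtain r where r: "q = [:- z j, 1:] * r" by (metis dvdE poly_eq_0_iff_dvd)
  have zj: "z j \<noteq> 0" using insert by auto
  have lin: "[:- z j, 1:] = smult (- z j) [:1, - (1 / z j):]" using zj by simp
  have "r \<noteq> 0" using r q insert.prems by auto
  then have "degree q = degree [:- z j, 1:] + degree r" unfolding r by (intro degree_mult_eq) auto
  then have "degree q = Suc (degree r)" by simp
  moreover have "G = smult (- z j) r * node_poly z (insert j I)"
  proof -
    have np: "node_poly z (insert j I) = [:1, - (1 / z j):] * node_poly z I"
      unfolding node_poly_def using insert.hyps by (intro prod.insert)
    have gen: "smult a L * r * n = smult a r * (L * n)" for a and L n :: "real poly"
      by (simp add: mult_ac)
    have "G = [:- z j, 1:] * r * node_poly z I" using q(1) by (simp only: r)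
    then show ?thesis by (simp only: lin gen np)
  qed
  ultimately show ?case using q insert.hyps zj
    by (intro exI[of _ "smult (- z j) r"]) auto
qed

text \<open>Product of three losses: (2 M)^2 from interpolating at \<open>M\<close> nodes with
  Lagrange polynomials bounded by 2, the constant of \<open>poly_sup_le_L2\<close>, and 1 / (\<nu> +
  1) from integrating the power.\<close>

definition nik_const :: "real \<Rightarrow> nat \<Rightarrow> real" where
  "nik_const \<nu> M = 16 * (real M)\<^sup>2 * (16 * real M ^ 3) powr (1 + \<bar>\<nu>\<bar>) / (\<nu> + 1)"

lemma cheb_node_pos: "S > 0 \<Longrightarrow> k \<in> {1..M} \<Longrightarrow> cheb_node M S k > 0"
  using cheb_angle_bounds[of k M] unfolding cheb_node_def
  by (intro mult_pos_pos zero_less_power sin_gt_zero) auto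

lemma cheb_node_mono: "S > 0 \<Longrightarrow> 1 \<le> j \<Longrightarrow> j \<le> k \<Longrightarrow> k \<le> M \<Longrightarrow> cheb_node M S j \<le> cheb_node M S k"
  using cheb_node_strict_mono[of S j k M] by (cases "j = k") auto

lemma cheb_sum_bound:
  assumes "S > 0" "t \<in> {0..S}" "I \<subseteq> {1..M}" "\<And>k. k \<in> I \<Longrightarrow> \<bar>a k\<bar> \<le> b" "0 \<le> b"
  shows "\<bar>\<Sum>k\<in>I. a k * poly (cheb_lagrange M S k) t\<bar> \<le> 2 * real M * b"
proof -
  have fin: "finite I" using assms(3) finite_subset by blast
  have "\<bar>\<Sum>k\<in>I. a k * poly (cheb_lagrange M S k) t\<bar> \<le> (\<Sum>k\<in>I. b * 2)"
    by (rule order_trans[OF sum_abs], intro sum_mono, unfold abs_mult, intro mult_mono)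
       (use assms cheb_lagrange_bound[OF assms(1,2)] in auto)
  also have "\<dots> = 2 * b * real (card I)" by simp
  also have "\<dots> \<le> 2 * b * real M"
    using card_mono[OF _ assms(3)] assms(5) by (intro mult_left_mono) auto
  finally show ?thesis by (simp add: mult_ac)
qed

lemma linear_power_bounds:
  fixes S t :: real
  assumes "S > 0" "t \<in> {0..S}"
  shows "0 \<le> (1 - t / S) ^ d" "(1 - t / S) ^ d \<le> 1"
  using assms by (auto intro!: zero_le_power power_le_one)

context bessel_like begin

text \<open>The polynomial \<open>q\<close> times node polynomial times
  \<open>(1 - t / S) ^ d\<close> has degree below \<open>M\<close> because
  \<open>N + d \<le> N2\<close>, so the Jacobi kernel bounds its value at \<open>x\<close>. Since
  \<open>R'\<close> is the node \<open>N2\<close>, the nodes where the node polynomial does not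
  vanish all lie in [0, R'], where the hypothesis \<open>le\<close> and the Nikolskii inequality
  control the values; interpolation carries the bound to [0, S].\<close>

lemma upper_finite:
  assumes nu: "\<nu> > -1" and R: "R > 0" and S: "S > 0" and N2: "N2 \<in> {1..M}" and NN: "N + d \<le> N2"
    and R': "R' = cheb_node M S N2" "R' \<le> R"
    and le: "\<And>t. t \<in> {0..R'} \<Longrightarrow> (poly (node_poly (cheb_node M S) {N2<..M}) t)\<^sup>2 \<le> tail_prod p R t"
    and q: "degree q < N" and x: "x \<in> {0..R'}"
  shows "(poly q x * poly (node_poly (cheb_node M S) {N2<..M}) x * (1 - x / S) ^ d)\<^sup>2 \<le>
     jac_kernel \<nu> S M x x * ((1 + nik_const \<nu> M * (S / R') powr (\<nu> + 1) * (1 - R' / S) ^ (2 * d)) *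
       (LBINT t:{0..R}. poly q t * poly q t * tail_weight p \<nu> R t))"
proof -
  interpret J: jacobi \<nu> S by standard (use nu S in auto)
  interpret W: power_weight "tail_weight p \<nu> R" R \<nu> by (rule power_weight_tail[OF R nu])
  have R'pos: "R' > 0" and R'S: "R' \<le> S" using cheb_node_pos[OF S N2] cheb_node_range[OF S, of M N2] R' by auto
  interpret J': jacobi \<nu> R' by standard (use nu R'pos in auto)
  let ?h = "node_poly (cheb_node M S) {N2<..M}"
  define g where "g = q * ?h"
  define D where "D = [:1, - (1 / S):] ^ d"
  have Dt: "poly D t = (1 - t / S) ^ d" for t by (simp add: D_def poly_power)
  have dh: "degree ?h \<le> M - N2" using degree_node_poly[of "cheb_node M S" "{N2<..M}"] by simp
  have dg: "degree g < M - d" unfolding g_def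
    using degree_mult_le[of q ?h] dh q N2 NN by auto
  have dD: "degree D \<le> d" unfolding D_def by (rule degree_linear_power_le)
  have df: "degree (g * D) < M" using degree_mult_le[of g D] dg dD by linarith
  define I where "I = (LBINT t:{0..R'}. (poly g t)\<^sup>2 * t powr \<nu>)"
  have I0: "I \<ge> 0" unfolding I_def set_lebesgue_integral_def by (intro integral_nonneg_AE) auto
  define b where "b = sqrt (4 * (16 * real M ^ 3) powr (1 + \<bar>\<nu>\<bar>) / R' powr (\<nu> + 1) * I)"
  have b0: "b \<ge> 0" using I0 by (simp add: b_def)
  have b2: "b\<^sup>2 = 4 * (16 * real M ^ 3) powr (1 + \<bar>\<nu>\<bar>) / R' powr (\<nu> + 1) * I"
    using I0 by (simp add: b_def)
  have gb: "\<bar>poly g t\<bar> \<le> b" if "t \<in> {0..R'}" for t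
  proof -
    have "(poly g t)\<^sup>2 \<le> b\<^sup>2" unfolding b2 I_def
      using dg by (intro poly_sup_le_L2[OF R'pos nu _ that]) auto
    then show ?thesis using b0 abs_le_square_iff[of "poly g t" b] by simp
  qed
  have gS: "\<bar>poly g t\<bar> \<le> 2 * real M * b" if t: "t \<in> {0..S}" for t
  proof -
    have "poly g t = (\<Sum>k=1..M. poly g (cheb_node M S k) * poly (cheb_lagrange M S k) t)"
      using dg by (subst cheb_interpolation[OF S, of g M]) (auto simp: poly_sum)
    also have "\<bar>\<dots>\<bar> \<le> 2 * real M * b"
    proof (rule cheb_sum_bound[OF S t _ _ b0])
      fix k assume k: "k \<in> {1..M}"
      show "\<bar>poly g (cheb_node M S k)\<bar> \<le> b"
      proof (cases "k \<le> N2")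
        case True
        then show ?thesis using k N2 R' cheb_node_mono[OF S, of k N2 M] cheb_node_range[OF S, of M k]
          by (intro gb) auto
      next
        case False
        then have "poly ?h (cheb_node M S k) = 0"
          using k cheb_node_pos[OF S k] by (auto simp: poly_node_poly intro!: bexI[of _ k])
        then show ?thesis using b0 by (simp add: g_def)
      qed
    qed auto
    finally show ?thesis .
  qed
  define e where "e = (1 - R' / S) ^ (2 * d)"
  define B where "B = (2 * real M * b)\<^sup>2 * e"
  have e0: "e \<ge> 0" unfolding e_def by (simp add: power_mult)
  \<comment> \<open>On [0, R'] the factor \<open>D\<close> is at most 1; beyond \<open>R'\<close>
    its decay is set against the bound \<open>2 * M * b\<close> for \<open>g\<close>.\<close>
  have pt: "(poly (g * D) t)\<^sup>2 * t powr \<nu> \<le> indicator {0..R'} t * ((poly g t)\<^sup>2 * t powr \<nu>) + B * t powr \<nu>"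
    if t: "t \<in> {0..S}" for t
  proof (cases "t \<le> R'")
    case True
    have "(poly D t)\<^sup>2 \<le> 1" using linear_power_bounds[OF S t, of d] by (intro power_le_one) (simp_all only: Dt)
    then have "(poly g t)\<^sup>2 * (poly D t)\<^sup>2 * t powr \<nu> \<le> (poly g t)\<^sup>2 * 1 * t powr \<nu>"
      by (intro mult_right_mono mult_left_mono) auto
    moreover have "0 \<le> B * t powr \<nu>" using e0 by (simp add: B_def)
    ultimately show ?thesis using True t by (simp add: power_mult_distrib)
  next
    case False
    have "(1 - t / S) ^ (2 * d) \<le> e" unfolding e_def
      using False t S by (intro power_mono diff_left_mono divide_right_mono) auto
    moreover have "(poly D t)\<^sup>2 = (1 - t / S) ^ (2 * d)" by (simp add: Dt power_mult mult.commute[of 2])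
    moreover have "\<bar>poly g t\<bar>\<^sup>2 \<le> (2 * real M * b)\<^sup>2" using gS[OF t] by (intro power_mono) auto
    ultimately have "(poly g t)\<^sup>2 * (poly D t)\<^sup>2 * t powr \<nu> \<le> (2 * real M * b)\<^sup>2 * e * t powr \<nu>"
      by (intro mult_right_mono mult_mono) auto
    then show ?thesis using False by (simp add: power_mult_distrib B_def)
  qed
  have int1: "set_integrable lborel {0..S} (\<lambda>t. indicator {0..R'} t * ((poly g t)\<^sup>2 * t powr \<nu>))"
  proof -
    have "set_integrable lborel {0..R'} (\<lambda>t. (poly g t)\<^sup>2 * t powr \<nu>)"
      using J'.set_integrable_poly2[of g g] by (simp add: power2_eq_square)
    moreover have "indicator {0..S} t *\<^sub>R (indicator {0..R'} t * ((poly g t)\<^sup>2 * t powr \<nu>)) = indicator {0..R'} t *\<^sub>R ((poly g t)\<^sup>2 * t powr \<nu>)" for t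
      using R'S by (auto simp: indicator_def)
    ultimately show ?thesis by (simp only: set_integrable_def)
  qed
  have int2: "set_integrable lborel {0..S} (\<lambda>t. B * t powr \<nu>)"
    using powr_set_integral(1)[OF nu, of S] S by simp
  have "J.wip (g * D) (g * D) \<le> (LBINT t:{0..S}. indicator {0..R'} t * ((poly g t)\<^sup>2 * t powr \<nu>) + B * t powr \<nu>)"
    unfolding J.wip_eq using J.set_integrable_poly2[of "g * D" "g * D"] int1 int2 pt
    by (intro set_integral_mono set_integral_add) (auto simp: power2_eq_square)
  also have "\<dots> = (LBINT t:{0..S}. indicator {0..R'} t * ((poly g t)\<^sup>2 * t powr \<nu>)) + (LBINT t:{0..S}. B * t powr \<nu>)"
    using int1 int2 by (rule set_integral_add)
  also have "(LBINT t:{0..S}. B * t powr \<nu>) = B * (S powr (\<nu> + 1) / (\<nu> + 1))"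
    using powr_set_integral(2)[OF nu, of S] S by simp
  also have "(LBINT t:{0..S}. indicator {0..R'} t * ((poly g t)\<^sup>2 * t powr \<nu>)) = I"
    unfolding I_def set_lebesgue_integral_def using R'S
    by (intro Bochner_Integration.integral_cong) (auto simp: indicator_def)
  also have "I + B * (S powr (\<nu> + 1) / (\<nu> + 1)) = (1 + nik_const \<nu> M * (S / R') powr (\<nu> + 1) * e) * I"
    unfolding B_def power_mult_distrib b2 nik_const_def using R'pos S nu
    by (simp add: powr_divide field_simps)
  also have "I \<le> W.wip q q"
    unfolding I_def W.wip_def
  proof (rule set_integral_mono_subset[OF _ W.set_integrable_poly2])
    show "set_integrable lborel {0..R'} (\<lambda>t. (poly g t)\<^sup>2 * t powr \<nu>)"
      using J'.set_integrable_poly2[of g g] by (simp add: power2_eq_square)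
    show "{0..R'} \<subseteq> {0..R}" using R' by auto
    show "(poly g t)\<^sup>2 * t powr \<nu> \<le> poly q t * poly q t * tail_weight p \<nu> R t" if "t \<in> {0..R'}" for t
    proof -
      have "(poly q t)\<^sup>2 * t powr \<nu> * (poly ?h t)\<^sup>2 \<le> (poly q t)\<^sup>2 * t powr \<nu> * tail_prod p R t"
        using le[OF that] by (intro mult_left_mono) auto
      then show ?thesis by (simp add: g_def power_mult_distrib tail_weight_eq power2_eq_square mult_ac)
    qed
    show "0 \<le> poly q t * poly q t * tail_weight p \<nu> R t" if "t \<in> {0..R}" for t
      using W.w_nonneg[OF that] by simp
  qed
  finally have main: "J.wip (g * D) (g * D) \<le> (1 + nik_const \<nu> M * (S / R') powr (\<nu> + 1) * e) * W.wip q q"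
    using nu e0 by (simp add: mult_left_mono nik_const_def add_nonneg_nonneg)
  have "jac_kernel \<nu> S M x x \<ge> 0"
    unfolding J.jac_kernel_eq by (intro sum_nonneg) auto
  then have "(poly (g * D) x)\<^sup>2 \<le> jac_kernel \<nu> S M x x * ((1 + nik_const \<nu> M * (S / R') powr (\<nu> + 1) * e) * W.wip q q)"
    by (intro order_trans[OF J.jac_kernel_bound[OF disjI2[OF df]]] mult_left_mono main)
  then show ?thesis by (simp add: g_def Dt e_def W.wip_def)
qed

text \<open>The Jacobi kernel at \<open>y\<close>, damped by \<open>(1 - t / S) ^ d\<close>, is tiny
  at the nodes beyond \<open>N\<close>. Correcting it by the interpolant of these values makes it
  divisible by the node polynomial, and the quotient is the competitor \<open>q\<close>. The last
  conclusion says that the correction is uniformly small; the second, that \<open>q\<close> has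
  almost the squared norm \<open>k\<close> of the Jacobi kernel.\<close>

lemma lower_finite:
  assumes nu: "\<nu> > -1" and R: "R > 0" and S: "S \<ge> R" and N: "1 \<le> N" "N < M" and M0: "1 \<le> M0" "M0 + d \<le> M"
    and le: "\<And>t. t \<in> {0..R} \<Longrightarrow> tail_prod p R t \<le> (poly (node_poly (cheb_node M S) {N<..M}) t)\<^sup>2"
    and \<delta>: "nik_const \<nu> M * (1 - cheb_node M S (Suc N) / S) ^ (2 * d) \<le> \<delta>" "0 < \<delta>"
    and k: "k = jac_kernel \<nu> S M0 y y"
  shows "\<exists>q. degree q < N \<and>
     (LBINT t:{0..R}. poly q t * poly q t * tail_weight p \<nu> R t) \<le> k * (1 + sqrt \<delta>)\<^sup>2 \<and>
     (\<forall>x\<in>{0..S}. (poly q x * poly (node_poly (cheb_node M S) {N<..M}) x - jac_kernel \<nu> S M0 x y * (1 - x / S) ^ d)\<^sup>2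
        \<le> \<delta> * (\<nu> + 1) * k / S powr (\<nu> + 1))"
proof -
  have S0: "S > 0" using R S by simp
  interpret J: jacobi \<nu> S by standard (use nu S0 in auto)
  interpret W: power_weight "tail_weight p \<nu> R" R \<nu> by (rule power_weight_tail[OF R nu])
  let ?z = "cheb_node M S"
  let ?h = "node_poly ?z {N<..M}"
  define K where "K = (\<Sum>i<M0. smult (poly (J.jac_on i) y) (J.jac_on i))"
  define D where "D = [:1, - (1 / S):] ^ d"
  have Dt: "poly D t = (1 - t / S) ^ d" for t by (simp add: D_def poly_power)
  have Kt: "poly K t = jac_kernel \<nu> S M0 t y" for t
    by (simp add: K_def poly_sum J.jac_kernel_eq mult.commute)
  have dK: "degree K < M0" unfolding K_def using M0
    by (intro degree_sum_less) (auto simp: J.degree_jac_on)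
  have dD: "degree D \<le> d" unfolding D_def by (rule degree_linear_power_le)
  define r where "r = K * D"
  have dr: "degree r < M" unfolding r_def using degree_mult_le[of K D] dK dD M0 by linarith
  have kK: "J.wip K K = k"
  proof -
    have "J.wip K (J.jac_on j) = poly (J.jac_on j) y" if "j < M0" for j
      using J.orthonormal_sum[OF J.orthonormal_jac_on that] by (simp add: K_def J.ip_sum J.ip_smult)
    then have "J.wip K K = (\<Sum>i<M0. poly (J.jac_on i) y * poly (J.jac_on i) y)"
      by (subst J.orthonormal_parseval[OF J.orthonormal_jac_on, of K M0]) (use dK in \<open>auto simp: J.ip_commute[of _ K]\<close>)
    then show ?thesis by (simp add: k J.jac_kernel_eq)
  qed
  have k0: "k \<ge> 0" using J.ip_nonneg[of K] kK by simp
  \<comment> \<open>Interpolation turns values bounded by \<open>b\<close> into a function bounded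
    by \<open>2 * M * b\<close>, whose square is to be the error allowed in the claim.\<close>
  define b where "b = sqrt (\<delta> * (\<nu> + 1) * k / S powr (\<nu> + 1)) / (2 * real M)"
  have b0: "b \<ge> 0" using \<delta> nu k0 by (simp add: b_def)
  have Mb2: "(2 * real M * b)\<^sup>2 = \<delta> * (\<nu> + 1) * k / S powr (\<nu> + 1)"
    using \<delta> nu k0 N by (simp add: b_def)
  have rb: "\<bar>poly r (?z l)\<bar> \<le> b" if l: "l \<in> {N<..M}" for l
  proof -
    have zl: "?z l \<in> {0..S}" by (rule cheb_node_range[OF S0])
    have "(poly K (?z l))\<^sup>2 \<le> 4 * (16 * real M ^ 3) powr (1 + \<bar>\<nu>\<bar>) / S powr (\<nu> + 1) * k"
      using poly_sup_le_L2[OF S0 nu _ zl, of K M] dK M0 kK by (simp add: J.wip_eq)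
    moreover have "(poly D (?z l))\<^sup>2 \<le> (1 - ?z (Suc N) / S) ^ (2 * d)"
    proof -
      have "(poly D (?z l))\<^sup>2 = (1 - ?z l / S) ^ (2 * d)" by (simp add: Dt power_mult mult.commute[of 2])
      also have "\<dots> \<le> (1 - ?z (Suc N) / S) ^ (2 * d)"
        using l zl S0 cheb_node_mono[OF S0, of "Suc N" l M]
        by (intro power_mono diff_left_mono divide_right_mono) auto
      finally show ?thesis .
    qed
    ultimately have "(poly r (?z l))\<^sup>2 \<le> 4 * (16 * real M ^ 3) powr (1 + \<bar>\<nu>\<bar>) / S powr (\<nu> + 1) * k * (1 - ?z (Suc N) / S) ^ (2 * d)"
      unfolding r_def poly_mult power_mult_distrib using k0 by (intro mult_mono) auto
    also have "\<dots> = nik_const \<nu> M * (1 - ?z (Suc N) / S) ^ (2 * d) * ((\<nu> + 1) * k / S powr (\<nu> + 1)) / (2 * real M)\<^sup>2"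
      using nu N by (simp add: nik_const_def power_mult_distrib)
    also have "\<dots> \<le> \<delta> * ((\<nu> + 1) * k / S powr (\<nu> + 1)) / (2 * real M)\<^sup>2"
      using \<delta> nu k0 by (intro divide_right_mono mult_right_mono) auto
    also have "\<dots> = b\<^sup>2" using \<delta> nu k0 by (simp add: b_def power_divide)
    finally show ?thesis using b0 abs_le_square_iff[of "poly r (?z l)" b] by simp
  qed
  \<comment> \<open>\<open>E\<close> takes the values of \<open>r\<close> at the nodes beyond
    \<open>N\<close> and vanishes at the other nodes.\<close>
  define E where "E = (\<Sum>l\<in>{N<..M}. smult (poly r (?z l)) (cheb_lagrange M S l))"
  define G where "G = r - E"
  have Eb: "\<bar>poly E t\<bar> \<le> 2 * real M * b" if "t \<in> {0..S}" for t
    unfolding E_def poly_sum poly_smult by (rule cheb_sum_bound[OF S0 that _ rb b0]) auto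
  have E2: "(poly E t)\<^sup>2 \<le> \<delta> * (\<nu> + 1) * k / S powr (\<nu> + 1)" if "t \<in> {0..S}" for t
    using Eb[OF that] unfolding Mb2[symmetric] by (metis abs_ge_zero power2_abs power_mono)
  have dE: "degree E < M" unfolding E_def using N
    by (intro degree_sum_less) (auto intro!: le_less_trans[OF degree_smult_le] degree_cheb_lagrange simp del: degree_smult_eq)
  have dG: "degree G < M" unfolding G_def using dr dE by (intro degree_diff_less)
  have Gz: "poly G (?z l) = 0" if l: "l \<in> {N<..M}" for l
  proof -
    have "poly E (?z l) = (\<Sum>j\<in>{N<..M}. if j = l then poly r (?z j) else 0)"
      unfolding E_def poly_sum using l N
      by (intro sum.cong) (auto simp: cheb_lagrange_node[OF S0])
    then show ?thesis using l by (simp add: G_def)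
  qed
  have "\<exists>q. G = q * ?h \<and> degree q < N"
  proof (cases "G = 0")
    case True
    then show ?thesis using N by (intro exI[of _ 0]) auto
  next
    case False
    have "\<exists>q. G = q * ?h \<and> degree q + card {N<..M} = degree G"
    proof (rule node_poly_quotient[OF _ _ _ Gz False])
      show "inj_on ?z {N<..M}" by (rule inj_on_subset[OF cheb_node_inj[OF S0]]) auto
      show "?z l \<noteq> 0" if "l \<in> {N<..M}" for l using cheb_node_pos[OF S0, of l M] that by auto
    qed auto
    then show ?thesis using dG N by auto
  qed
  then obtain q where q: "G = q * ?h" "degree q < N" by blast
  have int_r: "set_integrable lborel {0..S} (\<lambda>t. (1 + sqrt \<delta>) * ((poly K t)\<^sup>2 * t powr \<nu>))"
    using J.set_integrable_poly2[of K K] by (simp add: power2_eq_square)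
  have int_E: "set_integrable lborel {0..S} (\<lambda>t. (1 + 1 / sqrt \<delta>) * (\<delta> * (\<nu> + 1) * k / S powr (\<nu> + 1)) * t powr \<nu>)"
    using powr_set_integral(1)[OF nu, of S] S0 by simp
  have "W.wip q q \<le> (LBINT t:{0..S}. (1 + sqrt \<delta>) * ((poly K t)\<^sup>2 * t powr \<nu>) +
      (1 + 1 / sqrt \<delta>) * (\<delta> * (\<nu> + 1) * k / S powr (\<nu> + 1)) * t powr \<nu>)"
    unfolding W.wip_def
  proof (rule set_integral_mono_subset[OF W.set_integrable_poly2 set_integral_add(1)[OF int_r int_E]])
    show "{0..R} \<subseteq> {0..S}" using S by auto
    fix t
    show "0 \<le> (1 + sqrt \<delta>) * ((poly K t)\<^sup>2 * t powr \<nu>) + (1 + 1 / sqrt \<delta>) * (\<delta> * (\<nu> + 1) * k / S powr (\<nu> + 1)) * t powr \<nu>"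
      using \<delta> k0 nu by (intro add_nonneg_nonneg mult_nonneg_nonneg) auto
    assume t: "t \<in> {0..R}"
    then have tS: "t \<in> {0..S}" using S by auto
    have sd: "sqrt \<delta> > 0" using \<delta> by simp
    \<comment> \<open>With \<open>s = sqrt \<delta>\<close> the contributions of the kernel and of
      the correction add up to the perfect square in the claim.\<close>
    have young: "(a - e)\<^sup>2 \<le> (1 + s) * a\<^sup>2 + (1 + 1 / s) * e\<^sup>2" if "s > 0" for a e s :: real
    proof -
      have "0 \<le> (s * a + e)\<^sup>2 / s" using that by simp
      also have "\<dots> = (1 + s) * a\<^sup>2 + (1 + 1 / s) * e\<^sup>2 - (a - e)\<^sup>2"
        using that by (simp add: power2_eq_square field_simps)
      finally show ?thesis by simp
    qed
    have rK: "(poly r t)\<^sup>2 \<le> (poly K t)\<^sup>2"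
    proof -
      have "(poly D t)\<^sup>2 \<le> 1" using linear_power_bounds[OF S0 tS, of d] by (intro power_le_one) (simp_all only: Dt)
      then have "(poly K t)\<^sup>2 * (poly D t)\<^sup>2 \<le> (poly K t)\<^sup>2 * 1" by (intro mult_left_mono) auto
      then show ?thesis by (simp add: r_def power_mult_distrib)
    qed
    have "(poly q t)\<^sup>2 * tail_prod p R t \<le> (poly q t)\<^sup>2 * (poly ?h t)\<^sup>2"
      using le[OF t] by (intro mult_left_mono) auto
    also have "\<dots> = (poly r t - poly E t)\<^sup>2" using q(1) by (simp add: G_def power_mult_distrib[symmetric] flip: poly_mult poly_diff)
    also have "\<dots> \<le> (1 + sqrt \<delta>) * (poly r t)\<^sup>2 + (1 + 1 / sqrt \<delta>) * (poly E t)\<^sup>2" by (rule young[OF sd])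
    also have "\<dots> \<le> (1 + sqrt \<delta>) * (poly K t)\<^sup>2 + (1 + 1 / sqrt \<delta>) * (\<delta> * (\<nu> + 1) * k / S powr (\<nu> + 1))"
      using sd rK E2[OF tS] by (intro add_mono mult_left_mono) auto
    finally have "(poly q t)\<^sup>2 * tail_prod p R t * t powr \<nu> \<le>
       ((1 + sqrt \<delta>) * (poly K t)\<^sup>2 + (1 + 1 / sqrt \<delta>) * (\<delta> * (\<nu> + 1) * k / S powr (\<nu> + 1))) * t powr \<nu>"
      by (intro mult_right_mono) auto
    then have "(poly q t)\<^sup>2 * tail_prod p R t * t powr \<nu> \<le> (1 + sqrt \<delta>) * (poly K t)\<^sup>2 * t powr \<nu> +
       (1 + 1 / sqrt \<delta>) * (\<delta> * (\<nu> + 1) * k / S powr (\<nu> + 1)) * t powr \<nu>"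
      unfolding distrib_right[of "(1 + sqrt \<delta>) * (poly K t)\<^sup>2"] .
    then show "poly q t * poly q t * tail_weight p \<nu> R t \<le> (1 + sqrt \<delta>) * ((poly K t)\<^sup>2 * t powr \<nu>) +
       (1 + 1 / sqrt \<delta>) * (\<delta> * (\<nu> + 1) * k / S powr (\<nu> + 1)) * t powr \<nu>"
      by (simp only: tail_weight_eq power2_eq_square mult_ac)
  qed
  also have "\<dots> = (1 + sqrt \<delta>) * k + (1 + 1 / sqrt \<delta>) * (\<delta> * (\<nu> + 1) * k / S powr (\<nu> + 1)) * (S powr (\<nu> + 1) / (\<nu> + 1))"
    using kK powr_set_integral(2)[OF nu, of S] S0 by (subst set_integral_add(2)[OF int_r int_E]) (simp add: J.wip_eq)
  also have "\<dots> = k * (1 + sqrt \<delta>)\<^sup>2"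
  proof -
    define s where "s = sqrt \<delta>"
    have s: "s > 0" "\<delta> = s * s" using \<delta> by (auto simp: s_def)
    have arrange: "(1 + s) * k + (1 + 1 / s) * (s * s * n * k / P) * (P / n) = k * (1 + s)\<^sup>2"
      if "P > 0" "n > 0" for P n :: real
    proof -
      have "(1 + 1 / s) * (s * s * n * k / P) * (P / n) = (1 + 1 / s) * (s * s * k)" using that by simp
      also have "\<dots> = s * s * k + s * k" using s(1) by (simp add: distrib_right)
      finally show ?thesis by (simp add: power2_eq_square algebra_simps)
    qed
    have "(1 + s) * k + (1 + 1 / s) * (\<delta> * (\<nu> + 1) * k / S powr (\<nu> + 1)) * (S powr (\<nu> + 1) / (\<nu> + 1)) = k * (1 + s)\<^sup>2"
      unfolding s(2) using S0 nu by (intro arrange) auto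
    then show ?thesis unfolding s_def .
  qed
  finally have "W.wip q q \<le> k * (1 + sqrt \<delta>)\<^sup>2" .
  moreover have "poly q x * poly ?h x - jac_kernel \<nu> S M0 x y * (1 - x / S) ^ d = - poly E x" for x
  proof -
    have "poly q x * poly ?h x = poly G x" by (simp add: q(1))
    then show ?thesis by (simp add: G_def r_def Kt Dt)
  qed
  ultimately show ?thesis using q(2) E2 by (intro exI[of _ q]) (auto simp: W.wip_def)
qed

end

section \<open>Domination between tail products and node polynomials\<close>

definition isqrt :: "nat \<Rightarrow> nat" where "isqrt N = nat \<lfloor>sqrt (real N)\<rfloor>"

lemma isqrt_le: "real (isqrt N) \<le> sqrt (real N)"
  unfolding isqrt_def by (rule of_nat_floor) simp

lemma isqrt_ge: "sqrt (real N) - 1 \<le> real (isqrt N)"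
proof -
  have "real_of_int \<lfloor>sqrt (real N)\<rfloor> \<le> real (isqrt N)" by (simp add: isqrt_def)
  then show ?thesis by linarith
qed

lemma isqrt_le_self: "isqrt N \<le> N"
proof -
  have "sqrt (real N) \<le> real N" if "N \<ge> 1"
  proof -
    have "sqrt (real N) * 1 \<le> sqrt (real N) * sqrt (real N)" using that by (intro mult_left_mono) auto
    then show ?thesis by simp
  qed
  then have "real (isqrt N) \<le> real N" using isqrt_le[of N] by (cases "N = 0") auto
  then show ?thesis by simp
qed

lemma eventually_isqrt_le: "\<eta> > 0 \<Longrightarrow> \<forall>\<^sub>F N in sequentially. real (isqrt N) \<le> \<eta> * real N"
proof -
  assume \<eta>: "\<eta> > 0"
  have "\<forall>\<^sub>F N in sequentially. sqrt (real N) \<le> \<eta> * real N" using \<eta> by real_asymp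
  then show ?thesis by eventually_elim (use isqrt_le in \<open>auto intro: order_trans\<close>)
qed

text \<open>Bounds the squared norm lost outside the interval of control: a power of \<open>N\<close> from the
  Nikolskii-type inequality \<open>poly_sup_le_L2\<close> and the interpolation, times the decay of \<open>(1 - t / S) ^ (2 d)\<close>.\<close>

definition err :: "real \<Rightarrow> nat \<Rightarrow> nat \<Rightarrow> real" where
  "err \<nu> A N = nik_const \<nu> (A * N) * (16 * (real A)\<^sup>2) powr (\<nu> + 1) * exp (- (real (isqrt N) / (8 * (real A)\<^sup>2)))"

lemma err_tendsto_0:
  assumes "\<nu> > -1" "A \<ge> 1"
  shows "err \<nu> A \<longlonglongrightarrow> 0"
proof -
  define b where "b = 1 / (8 * (real A)\<^sup>2)"
  define a where "a = 2 + 3 * (1 + \<bar>\<nu>\<bar>)"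
  define C where "C = 16 * (real A)\<^sup>2 * (16 * (real A) ^ 3) powr (1 + \<bar>\<nu>\<bar>) / (\<nu> + 1) * (16 * (real A)\<^sup>2) powr (\<nu> + 1) * exp b"
  have b: "b > 0" using assms by (simp add: b_def)
  have C: "C \<ge> 0" using assms by (simp add: C_def)
  have "(\<lambda>N. real N powr a * exp (- (b * sqrt (real N)))) \<longlonglongrightarrow> 0"
    using b by real_asymp
  then have lim: "(\<lambda>N. C * (real N powr a * exp (- (b * sqrt (real N))))) \<longlonglongrightarrow> 0"
    by (rule tendsto_mult_right_zero)
  have up: "\<forall>\<^sub>F N in sequentially. err \<nu> A N \<le> C * (real N powr a * exp (- (b * sqrt (real N))))"
    using eventually_ge_at_top[of 1]
  proof eventually_elim
    case (elim N)
    have N: "real N > 0" using elim by simp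
    have 1: "(16 * real (A * N) ^ 3) powr (1 + \<bar>\<nu>\<bar>) = (16 * (real A) ^ 3) powr (1 + \<bar>\<nu>\<bar>) * real N powr (3 * (1 + \<bar>\<nu>\<bar>))"
    proof -
      have "16 * real (A * N) ^ 3 = (16 * (real A) ^ 3) * real N powr 3"
        using N by (simp add: power_mult_distrib powr_numeral)
      then show ?thesis by (simp only: powr_mult powr_powr)
    qed
    have 2: "real N powr a = (real N)\<^sup>2 * real N powr (3 * (1 + \<bar>\<nu>\<bar>))"
      using N by (simp add: a_def powr_add powr_numeral)
    have nik: "nik_const \<nu> (A * N) = 16 * (real A)\<^sup>2 * (16 * (real A) ^ 3) powr (1 + \<bar>\<nu>\<bar>) / (\<nu> + 1) * real N powr a"
      unfolding nik_const_def 1 2 by (simp add: power_mult_distrib)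
    have "exp (- (real (isqrt N) / (8 * (real A)\<^sup>2))) = exp (- (b * real (isqrt N)))" by (simp add: b_def)
    also have "\<dots> \<le> exp (b - b * sqrt (real N))"
    proof -
      have "b * (sqrt (real N) - 1) \<le> b * real (isqrt N)" using b by (intro mult_left_mono isqrt_ge) auto
      then show ?thesis by (simp add: right_diff_distrib)
    qed
    also have "\<dots> = exp b * exp (- (b * sqrt (real N)))" by (simp add: exp_diff exp_minus field_simps)
    finally have "err \<nu> A N \<le> nik_const \<nu> (A * N) * (16 * (real A)\<^sup>2) powr (\<nu> + 1) * (exp b * exp (- (b * sqrt (real N))))"
      unfolding err_def using assms by (intro mult_left_mono) (auto simp: nik_const_def)
    also have "\<dots> = C * (real N powr a * exp (- (b * sqrt (real N))))" unfolding nik C_def by simp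
    finally show ?case .
  qed
  have "\<forall>\<^sub>F N in sequentially. 0 \<le> err \<nu> A N"
    using assms by (intro always_eventually) (auto simp: err_def nik_const_def)
  from tendsto_sandwich[OF this up tendsto_const lim] show ?thesis .
qed

lemma err_pos: "\<nu> > -1 \<Longrightarrow> A \<ge> 1 \<Longrightarrow> N \<ge> 1 \<Longrightarrow> err \<nu> A N > 0"
  by (auto simp: err_def nik_const_def intro!: mult_pos_pos divide_pos_pos)

lemma power_le_exp:
  fixes y :: real
  assumes "y0 \<le> y" "y \<le> 1" shows "(1 - y) ^ n \<le> exp (- (real n * y0))"
proof -
  have "(1 - y) ^ n \<le> exp (- y) ^ n"
    using assms exp_ge_add_one_self[of "- y"] by (intro power_mono) auto
  also have "\<dots> = exp (- (real n * y))" by (simp add: exp_of_nat_mult[symmetric])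
  also have "\<dots> \<le> exp (- (real n * y0))" using assms by (simp add: mult_left_mono)
  finally show ?thesis .
qed

text \<open>The nodes from \<open>N\<close> on are at least c^2 N^2 / 4, and S = 4 A^2 N^2 c^2, so
  the ratio is bounded by 16 A^2 independently of \<open>N\<close> and \<open>c\<close>.\<close>

lemma node_ratio:
  assumes "c > 0" "N \<ge> 1" "A \<ge> 1" "N \<le> k" "k \<le> A * N"
    and S: "S = 4 * (real (A * N))\<^sup>2 * c\<^sup>2"
  shows "1 / (16 * (real A)\<^sup>2) \<le> cheb_node (A * N) S k / S" "cheb_node (A * N) S k / S \<le> 1" "S > 0"
    "S / cheb_node (A * N) S k \<le> 16 * (real A)\<^sup>2"
proof -
  show S0: "S > 0" using assms by (simp add: S)
  have k: "k \<in> {1..A * N}" using assms by auto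
  have "c\<^sup>2 * (real N)\<^sup>2 / 4 \<le> c\<^sup>2 * (real k)\<^sup>2 / 4"
    using assms by (intro divide_right_mono mult_left_mono power_mono) auto
  then have ge: "c\<^sup>2 * (real N)\<^sup>2 / 4 \<le> cheb_node (A * N) S k" using cheb_node_ge[OF k, of c] unfolding S by linarith
  have "1 / (16 * (real A)\<^sup>2) = (c\<^sup>2 * (real N)\<^sup>2 / 4) / S"
    using assms by (simp add: S power_mult_distrib)
  also have "\<dots> \<le> cheb_node (A * N) S k / S" using ge S0 by (intro divide_right_mono) auto
  finally show 1: "1 / (16 * (real A)\<^sup>2) \<le> cheb_node (A * N) S k / S" .
  show "cheb_node (A * N) S k / S \<le> 1" using cheb_node_range[OF S0, of "A * N" k] S0 by simp
  have A0: "1 / (16 * (real A)\<^sup>2) > 0" using assms by simp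
  have z0: "cheb_node (A * N) S k > 0" by (rule cheb_node_pos[OF S0 k])
  have "inverse (cheb_node (A * N) S k / S) \<le> inverse (1 / (16 * (real A)\<^sup>2))"
    by (rule le_imp_inverse_le[OF 1 A0])
  then show "S / cheb_node (A * N) S k \<le> 16 * (real A)\<^sup>2" by (simp add: inverse_eq_divide)
qed

text \<open>The first form carries the power of S / node that arises in \<open>upper_finite\<close>,
  where the Nikolskii inequality lives on a shorter interval than the final integral; the second is
  the form of \<open>lower_finite\<close>.\<close>

lemma err_bound:
  assumes "\<nu> > -1" "c > 0" "N \<ge> 1" "A \<ge> 1" "N \<le> k" "k \<le> A * N"
    and S: "S = 4 * (real (A * N))\<^sup>2 * c\<^sup>2"
  shows "nik_const \<nu> (A * N) * (S / cheb_node (A * N) S k) powr (\<nu> + 1) *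
     (1 - cheb_node (A * N) S k / S) ^ (2 * isqrt N) \<le> err \<nu> A N"
    and "nik_const \<nu> (A * N) * (1 - cheb_node (A * N) S k / S) ^ (2 * isqrt N) \<le> err \<nu> A N"
proof -
  note nr = node_ratio[OF assms(2-7)]
  have z0: "cheb_node (A * N) S k > 0" using assms by (intro cheb_node_pos nr(3)) auto
  have nik: "0 \<le> nik_const \<nu> (A * N)" using assms by (simp add: nik_const_def)
  have e: "(1 - cheb_node (A * N) S k / S) ^ (2 * isqrt N) \<le> exp (- (real (isqrt N) / (8 * (real A)\<^sup>2)))"
    using power_le_exp[OF nr(1,2), of "2 * isqrt N"] by simp
  have e0: "0 \<le> (1 - cheb_node (A * N) S k / S) ^ (2 * isqrt N)" using nr(2) by (intro zero_le_power) auto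
  have "(S / cheb_node (A * N) S k) powr (\<nu> + 1) \<le> (16 * (real A)\<^sup>2) powr (\<nu> + 1)"
    using assms nr(3,4) z0 by (intro powr_mono2) auto
  then show "nik_const \<nu> (A * N) * (S / cheb_node (A * N) S k) powr (\<nu> + 1) *
     (1 - cheb_node (A * N) S k / S) ^ (2 * isqrt N) \<le> err \<nu> A N"
    unfolding err_def using nik e e0 by (intro mult_mono) auto
  have "1 \<le> (real A)\<^sup>2" using assms by (simp add: one_le_power)
  then have "1 \<le> 16 * (real A)\<^sup>2" by linarith
  then have "1 \<le> (16 * (real A)\<^sup>2) powr (\<nu> + 1)" using assms(1) by (intro ge_one_powr_ge_zero) linarith+
  then have "nik_const \<nu> (A * N) * 1 * (1 - cheb_node (A * N) S k / S) ^ (2 * isqrt N) \<le> err \<nu> A N"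
    unfolding err_def using nik e e0 by (intro mult_mono) auto
  then show "nik_const \<nu> (A * N) * (1 - cheb_node (A * N) S k / S) ^ (2 * isqrt N) \<le> err \<nu> A N" by simp
qed

lemma node_poly_near_1:
  assumes c: "c > 0" and N: "1 \<le> N" and t: "0 \<le> t" and S: "S = 4 * (real M)\<^sup>2 * c\<^sup>2"
    and le: "\<And>k. k \<in> {N<..M} \<Longrightarrow> t \<le> cheb_node M S k"
  shows "1 - 4 * t / c\<^sup>2 / real N \<le> poly (node_poly (cheb_node M S) {N<..M}) t"
    and "poly (node_poly (cheb_node M S) {N<..M}) t \<le> 1"
proof -
  let ?z = "cheb_node M S"
  have z: "c\<^sup>2 * (real k)\<^sup>2 / 4 \<le> ?z k" "?z k > 0" if "k \<in> {N<..M}" for k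
  proof -
    show "c\<^sup>2 * (real k)\<^sup>2 / 4 \<le> ?z k" unfolding S using that N by (intro cheb_node_ge) auto
    moreover have "0 < c\<^sup>2 * (real k)\<^sup>2 / 4" using that c by auto
    ultimately show "?z k > 0" by linarith
  qed
  have f: "0 \<le> t / ?z k \<and> t / ?z k \<le> 1" if "k \<in> {N<..M}" for k using z[OF that] le[OF that] t by auto
  have "(\<Sum>k\<in>{N<..M}. t / ?z k) \<le> (\<Sum>k\<in>{N<..M}. 4 * t / c\<^sup>2 * (1 / (real k)\<^sup>2))"
  proof (rule sum_mono)
    fix k assume k: "k \<in> {N<..M}"
    have "t / ?z k \<le> t / (c\<^sup>2 * (real k)\<^sup>2 / 4)"
      using z[OF k] t c k by (intro divide_left_mono mult_pos_pos) auto
    then show "t / ?z k \<le> 4 * t / c\<^sup>2 * (1 / (real k)\<^sup>2)" by (simp add: mult.commute[of 4 t])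
  qed
  also have "\<dots> \<le> 4 * t / c\<^sup>2 * (1 / real N)" unfolding sum_distrib_left[symmetric]
    using t N by (intro mult_left_mono sum_inverse_squares_le) auto
  finally have s: "(\<Sum>k\<in>{N<..M}. t / ?z k) \<le> 4 * t / c\<^sup>2 / real N" by simp
  show "1 - 4 * t / c\<^sup>2 / real N \<le> poly (node_poly ?z {N<..M}) t"
    using prod_one_minus_ge[of "{N<..M}" "\<lambda>k. t / ?z k"] f s by (simp add: poly_node_poly)
  show "poly (node_poly ?z {N<..M}) t \<le> 1"
    using prod_one_minus_ge[of "{N<..M}" "\<lambda>k. t / ?z k"] f by (simp add: poly_node_poly)
qed

context bessel_like begin

text \<open>Node \<open>k\<close> is matched with \<open>p (k - d)\<close>,
  \<open>d = isqrt N\<close>, which frees \<open>d\<close> degrees; the indices of \<open>p\<close>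
  beyond \<open>M - d\<close> stay unmatched and are paid for by the margin. Of the factor
  \<open>\<theta> ^ 6\<close> in the upper bound for the nodes, \<theta>^2 absorbs the shift,
  \<theta>^2 the asymptotics of \<open>p\<close>, and \<theta>^2 is left as the margin
  \<open>z k \<le> \<theta>^2 p (k - d)\<close>. The bound of node \<open>N + d\<close> by
  \<open>p N\<close> places the interval of control inside [0, R].\<close>

lemma upper_domination:
  assumes \<theta>: "0 < \<theta>" "\<theta> < 1" and A: "real A \<ge> 6 + 12 / (\<theta>\<^sup>2 * (1 - \<theta>\<^sup>2))"
  shows "\<forall>\<^sub>F N in sequentially. N + isqrt N < A * N \<and>
     cheb_node (A * N) (4 * (real (A * N))\<^sup>2 * (\<theta> ^ 3)\<^sup>2) (N + isqrt N) \<le> p N \<and>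
     (\<forall>t\<in>{0..cheb_node (A * N) (4 * (real (A * N))\<^sup>2 * (\<theta> ^ 3)\<^sup>2) (N + isqrt N)}. \<forall>n\<ge>A * N.
       poly (node_poly (cheb_node (A * N) (4 * (real (A * N))\<^sup>2 * (\<theta> ^ 3)\<^sup>2)) {N + isqrt N<..A * N}) t
         \<le> (\<Prod>k\<in>{N<..n}. 1 - t / p k))"
proof -
  have \<theta>2: "\<theta>\<^sup>2 < 1" using \<theta> by (simp add: power_less_one_iff)
  have A6: "real A \<ge> 6" using A \<theta> \<theta>2 by (smt (verit) divide_nonneg_pos mult_pos_pos zero_less_power)
  obtain n0 where n0: "\<And>n. n \<ge> n0 \<Longrightarrow> \<theta>\<^sup>2 * pi\<^sup>2 * (real n)\<^sup>2 \<le> p n"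
    using eventually_p_ge[OF \<theta>2] by (auto simp: eventually_sequentially)
  \<comment> \<open>Hence \<open>\<theta> * (N + d) \<le> N\<close>: the shift costs at most a
    factor \<open>\<theta>\<close> in the index.\<close>
  have "\<forall>\<^sub>F N in sequentially. real (isqrt N) \<le> (1 - \<theta>) / \<theta> * real N"
    using \<theta> by (intro eventually_isqrt_le) auto
  then show ?thesis using eventually_ge_at_top[of "max 1 n0"]
  proof eventually_elim
    case (elim N)
    define d M S where "d = isqrt N" and "M = A * N" and "S = 4 * (real M)\<^sup>2 * (\<theta> ^ 3)\<^sup>2"
    let ?z = "cheb_node M S" and ?N2 = "N + d"
    have N: "N \<ge> 1" "N \<ge> n0" and d: "d \<le> N" "real d \<le> (1 - \<theta>) / \<theta> * real N"
      using elim isqrt_le_self[of N] by (auto simp: d_def)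
    have Nr: "real N \<ge> 1" using N by simp
    have M6: "real M \<ge> 6 * real N" unfolding M_def using A6 by (simp add: mult_right_mono)
    have N2M: "?N2 < M" using M6 d N by linarith
    have S0: "S > 0" using N2M \<theta> by (simp add: S_def)
    have \<theta>d: "\<theta> * real d \<le> (1 - \<theta>) * real N"
      using mult_left_mono[OF d(2), of \<theta>] \<theta> by simp
    have zle: "?z k \<le> \<theta> ^ 6 * pi\<^sup>2 * (real k)\<^sup>2" if "k \<in> {1..M}" for k
      using cheb_node_le[OF that, of "\<theta> ^ 3"] by (simp add: S_def flip: power_mult)
    have N2N: "\<theta> * real ?N2 \<le> real N" using \<theta>d by (simp add: algebra_simps)
    have "(\<theta> * real ?N2)\<^sup>2 \<le> (real N)\<^sup>2" using N2N \<theta> by (intro power_mono) auto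
    then have "\<theta> ^ 4 * pi\<^sup>2 * (\<theta> * real ?N2)\<^sup>2 \<le> \<theta> ^ 4 * pi\<^sup>2 * (real N)\<^sup>2" by (intro mult_left_mono) auto
    moreover have "\<theta> ^ 4 * pi\<^sup>2 * (\<theta> * real ?N2)\<^sup>2 = \<theta> ^ 6 * pi\<^sup>2 * (real ?N2)\<^sup>2"
      by (simp add: power_mult_distrib)
    moreover have "?z ?N2 \<le> \<theta> ^ 6 * pi\<^sup>2 * (real ?N2)\<^sup>2" using N N2M by (intro zle) auto
    ultimately have zN2: "?z ?N2 \<le> \<theta> ^ 4 * pi\<^sup>2 * (real N)\<^sup>2" by linarith
    have "\<theta> ^ 4 \<le> \<theta>\<^sup>2" using \<theta> by (intro power_decreasing) auto
    then have "\<theta> ^ 4 * (pi\<^sup>2 * (real N)\<^sup>2) \<le> \<theta>\<^sup>2 * (pi\<^sup>2 * (real N)\<^sup>2)" by (intro mult_right_mono) auto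
    then have R'p: "?z ?N2 \<le> p N" using zN2 n0[OF N(2)] by linarith
    have dom: "poly (node_poly ?z {?N2<..M}) t \<le> (\<Prod>k\<in>{N<..n}. 1 - t / p k)"
      if t: "t \<in> {0..?z ?N2}" and n: "n \<ge> M" for t n
    proof -
      have t0: "0 \<le> t" using t by simp
      have zpos: "?z k > 0" if "k \<in> {?N2<..M}" for k using that by (intro cheb_node_pos S0) auto
      have tz: "t \<le> ?z k" if "k \<in> {?N2<..M}" for k
        using t cheb_node_mono[OF S0, of ?N2 k M] that N by auto
      have zp: "?z k \<le> \<theta>\<^sup>2 * p (k - d)" if k: "k \<in> {?N2<..M}" for k
      proof -
        have "\<theta> * real d + (1 - \<theta>) * real d \<le> (1 - \<theta>) * real N + (1 - \<theta>) * real d" using \<theta>d by simp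
        also have "\<dots> = (1 - \<theta>) * real ?N2" by (simp add: distrib_left)
        also have "\<dots> \<le> (1 - \<theta>) * real k" using k \<theta> by (intro mult_left_mono) auto
        finally have "\<theta> * real k \<le> real (k - d)" using k by (simp add: algebra_simps of_nat_diff)
        then have "(\<theta> * real k)\<^sup>2 \<le> (real (k - d))\<^sup>2" using \<theta> by (intro power_mono) auto
        then have "\<theta> ^ 4 * pi\<^sup>2 * (\<theta> * real k)\<^sup>2 \<le> \<theta> ^ 4 * pi\<^sup>2 * (real (k - d))\<^sup>2" by (intro mult_left_mono) auto
        moreover have "\<theta> ^ 4 * pi\<^sup>2 * (\<theta> * real k)\<^sup>2 = \<theta> ^ 6 * pi\<^sup>2 * (real k)\<^sup>2"
          by (simp add: power_mult_distrib)
        moreover have "\<theta>\<^sup>2 * (\<theta>\<^sup>2 * pi\<^sup>2 * (real (k - d))\<^sup>2) \<le> \<theta>\<^sup>2 * p (k - d)"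
          using k N by (intro mult_left_mono n0) auto
        moreover have "\<theta>\<^sup>2 * (\<theta>\<^sup>2 * pi\<^sup>2 * (real (k - d))\<^sup>2) = \<theta> ^ 4 * pi\<^sup>2 * (real (k - d))\<^sup>2"
          by (simp add: power2_eq_square power_numeral_reduce)
        moreover have "?z k \<le> \<theta> ^ 6 * pi\<^sup>2 * (real k)\<^sup>2" using k N by (intro zle) auto
        ultimately show ?thesis by linarith
      qed
      have ppos: "p (k - d) > 0" if "k \<in> {?N2<..M}" for k using that N by (intro p_pos) auto
      have vu: "t / p (k - d) \<le> \<theta>\<^sup>2 * (t / ?z k)" if k: "k \<in> {?N2<..M}" for k
      proof -
        have "?z k * t \<le> \<theta>\<^sup>2 * p (k - d) * t" by (intro mult_right_mono zp[OF k] t0)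
        then show ?thesis using zpos[OF k] ppos[OF k] by (simp add: field_simps)
      qed
      have Md: "real (M - d) \<ge> (real A - 1) * real N"
        using d N2M by (simp add: of_nat_diff M_def algebra_simps)
      have Md2: "real (M - d) \<ge> 2 * real N" using M6 d N2M by (simp add: of_nat_diff)
      have wle: "t / p k \<le> t / (\<theta>\<^sup>2 * pi\<^sup>2) * (1 / (real k)\<^sup>2)" "t / p k \<le> 1 / 2" "p k > 0"
        if k: "k \<in> {M - d<..n}" for k
      proof -
        have kr: "real k \<ge> 2 * real N" and k1: "k \<ge> 1" "k \<ge> n0" "real k > 0" using k Md2 N by auto
        show pk: "p k > 0" using k1 by (intro p_pos)
        have pos: "\<theta>\<^sup>2 * pi\<^sup>2 * (real k)\<^sup>2 > 0" using \<theta> k1 by simp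
        have "t / p k \<le> t / (\<theta>\<^sup>2 * pi\<^sup>2 * (real k)\<^sup>2)"
          using n0[OF k1(2)] t0 pos pk k1 by (intro divide_left_mono mult_pos_pos) auto
        then show "t / p k \<le> t / (\<theta>\<^sup>2 * pi\<^sup>2) * (1 / (real k)\<^sup>2)" by simp
        have "(2 * real N)\<^sup>2 \<le> (real k)\<^sup>2" using kr by (intro power_mono) auto
        then have "4 * (\<theta>\<^sup>2 * pi\<^sup>2 * (real N)\<^sup>2) \<le> \<theta>\<^sup>2 * pi\<^sup>2 * (real k)\<^sup>2"
          using mult_left_mono[of "(2 * real N)\<^sup>2" "(real k)\<^sup>2" "\<theta>\<^sup>2 * pi\<^sup>2"] by (simp add: power_mult_distrib mult_ac)
        moreover have "t \<le> \<theta>\<^sup>2 * pi\<^sup>2 * (real N)\<^sup>2"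
          using t zN2 \<open>\<theta> ^ 4 * (pi\<^sup>2 * (real N)\<^sup>2) \<le> \<theta>\<^sup>2 * (pi\<^sup>2 * (real N)\<^sup>2)\<close>
          unfolding atLeastAtMost_iff by linarith
        ultimately have "2 * t \<le> p k" using n0[OF k1(2)] t0 by linarith
        then show "t / p k \<le> 1 / 2" using pk by simp
      qed
      have "(\<Prod>k\<in>{?N2<..M}. 1 - t / ?z k) \<le> (\<Prod>k\<in>{?N2<..M}. 1 - t / p (k - d)) * (\<Prod>k\<in>{M - d<..n}. 1 - t / p k)"
      proof (rule prod_compare)
        fix k assume k: "k \<in> {?N2<..M}"
        have u: "0 \<le> t / ?z k" "t / ?z k \<le> 1" using zpos[OF k] tz[OF k] t0 by auto
        have "\<theta>\<^sup>2 * (t / ?z k) \<le> 1 * (t / ?z k)" using u \<theta>2 by (intro mult_right_mono) auto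
        then show "0 \<le> t / p (k - d) \<and> t / p (k - d) \<le> t / ?z k \<and> t / ?z k \<le> 1"
          using vu[OF k] u ppos[OF k] t0 by auto
      next
        fix k assume k: "k \<in> {M - d<..n}"
        then show "0 \<le> t / p k \<and> t / p k \<le> 1 / 2" using wle[OF k] t0 by auto
      next
        have "(\<Sum>k\<in>{M - d<..n}. t / p k) \<le> (\<Sum>k\<in>{M - d<..n}. t / (\<theta>\<^sup>2 * pi\<^sup>2) * (1 / (real k)\<^sup>2))"
          by (intro sum_mono wle)
        also have "\<dots> \<le> t / (\<theta>\<^sup>2 * pi\<^sup>2) * (1 / real (M - d))" unfolding sum_distrib_left[symmetric]
          using t0 Md2 N by (intro mult_left_mono sum_inverse_squares_le) auto
        also have "\<dots> = t / pi\<^sup>2 * (1 / (\<theta>\<^sup>2 * real (M - d)))" by simp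
        finally have "2 * (\<Sum>k\<in>{M - d<..n}. t / p k) \<le> 2 * (t / pi\<^sup>2 * (1 / (\<theta>\<^sup>2 * real (M - d))))"
          by (rule mult_left_mono) simp
        also have "2 * (t / pi\<^sup>2 * (1 / (\<theta>\<^sup>2 * real (M - d)))) = t / pi\<^sup>2 * (2 / (\<theta>\<^sup>2 * real (M - d)))" by simp
        finally have J: "2 * (\<Sum>k\<in>{M - d<..n}. t / p k) \<le> t / pi\<^sup>2 * (2 / (\<theta>\<^sup>2 * real (M - d)))" .
        have "(1 - \<theta>\<^sup>2) * (t / pi\<^sup>2) * (1 / real (Suc ?N2) - 1 / real (Suc M)) \<le>
          (1 - \<theta>\<^sup>2) * (t / pi\<^sup>2) * (\<Sum>k\<in>{?N2<..M}. 1 / (real k)\<^sup>2)"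
          using N2M t0 \<theta>2 by (intro mult_left_mono sum_inverse_squares_ge) auto
        also have "\<dots> = (\<Sum>k\<in>{?N2<..M}. (1 - \<theta>\<^sup>2) * (t / (pi\<^sup>2 * (real k)\<^sup>2)))"
          by (simp add: sum_distrib_left)
        also have "\<dots> \<le> (\<Sum>k\<in>{?N2<..M}. t / ?z k - t / p (k - d))"
        proof (rule sum_mono)
          fix k assume k: "k \<in> {?N2<..M}"
          have "\<theta> ^ 6 \<le> 1" using \<theta> by (intro power_le_one) auto
          then have "\<theta> ^ 6 * (pi\<^sup>2 * (real k)\<^sup>2) \<le> 1 * (pi\<^sup>2 * (real k)\<^sup>2)" by (intro mult_right_mono) auto
          moreover have "?z k \<le> \<theta> ^ 6 * pi\<^sup>2 * (real k)\<^sup>2" using k N by (intro zle) auto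
          ultimately have "?z k \<le> pi\<^sup>2 * (real k)\<^sup>2" by linarith
          then have "t / (pi\<^sup>2 * (real k)\<^sup>2) \<le> t / ?z k"
            using t0 zpos[OF k] k by (intro divide_left_mono mult_pos_pos) auto
          then have "(1 - \<theta>\<^sup>2) * (t / (pi\<^sup>2 * (real k)\<^sup>2)) \<le> (1 - \<theta>\<^sup>2) * (t / ?z k)"
            using \<theta>2 by (intro mult_left_mono) auto
          also have "\<dots> \<le> t / ?z k - t / p (k - d)"
            using vu[OF k] unfolding left_diff_distrib mult_1_left by linarith
          finally show "(1 - \<theta>\<^sup>2) * (t / (pi\<^sup>2 * (real k)\<^sup>2)) \<le> t / ?z k - t / p (k - d)" .
        qed
        finally have I: "t / pi\<^sup>2 * ((1 - \<theta>\<^sup>2) * (1 / real (Suc ?N2) - 1 / real (Suc M))) \<le>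
          (\<Sum>k\<in>{?N2<..M}. t / ?z k - t / p (k - d))" by (simp only: mult_ac)
        \<comment> \<open>Cost against gain, both divided by t / \<pi>^2. As N + d + 1 \<le> 3 N and
          M \<ge> 6 N, the bracket is at least 1 / (6 N); twice 6 is the 12 in the hypothesis on
          \<open>A\<close>.\<close>
        have key: "2 / (\<theta>\<^sup>2 * real (M - d)) \<le> (1 - \<theta>\<^sup>2) * (1 / real (Suc ?N2) - 1 / real (Suc M))"
        proof -
          define e where "e = \<theta>\<^sup>2 * (1 - \<theta>\<^sup>2)"
          have e: "e > 0" using \<theta> \<theta>2 by (simp add: e_def)
          have "12 / e \<le> real A - 1" using A by (simp add: e_def)
          then have Ae: "12 \<le> (real A - 1) * e" using e by (simp add: pos_divide_le_eq)
          have "2 / (\<theta>\<^sup>2 * real (M - d)) \<le> 2 / (\<theta>\<^sup>2 * ((real A - 1) * real N))"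
            using \<theta> Md A6 Nr Md2 by (intro divide_left_mono mult_left_mono mult_pos_pos) auto
          also have "\<dots> \<le> (1 - \<theta>\<^sup>2) * (1 / (6 * real N))"
          proof -
            have "12 * real N \<le> (real A - 1) * e * real N" using Ae Nr by (intro mult_right_mono) auto
            then show ?thesis using \<theta> A6 Nr by (simp add: divide_simps e_def) (simp add: algebra_simps)
          qed
          also have "\<dots> \<le> (1 - \<theta>\<^sup>2) * (1 / real (Suc ?N2) - 1 / real (Suc M))"
          proof (intro mult_left_mono)
            have "1 / (3 * real N) \<le> 1 / real (Suc ?N2)" using d Nr by (intro divide_left_mono) auto
            moreover have "1 / real (Suc M) \<le> 1 / (6 * real N)" using M6 Nr by (intro divide_left_mono) auto
            moreover have "1 / (3 * real N) - 1 / (6 * real N) = 1 / (6 * real N)" using Nr by (simp add: field_simps)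
            ultimately show "1 / (6 * real N) \<le> 1 / real (Suc ?N2) - 1 / real (Suc M)" by linarith
          qed (use \<theta>2 in auto)
          finally show ?thesis .
        qed
        have "t / pi\<^sup>2 * (2 / (\<theta>\<^sup>2 * real (M - d))) \<le> t / pi\<^sup>2 * ((1 - \<theta>\<^sup>2) * (1 / real (Suc ?N2) - 1 / real (Suc M)))"
          using t0 by (intro mult_left_mono key) auto
        then show "2 * (\<Sum>k\<in>{M - d<..n}. t / p k) \<le> (\<Sum>k\<in>{?N2<..M}. t / ?z k - t / p (k - d))"
          by (rule order_trans[OF J order_trans[OF _ I]])
      qed auto
      also have "(\<Prod>k\<in>{?N2<..M}. 1 - t / p (k - d)) = (\<Prod>k\<in>{N<..M - d}. 1 - t / p k)"
        using N2M by (intro prod.reindex_bij_witness[of _ "\<lambda>k. k + d" "\<lambda>k. k - d"]) auto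
      also have "(\<Prod>k\<in>{N<..M - d}. 1 - t / p k) * (\<Prod>k\<in>{M - d<..n}. 1 - t / p k) = (\<Prod>k\<in>{N<..n}. 1 - t / p k)"
      proof -
        have "{N<..n} = {N<..M - d} \<union> {M - d<..n}" using N2M n by auto
        then show ?thesis by (simp add: prod.union_disjoint)
      qed
      finally show ?thesis by (simp only: poly_node_poly)
    qed
    show ?case using N2M R'p dom unfolding d_def M_def S_def by blast
  qed
qed

end

context bessel_like begin

text \<open>Nodes now need lower bounds, and the sine is close to its argument only for
  \<open>k\<close> small against \<open>M\<close>; hence two scales, K = B N and M = m K. Node
  \<open>k\<close> is matched with \<open>p k\<close> for N < k \<le> K. The nodes beyond
  \<open>K\<close> are paid for by the margin, and the factors of the tail product beyond
  \<open>K\<close> are at most 1. Of the six powers of 1 / \<theta>, two are lost to the sine, one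
  to replacing k - 1/2 by k, two to the asymptotics of \<open>p\<close>; the last is the margin
  \<open>p k \<le> \<theta> * z k\<close>.\<close>

lemma lower_domination:
  assumes \<theta>: "0 < \<theta>" "\<theta> < 1" and B: "real B \<ge> 4 + 512 / (\<theta>\<^sup>2 * (1 - \<theta>))" and m: "real m \<ge> 1 + 1 / (1 - \<theta>)"
    and A: "A = B * m"
  shows "\<forall>\<^sub>F N in sequentially. 2 * N < A * N \<and>
     p (N + 1) \<le> cheb_node (A * N) (4 * (real (A * N))\<^sup>2 * ((1 / \<theta>) ^ 3)\<^sup>2) (N + 1) \<and>
     (\<forall>t\<in>{0..p (N + 1)}. \<forall>n\<ge>A * N. (\<Prod>k\<in>{N<..n}. 1 - t / p k) \<le>
       poly (node_poly (cheb_node (A * N) (4 * (real (A * N))\<^sup>2 * ((1 / \<theta>) ^ 3)\<^sup>2)) {N<..A * N}) t)"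
proof -
  define e where "e = \<theta>\<^sup>2 * (1 - \<theta>)"
  have e: "e > 0" using \<theta> by (simp add: e_def)
  have \<theta>2: "\<theta>\<^sup>2 \<le> 1" using \<theta> by (simp add: power_le_one)
  have e2: "e \<le> \<theta>\<^sup>2" unfolding e_def using \<theta> by (simp add: mult_left_le)
  have "512 / e > 0" using e by simp
  then have B4: "real B \<ge> 4" and Be: "512 / e \<le> real B" using B e unfolding e_def[symmetric] by linarith+
  have Be': "512 \<le> real B * e" using Be e by (simp add: pos_divide_le_eq)
  have "1 / (1 - \<theta>) > 0" using \<theta> by simp
  then have m1: "real m \<ge> 1" and m\<theta>: "1 / (1 - \<theta>) \<le> real m" using m by linarith+
  have m\<theta>': "1 \<le> real m * (1 - \<theta>)" using m\<theta> \<theta> by (simp add: pos_divide_le_eq)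
  have "1 < 1 / \<theta>\<^sup>2" using \<theta> by (simp add: power_less_one_iff)
  from eventually_p_le[OF this] obtain n0 where n0: "\<And>n. n \<ge> n0 \<Longrightarrow> p n \<le> 1 / \<theta>\<^sup>2 * pi\<^sup>2 * (real n)\<^sup>2"
    by (auto simp: eventually_sequentially)
  \<comment> \<open>The last threshold ensures \<theta> k^2 \<le> (k - 1/2)^2 for all k > N.\<close>
  show ?thesis using eventually_ge_at_top[of "max (max 1 n0) (nat \<lceil>1 / (1 - \<theta>)\<rceil>)"]
  proof eventually_elim
    case (elim N)
    define M S K where "M = A * N" and "S = 4 * (real M)\<^sup>2 * ((1 / \<theta>) ^ 3)\<^sup>2" and "K = B * N"
    let ?z = "cheb_node M S"
    have N: "N \<ge> 1" "N \<ge> n0" and N\<theta>: "1 / (1 - \<theta>) \<le> real N"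
      using elim by (auto simp: nat_le_iff ceiling_le_iff)
    have N\<theta>': "1 \<le> (1 - \<theta>) * real N" using N\<theta> \<theta> by (simp add: pos_divide_le_eq mult.commute)
    have Nr: "real N \<ge> 1" using N by simp
    have K4: "real K \<ge> 4 * real N" unfolding K_def using B4 by (simp add: mult_right_mono)
    have MK: "M = m * K" by (simp add: M_def K_def A)
    have "1 * real K \<le> real m * real K" using m1 by (intro mult_right_mono) auto
    then have KM: "K \<le> M" using MK by (simp flip: of_nat_mult)
    have NM: "2 * N < M" "N < K" using K4 KM Nr by linarith+
    have S0: "S > 0" using NM \<theta> by (simp add: S_def)
    have zpos: "?z k > 0" if "k \<in> {N<..M}" for k using that by (intro cheb_node_pos S0) auto
    have ppos: "p k > 0" if "k \<in> {N<..n}" for k n using that by (intro p_pos) auto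
    have pz: "p k \<le> \<theta> * ?z k" if k: "k \<in> {N<..K}" for k
    proof -
      have kM: "k \<in> {1..M}" and kr: "real k \<ge> real N" and kn: "k \<ge> n0" using k KM N by auto
      let ?a = "cheb_angle M k / 2"
      have a0: "0 \<le> ?a" using cheb_angle_bounds[OF kM] by simp
      \<comment> \<open>With the hypothesis on \<open>m\<close> this gives 1 - a^2 / 6 \<ge>
        \<theta> for the half angle a, so its sine is at least \<theta> a.\<close>
      have "?a \<le> 2 / real m"
      proof -
        have M0: "real M > 0" using kM by simp
        have "?a = (2 * real k - 1) * pi / (4 * real M)" by (simp add: cheb_angle_def)
        also have "\<dots> \<le> (2 * real K) * 4 / (4 * real M)"
          using k pi_less_4 M0 by (intro divide_right_mono mult_mono) auto
        also have "\<dots> = 2 / real m" using NM m1 by (simp add: MK)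
        finally show ?thesis .
      qed
      then have "?a\<^sup>2 \<le> (2 / real m)\<^sup>2" using a0 by (intro power_mono) auto
      also have "(2 / real m)\<^sup>2 = 4 / (real m * real m)" by (simp add: power2_eq_square)
      also have "\<dots> \<le> 4 / (real m * 1)" using m1 by (intro divide_left_mono mult_left_mono) auto
      also have "\<dots> \<le> 4 * (1 - \<theta>)"
      proof -
        have "4 \<le> 4 * (1 - \<theta>) * (real m * 1)" using m\<theta>' by (simp add: algebra_simps)
        then show ?thesis using m1 by (subst pos_divide_le_eq) auto
      qed
      finally have a2: "?a\<^sup>2 \<le> 4 * (1 - \<theta>)" .
      have "\<theta> \<le> 1 - x / 6" if "x \<le> 4 * (1 - \<theta>)" for x :: real
      proof -
        have "x / 6 \<le> 4 * (1 - \<theta>) / 6" using that by (rule divide_right_mono) simp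
        also have "\<dots> \<le> 1 - \<theta>" using \<theta> by simp
        finally show ?thesis by simp
      qed
      from this[OF a2] have "\<theta> \<le> 1 - ?a\<^sup>2 / 6" .
      then have "\<theta> * ?a \<le> (1 - ?a\<^sup>2 / 6) * ?a" using a0 by (intro mult_right_mono) auto
      also have "\<dots> \<le> sin ?a" using sin_ge_cubic[OF a0] by (simp only: mult.commute)
      finally have "\<theta>\<^sup>2 * ((1 / \<theta>) ^ 3)\<^sup>2 * pi\<^sup>2 * (real k - 1 / 2)\<^sup>2 \<le> ?z k"
        unfolding S_def using \<theta> by (intro cheb_node_ge_aux kM) auto
      moreover have "\<theta>\<^sup>2 * ((1 / \<theta>) ^ 3)\<^sup>2 = 1 / \<theta> ^ 4"
        using \<theta> by (simp add: field_simps flip: power_mult power_add)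
      ultimately have z: "1 / \<theta> ^ 4 * pi\<^sup>2 * (real k - 1 / 2)\<^sup>2 \<le> ?z k" by simp
      have "(1 - \<theta>) * real N \<le> (1 - \<theta>) * real k" using kr \<theta> by (intro mult_left_mono) auto
      then have "real k * 1 \<le> real k * ((1 - \<theta>) * real k)" using N\<theta>' by (intro mult_left_mono) auto
      then have "\<theta> * (real k)\<^sup>2 \<le> (real k - 1 / 2)\<^sup>2" by (simp add: power2_eq_square algebra_simps)
      then have "1 / \<theta> ^ 3 * pi\<^sup>2 * (\<theta> * (real k)\<^sup>2) \<le> 1 / \<theta> ^ 3 * pi\<^sup>2 * (real k - 1 / 2)\<^sup>2"
        using \<theta> by (intro mult_left_mono) auto
      moreover have "1 / \<theta> ^ 3 * pi\<^sup>2 * (\<theta> * (real k)\<^sup>2) = 1 / \<theta>\<^sup>2 * pi\<^sup>2 * (real k)\<^sup>2"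
        using \<theta> by (simp add: power2_eq_square power3_eq_cube)
      moreover have "\<theta> * (1 / \<theta> ^ 4 * pi\<^sup>2 * (real k - 1 / 2)\<^sup>2) \<le> \<theta> * ?z k" using z \<theta> by (intro mult_left_mono) auto
      moreover have "\<theta> * (1 / \<theta> ^ 4 * pi\<^sup>2 * (real k - 1 / 2)\<^sup>2) = 1 / \<theta> ^ 3 * pi\<^sup>2 * (real k - 1 / 2)\<^sup>2"
        using \<theta> by (simp add: power_numeral_reduce)
      ultimately show ?thesis using n0[OF kn] by linarith
    qed
    have pzN: "p (N + 1) \<le> ?z (N + 1)"
    proof -
      have "p (N + 1) \<le> \<theta> * ?z (N + 1)" using NM by (intro pz) auto
      also have "\<dots> \<le> 1 * ?z (N + 1)" using \<theta> zpos[of "N + 1"] NM by (intro mult_right_mono) auto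
      finally show ?thesis by simp
    qed
    have dom: "(\<Prod>k\<in>{N<..n}. 1 - t / p k) \<le> poly (node_poly ?z {N<..M}) t"
      if t: "t \<in> {0..p (N + 1)}" and n: "n \<ge> M" for t n
    proof -
      have t0: "0 \<le> t" using t by simp
      have tp: "t \<le> p k" if "k \<in> {N<..n}" for k using t p_le[of "N + 1" k] that by auto
      have f: "0 \<le> 1 - t / p k \<and> 1 - t / p k \<le> 1" if k: "k \<in> {N<..n}" for k
        using tp[OF k] t0 ppos[OF k] by auto
      have tbound: "t \<le> 64 * (real N)\<^sup>2 / \<theta>\<^sup>2"
      proof -
        have "t \<le> 1 / \<theta>\<^sup>2 * pi\<^sup>2 * (real (N + 1))\<^sup>2" using t n0[of "N + 1"] N by auto
        also have "\<dots> \<le> 1 / \<theta>\<^sup>2 * 4\<^sup>2 * (2 * real N)\<^sup>2"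
          using pi_less_4 Nr by (intro mult_mono power_mono) auto
        finally show ?thesis by (simp add: power_mult_distrib)
      qed
      have wle: "t / ?z k \<le> 4 * t * (1 / (real k)\<^sup>2)" "t / ?z k \<le> 1 / 2" "?z k > 0"
        if k: "k \<in> {K<..M}" for k
      proof -
        have kM: "k \<in> {N<..M}" "k \<in> {1..M}" using k NM by auto
        show zk: "?z k > 0" by (rule zpos[OF kM(1)])
        have "1 \<le> (1 / \<theta>) ^ 3" using \<theta> by (intro one_le_power) auto
        then have "1 \<le> ((1 / \<theta>) ^ 3)\<^sup>2" by (rule one_le_power)
        then have "1 * (real k)\<^sup>2 / 4 \<le> ((1 / \<theta>) ^ 3)\<^sup>2 * (real k)\<^sup>2 / 4" by (intro divide_right_mono mult_right_mono) auto
        also have "\<dots> \<le> ?z k" unfolding S_def by (rule cheb_node_ge[OF kM(2)])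
        finally have z4: "(real k)\<^sup>2 / 4 \<le> ?z k" by simp
        have k0: "real k > 0" using kM by simp
        have "t / ?z k \<le> t / ((real k)\<^sup>2 / 4)" using z4 t0 zk k0 by (intro divide_left_mono mult_pos_pos) auto
        then show "t / ?z k \<le> 4 * t * (1 / (real k)\<^sup>2)" by (simp add: mult.commute[of 4 t])
        have "real B * real N \<le> real k" using k by (simp add: K_def less_imp_le flip: of_nat_mult)
        then have "(real B * real N)\<^sup>2 \<le> (real k)\<^sup>2" by (intro power_mono) auto
        moreover have "512 * (real N)\<^sup>2 / \<theta>\<^sup>2 \<le> (real B * real N)\<^sup>2"
        proof -
          have "512 / \<theta>\<^sup>2 \<le> 512 / e" using e e2 \<theta> by (intro divide_left_mono) auto
          then have "512 / \<theta>\<^sup>2 \<le> real B * 1" using Be by linarith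
          also have "\<dots> \<le> real B * real B" using B4 by (intro mult_left_mono) auto
          finally have "512 / \<theta>\<^sup>2 * (real N)\<^sup>2 \<le> real B * real B * (real N)\<^sup>2" by (intro mult_right_mono) auto
          then show ?thesis by (simp add: power2_eq_square mult_ac)
        qed
        ultimately have "512 * (real N)\<^sup>2 / \<theta>\<^sup>2 \<le> (real k)\<^sup>2" by (rule order_trans[rotated])
        then have "8 * (64 * (real N)\<^sup>2 / \<theta>\<^sup>2) \<le> (real k)\<^sup>2" by simp
        then have "2 * t \<le> ?z k" using tbound z4 by linarith
        then show "t / ?z k \<le> 1 / 2" using zk by simp
      qed
      have "(\<Prod>k\<in>{N<..n}. 1 - t / p k) = (\<Prod>k\<in>{N<..K}. 1 - t / p k) * (\<Prod>k\<in>{K<..n}. 1 - t / p k)"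
      proof -
        have "{N<..n} = {N<..K} \<union> {K<..n}" using NM KM n by auto
        then show ?thesis by (simp add: prod.union_disjoint)
      qed
      also have "\<dots> \<le> (\<Prod>k\<in>{N<..K}. 1 - t / p k) * 1"
      proof (intro mult_left_mono prod_le_1 prod_nonneg)
        fix k assume "k \<in> {K<..n}"
        then show "0 \<le> 1 - t / p k \<and> 1 - t / p k \<le> 1" using NM by (intro f) auto
      next
        fix k assume "k \<in> {N<..K}"
        then show "0 \<le> 1 - t / p k" using KM n by (intro f[THEN conjunct1]) auto
      qed
      also have "(\<Prod>k\<in>{N<..K}. 1 - t / p k) * 1 \<le> (\<Prod>k\<in>{N<..K}. 1 - t / ?z k) * (\<Prod>k\<in>{K<..M}. 1 - t / ?z k)"
        unfolding mult_1_right
      proof (rule prod_compare)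
        fix k assume k: "k \<in> {N<..K}"
        have kn: "k \<in> {N<..n}" "k \<in> {N<..M}" using k KM n by auto
        have "p k \<le> \<theta> * ?z k" by (rule pz[OF k])
        also have "\<dots> \<le> 1 * ?z k" using \<theta> zpos[OF kn(2)] by (intro mult_right_mono) auto
        finally have "p k \<le> ?z k" by simp
        then have "t / ?z k \<le> t / p k" using t0 ppos[OF kn(1)] by (intro divide_left_mono mult_pos_pos zpos kn) auto
        then show "0 \<le> t / ?z k \<and> t / ?z k \<le> t / p k \<and> t / p k \<le> 1"
          using t0 zpos[OF kn(2)] f[OF kn(1)] by auto
      next
        fix k assume k: "k \<in> {K<..M}"
        then show "0 \<le> t / ?z k \<and> t / ?z k \<le> 1 / 2" using wle[OF k] t0 by auto
      next
        have "(\<Sum>k\<in>{K<..M}. t / ?z k) \<le> (\<Sum>k\<in>{K<..M}. 4 * t * (1 / (real k)\<^sup>2))"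
          by (intro sum_mono wle)
        also have "\<dots> \<le> 4 * t * (1 / real K)" unfolding sum_distrib_left[symmetric]
          using t0 NM by (intro mult_left_mono sum_inverse_squares_le) auto
        finally have "2 * (\<Sum>k\<in>{K<..M}. t / ?z k) \<le> 2 * (4 * t * (1 / real K))"
          by (rule mult_left_mono) simp
        also have "2 * (4 * t * (1 / real K)) = t * (8 / real K)" by simp
        finally have J: "2 * (\<Sum>k\<in>{K<..M}. t / ?z k) \<le> t * (8 / real K)" .
        have "(1 - \<theta>) * (t * (\<theta>\<^sup>2 / pi\<^sup>2)) * (1 / real (Suc N) - 1 / real (Suc K)) \<le>
          (1 - \<theta>) * (t * (\<theta>\<^sup>2 / pi\<^sup>2)) * (\<Sum>k\<in>{N<..K}. 1 / (real k)\<^sup>2)"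
          using NM t0 \<theta> by (intro mult_left_mono sum_inverse_squares_ge) auto
        also have "\<dots> = (\<Sum>k\<in>{N<..K}. (1 - \<theta>) * (t * (\<theta>\<^sup>2 / pi\<^sup>2) * (1 / (real k)\<^sup>2)))"
          by (simp add: sum_distrib_left mult.assoc)
        also have "\<dots> \<le> (\<Sum>k\<in>{N<..K}. t / p k - t / ?z k)"
        proof (rule sum_mono)
          fix k assume k: "k \<in> {N<..K}"
          have kn: "k \<in> {N<..n}" "k \<in> {N<..M}" "k \<ge> n0" "real k > 0" using k KM n N by auto
          have "t / (1 / \<theta>\<^sup>2 * pi\<^sup>2 * (real k)\<^sup>2) \<le> t / p k"
            using t0 ppos[OF kn(1)] n0[OF kn(3)] kn \<theta> by (intro divide_left_mono mult_pos_pos) auto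
          then have "(1 - \<theta>) * (t * (\<theta>\<^sup>2 / pi\<^sup>2) * (1 / (real k)\<^sup>2)) \<le> (1 - \<theta>) * (t / p k)"
            using \<theta> by (intro mult_left_mono) (auto simp: divide_simps mult_ac)
          also have "\<dots> \<le> t / p k - t / ?z k"
          proof -
            have "t * p k \<le> t * (\<theta> * ?z k)" using pz[OF k] t0 by (intro mult_left_mono) auto
            then have "t / ?z k \<le> \<theta> * (t / p k)" using zpos[OF kn(2)] ppos[OF kn(1)]
              by (simp add: divide_simps mult_ac)
            then show ?thesis unfolding left_diff_distrib mult_1_left by linarith
          qed
          finally show "(1 - \<theta>) * (t * (\<theta>\<^sup>2 / pi\<^sup>2) * (1 / (real k)\<^sup>2)) \<le> t / p k - t / ?z k" .
        qed
        finally have I: "t * (e / pi\<^sup>2 * (1 / real (Suc N) - 1 / real (Suc K))) \<le> (\<Sum>k\<in>{N<..K}. t / p k - t / ?z k)"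
          by (simp add: e_def mult_ac)
        \<comment> \<open>As \<pi>^2 \<le> 16 and the bracket is at least 1 / (4 N), the gain is at
          least e / (64 N), against the cost 8 / (B N); 8 times 64 is the 512 in the hypothesis on
          \<open>B\<close>.\<close>
        have key: "8 / real K \<le> e / pi\<^sup>2 * (1 / real (Suc N) - 1 / real (Suc K))"
        proof -
          have "8 / real K = 8 / (real B * real N)" by (simp add: K_def)
          also have "\<dots> \<le> e / 16 * (1 / (4 * real N))"
          proof -
            have "512 * real N \<le> real B * e * real N" using Be' Nr by (intro mult_right_mono) auto
            then have "8 * (64 * real N) \<le> e * (real B * real N)" by (simp only: mult_ac)
            then have le: "8 * (64 * real N) / (real B * real N * (64 * real N)) \<le> e * (real B * real N) / (real B * real N * (64 * real N))"
              by (rule divide_right_mono) simp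
            have "real B > 0" "real N > 0" using B4 Nr by linarith+
            then have "8 / (real B * real N) = 8 * (64 * real N) / (real B * real N * (64 * real N))"
              and "e / 16 * (1 / (4 * real N)) = e * (real B * real N) / (real B * real N * (64 * real N))"
              by simp_all
            then show ?thesis using le by (simp only:)
          qed
          also have "\<dots> \<le> e / pi\<^sup>2 * (1 / real (Suc N) - 1 / real (Suc K))"
          proof (intro mult_mono)
            have "pi\<^sup>2 \<le> 4\<^sup>2" using pi_less_4 by (intro power_mono) auto
            then show "e / 16 \<le> e / pi\<^sup>2" using e by (intro divide_left_mono) auto
            have "1 / (2 * real N) \<le> 1 / real (Suc N)" using Nr by (intro divide_left_mono) auto
            moreover have "1 / real (Suc K) \<le> 1 / (4 * real N)" using K4 Nr by (intro divide_left_mono) auto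
            moreover have "1 / (2 * real N) - 1 / (4 * real N) = 1 / (4 * real N)" using Nr by (simp add: field_simps)
            ultimately show "1 / (4 * real N) \<le> 1 / real (Suc N) - 1 / real (Suc K)" by linarith
          qed (use e Nr in auto)
          finally show ?thesis .
        qed
        have "t * (8 / real K) \<le> t * (e / pi\<^sup>2 * (1 / real (Suc N) - 1 / real (Suc K)))"
          using t0 by (intro mult_left_mono key) auto
        then show "2 * (\<Sum>k\<in>{K<..M}. t / ?z k) \<le> (\<Sum>k\<in>{N<..K}. t / p k - t / ?z k)"
          by (rule order_trans[OF J order_trans[OF _ I]])
      qed auto
      also have "\<dots> = (\<Prod>k\<in>{N<..M}. 1 - t / ?z k)"
      proof -
        have "{N<..M} = {N<..K} \<union> {K<..M}" using NM KM by auto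
        then show ?thesis by (simp add: prod.union_disjoint)
      qed
      finally show ?thesis by (simp only: poly_node_poly)
    qed
    show ?case using NM pzN dom unfolding M_def S_def by blast
  qed
qed

end

section \<open>The limit of the Christoffel-Darboux kernels\<close>

text \<open>By the reproducing property, the last factor is the squared norm of K - q, where K is
  the kernel at \<open>y\<close>; \<open>eval_bound\<close> then evaluates K - q at
  \<open>x\<close>. This turns diagonal bounds into values off the diagonal.\<close>

lemma (in poly_inner) kernel_difference_bound:
  assumes on: "orthonormal_upto n \<phi>" and q: "degree q < n"
  shows "((\<Sum>i<n. poly (\<phi> i) x * poly (\<phi> i) y) - poly q x)\<^sup>2 \<le>
     (\<Sum>i<n. poly (\<phi> i) x * poly (\<phi> i) x) *
     ((\<Sum>i<n. poly (\<phi> i) y * poly (\<phi> i) y) - 2 * poly q y + ip q q)"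
    and "0 \<le> (\<Sum>i<n. poly (\<phi> i) y * poly (\<phi> i) y) - 2 * poly q y + ip q q"
proof -
  define K where "K = (\<Sum>i<n. smult (poly (\<phi> i) y) (\<phi> i))"
  have n: "n > 0" using q by simp
  have dK: "degree K < n" unfolding K_def using on n
    by (intro degree_sum_less) (auto simp: orthonormal_upto_def)
  have Kx: "poly K z = (\<Sum>i<n. poly (\<phi> i) z * poly (\<phi> i) y)" for z
    by (simp add: K_def poly_sum mult.commute)
  have rep: "ip r K = poly r y" if "degree r < n" for r
  proof -
    have "ip r K = (\<Sum>i<n. ip r (\<phi> i) * poly (\<phi> i) y)"
      unfolding ip_commute[of r] K_def by (simp add: ip_sum ip_smult ip_commute[of r] mult.commute)
    also have "\<dots> = poly (\<Sum>i<n. smult (ip r (\<phi> i)) (\<phi> i)) y" by (simp add: poly_sum)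
    also have "\<dots> = poly r y" using orthonormal_expansion[OF on disjI2[OF that]] by simp
    finally show ?thesis .
  qed
  have "ip (K - q) (K - q) = ip K K - 2 * ip q K + ip q q"
    by (simp add: ip_diff ip_diff_right ip_commute[of K q])
  also have "\<dots> = poly K y - 2 * poly q y + ip q q" using rep[OF dK] rep[OF q] by simp
  finally have nrm: "ip (K - q) (K - q) = (\<Sum>i<n. poly (\<phi> i) y * poly (\<phi> i) y) - 2 * poly q y + ip q q"
    by (simp add: Kx)
  then show "0 \<le> (\<Sum>i<n. poly (\<phi> i) y * poly (\<phi> i) y) - 2 * poly q y + ip q q"
    using ip_nonneg[of "K - q"] by simp
  have "degree (K - q) < n" using dK q by (rule degree_diff_less)
  from eval_bound[OF on disjI2[OF this], of x]
  show "((\<Sum>i<n. poly (\<phi> i) x * poly (\<phi> i) y) - poly q x)\<^sup>2 \<le>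
     (\<Sum>i<n. poly (\<phi> i) x * poly (\<phi> i) x) *
     ((\<Sum>i<n. poly (\<phi> i) y * poly (\<phi> i) y) - 2 * poly q y + ip q q)"
    by (simp add: nrm Kx power2_eq_square)
qed

text \<open>The limit of the Jacobi kernels when \<open>S / (4 M\<^sup>2)\<close> tends to \<open>\<gamma>\<close>: for \<open>\<gamma> = 1\<close> it is the Bessel kernel
  without the factor \<open>(x y) powr (\<nu> / 2)\<close>.\<close>

definition jlim :: "real \<Rightarrow> real \<Rightarrow> real \<Rightarrow> real \<Rightarrow> real" where
  "jlim \<nu> \<gamma> x y = (1 / (4 * \<gamma>)) powr (\<nu> + 1) * (rGamma (\<nu> + 1))\<^sup>2 * bess_int \<nu> (x / \<gamma>) (y / \<gamma>)"

lemma jlim_limit: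
  assumes nu: "\<nu> > -1" and g: "g \<longlonglongrightarrow> 1"
  shows "(\<lambda>n::nat. jlim \<nu> (g n) x y) \<longlonglongrightarrow> jlim \<nu> 1 x y"
proof -
  have "(\<lambda>n. x / g n) \<longlonglongrightarrow> x / 1" "(\<lambda>n. y / g n) \<longlonglongrightarrow> y / 1"
    by (intro tendsto_intros g; simp)+
  then show ?thesis unfolding jlim_def
    by (intro tendsto_intros bess_int_limit[OF nu] g) auto
qed

section \<open>Auxiliary factors that tend to 1 at fixed points\<close>

lemma tendsto_over_large:
  fixes M :: "nat \<Rightarrow> nat"
  assumes "f \<longlonglongrightarrow> l" "filterlim M at_top sequentially"
  shows "(\<lambda>j. f j / real (M j)) \<longlonglongrightarrow> 0"
  by (intro tendsto_divide_0[OF assms(1)] filterlim_at_top_imp_at_infinity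
       filterlim_compose[OF filterlim_real_sequentially assms(2)])

lemma eventually_le_square:
  fixes N :: "nat \<Rightarrow> nat"
  assumes c: "c > 0" and N: "filterlim N at_top sequentially" and x: "x \<longlonglongrightarrow> x0"
  shows "\<forall>\<^sub>F j in sequentially. N j \<ge> 1 \<and> x j \<le> c * (real (N j))\<^sup>2"
proof -
  have "\<forall>\<^sub>F j in sequentially. N j \<ge> nat \<lceil>max 1 ((x0 + 1) / c)\<rceil>"
    using N unfolding filterlim_at_top by (rule spec)
  moreover have "\<forall>\<^sub>F j in sequentially. x j < x0 + 1" using x by (rule order_tendstoD) simp
  ultimately show ?thesis
  proof eventually_elim
    case (elim j)
    then have N1: "real (N j) \<ge> 1" and Nx: "(x0 + 1) / c \<le> real (N j)" by (auto simp: nat_le_iff ceiling_le_iff)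
    have "x0 + 1 \<le> c * real (N j)" using Nx c by (simp add: pos_divide_le_eq mult.commute)
    also have "\<dots> \<le> c * (real (N j))\<^sup>2"
      using N1 c by (intro mult_left_mono) (auto simp: power2_eq_square)
    finally show ?case using elim N1 by simp
  qed
qed

lemma node_poly_tendsto_1:
  fixes N M :: "nat \<Rightarrow> nat"
  assumes c: "c > 0" and N: "filterlim N at_top sequentially" and x: "x \<longlonglongrightarrow> x0" and x0: "x0 > 0"
    and S: "\<And>j. S j = 4 * (real (M j))\<^sup>2 * c\<^sup>2"
  shows "(\<lambda>j. poly (node_poly (cheb_node (M j) (S j)) {N j<..M j}) (x j)) \<longlonglongrightarrow> 1"
proof -
  have "\<forall>\<^sub>F j in sequentially. x j > 0" using x x0 by (rule order_tendstoD)
  moreover have "\<forall>\<^sub>F j in sequentially. N j \<ge> 1 \<and> x j \<le> c\<^sup>2 / 4 * (real (N j))\<^sup>2"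
    using c by (intro eventually_le_square[OF _ N x]) auto
  ultimately have ev: "\<forall>\<^sub>F j in sequentially.
      1 - 4 * x j / c\<^sup>2 / real (N j) \<le> poly (node_poly (cheb_node (M j) (S j)) {N j<..M j}) (x j) \<and>
      poly (node_poly (cheb_node (M j) (S j)) {N j<..M j}) (x j) \<le> 1"
  proof eventually_elim
    case (elim j)
    have le: "x j \<le> cheb_node (M j) (S j) k" if k: "k \<in> {N j<..M j}" for k
    proof -
      have "x j \<le> c\<^sup>2 / 4 * (real (N j))\<^sup>2" using elim by simp
      also have "\<dots> \<le> c\<^sup>2 / 4 * (real k)\<^sup>2" using k by (intro mult_left_mono power_mono) auto
      also have "\<dots> \<le> cheb_node (M j) (S j) k" unfolding S using cheb_node_ge[of k "M j" c] k by simp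
      finally show ?thesis .
    qed
    from elim have "1 \<le> N j" "0 \<le> x j" by auto
    from node_poly_near_1[OF c this S le] show ?case by blast
  qed
  have "(\<lambda>j. 1 - 4 * x j / c\<^sup>2 / real (N j)) \<longlonglongrightarrow> 1 - 0"
    using c by (intro tendsto_diff tendsto_const tendsto_over_large[OF _ N, of _ "4 * x0 / c\<^sup>2"] tendsto_intros x) auto
  then have lim: "(\<lambda>j. 1 - 4 * x j / c\<^sup>2 / real (N j)) \<longlonglongrightarrow> 1" by simp
  from ev have ev1: "\<forall>\<^sub>F j in sequentially. 1 - 4 * x j / c\<^sup>2 / real (N j) \<le> poly (node_poly (cheb_node (M j) (S j)) {N j<..M j}) (x j)"
    by eventually_elim simp
  from ev have ev2: "\<forall>\<^sub>F j in sequentially. poly (node_poly (cheb_node (M j) (S j)) {N j<..M j}) (x j) \<le> 1"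
    by eventually_elim simp
  from tendsto_sandwich[OF ev1 ev2 lim tendsto_const] show ?thesis .
qed

text \<open>By Bernoulli's inequality: the exponent is at most \<open>M\<close> while x / S is of
  order 1 / M^2, so the power is 1 + O(1 / M).\<close>

lemma linear_power_tendsto_1:
  fixes M d :: "nat \<Rightarrow> nat"
  assumes c: "c > 0" and M: "filterlim M at_top sequentially" and x: "x \<longlonglongrightarrow> x0" and x0: "x0 > 0"
    and S: "\<And>j. S j = 4 * (real (M j))\<^sup>2 * c\<^sup>2" and d: "\<forall>\<^sub>F j in sequentially. d j \<le> M j"
  shows "(\<lambda>j. (1 - x j / S j) ^ d j) \<longlonglongrightarrow> 1"
proof -
  have "\<forall>\<^sub>F j in sequentially. x j > 0" using x x0 by (rule order_tendstoD)
  moreover have "\<forall>\<^sub>F j in sequentially. M j \<ge> 1 \<and> x j \<le> 4 * c\<^sup>2 * (real (M j))\<^sup>2"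
    using c by (intro eventually_le_square[OF _ M x]) auto
  ultimately have ev: "\<forall>\<^sub>F j in sequentially.
      1 - x j / (4 * c\<^sup>2) / real (M j) \<le> (1 - x j / S j) ^ d j \<and> (1 - x j / S j) ^ d j \<le> 1"
    using d
  proof eventually_elim
    case (elim j)
    have M1: "real (M j) \<ge> 1" using elim by simp
    then have S0: "S j > 0" using c by (auto simp: S)
    have xS: "x j / S j \<le> 1" "0 \<le> x j / S j" using elim S0 by (auto simp: S mult_ac)
    have "real (d j) * (x j / S j) \<le> real (M j) * (x j / S j)" using elim xS by (intro mult_right_mono) auto
    also have "\<dots> = x j / (4 * c\<^sup>2) / real (M j)" using M1 c by (simp add: S power2_eq_square)
    finally have "1 - x j / (4 * c\<^sup>2) / real (M j) \<le> 1 + real (d j) * (- (x j / S j))" by simp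
    also have "\<dots> \<le> (1 + - (x j / S j)) ^ d j" using xS by (intro Bernoulli_inequality) auto
    finally show ?case using xS by (auto intro: power_le_one)
  qed
  have "(\<lambda>j. 1 - x j / (4 * c\<^sup>2) / real (M j)) \<longlonglongrightarrow> 1 - 0"
    using c by (intro tendsto_diff tendsto_const tendsto_over_large[OF _ M, of _ "x0 / (4 * c\<^sup>2)"] tendsto_intros x) auto
  then have lim: "(\<lambda>j. 1 - x j / (4 * c\<^sup>2) / real (M j)) \<longlonglongrightarrow> 1" by simp
  from ev have ev1: "\<forall>\<^sub>F j in sequentially. 1 - x j / (4 * c\<^sup>2) / real (M j) \<le> (1 - x j / S j) ^ d j"
    by eventually_elim simp
  from ev have ev2: "\<forall>\<^sub>F j in sequentially. (1 - x j / S j) ^ d j \<le> 1"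
    by eventually_elim simp
  from tendsto_sandwich[OF ev1 ev2 lim tendsto_const] show ?thesis .
qed

text \<open>Uniform convergence on compact sets is reduced to convergence along sequences
  \<open>R j \<longlonglongrightarrow> \<infinity>\<close>, \<open>x j \<longlonglongrightarrow> x0\<close>, \<open>y j \<longlonglongrightarrow> y0\<close>.\<close>

locale bessel_seq = bessel_like p for p +
  fixes \<nu> :: real and R :: "nat \<Rightarrow> real"
  assumes nu: "\<nu> > -1" and R_lim: "filterlim R at_top sequentially"
begin

definition N :: "nat \<Rightarrow> nat" where "N j = count_upto p (R j)"

definition onp :: "nat \<Rightarrow> nat \<Rightarrow> real poly" where
  "onp j = orthonormal_poly 0 (R j) (tail_weight p \<nu> (R j))"

text \<open>The reproducing kernel proper. The weights are put back in
  \<open>CD_kernel_limit\<close>, since their product part converges separately.\<close>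

definition khat :: "nat \<Rightarrow> real \<Rightarrow> real \<Rightarrow> real" where
  "khat j x y = (\<Sum>i<N j. poly (onp j i) x * poly (onp j i) y)"

definition wnorm :: "nat \<Rightarrow> real poly \<Rightarrow> real" where
  "wnorm j q = (LBINT t:{0..R j}. poly q t * poly q t * tail_weight p \<nu> (R j) t)"

lemma N_lim: "filterlim N at_top sequentially"
  unfolding N_def[abs_def] by (rule filterlim_compose[OF count_at_top R_lim])

lemma eventually_R_pos: "\<forall>\<^sub>F j in sequentially. R j > 0"
  using R_lim by (simp add: filterlim_at_top_dense)

lemma khat_difference_bound:
  assumes "R j > 0" "degree q < N j"
  shows "(khat j x y - poly q x)\<^sup>2 \<le> khat j x x * (khat j y y - 2 * poly q y + wnorm j q)"
    and "0 \<le> khat j y y - 2 * poly q y + wnorm j q"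
proof -
  interpret W: power_weight "tail_weight p \<nu> (R j)" "R j" \<nu> by (rule power_weight_tail[OF assms(1) nu])
  note * = W.kernel_difference_bound[OF W.orthonormal_upto_orthonormal_poly assms(2)]
  show "(khat j x y - poly q x)\<^sup>2 \<le> khat j x x * (khat j y y - 2 * poly q y + wnorm j q)"
    using *(1)[of x y] by (simp only: khat_def onp_def wnorm_def W.wip_def)
  show "0 \<le> khat j y y - 2 * poly q y + wnorm j q"
    using *(2)[of y] by (simp only: khat_def onp_def wnorm_def W.wip_def)
qed

lemma khat_nonneg: "0 \<le> khat j x x"
  by (simp add: khat_def sum_nonneg)

lemma khat_reproducing:
  assumes "R j > 0" "N j \<ge> 1"
  shows "\<exists>q. degree q < N j \<and> (\<forall>z. poly q z = khat j z x) \<and> wnorm j q = khat j x x"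
proof -
  interpret W: power_weight "tail_weight p \<nu> (R j)" "R j" \<nu> by (rule power_weight_tail[OF assms(1) nu])
  have on: "W.orthonormal_upto (N j) (onp j)" unfolding onp_def by (rule W.orthonormal_upto_orthonormal_poly)
  define q where "q = (\<Sum>i<N j. smult (poly (onp j i) x) (onp j i))"
  have dq: "degree q < N j" unfolding q_def using on assms(2)
    by (intro degree_sum_less) (auto simp: W.orthonormal_upto_def)
  have "W.wip q (onp j i) = poly (onp j i) x" if "i < N j" for i
    using W.orthonormal_sum[OF on that] by (simp add: q_def W.ip_sum W.ip_smult)
  then have "W.wip q q = (\<Sum>i<N j. poly (onp j i) x * poly (onp j i) x)"
    by (subst W.orthonormal_parseval[OF on disjI2[OF dq]]) (simp add: W.ip_commute[of _ q])
  then have "wnorm j q = khat j x x" by (simp only: wnorm_def W.wip_def khat_def)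
  moreover have "poly q z = khat j z x" for z by (simp add: q_def poly_sum khat_def mult.commute)
  ultimately show ?thesis using dq by blast
qed

text \<open>\<open>upper_finite\<close> is applied to the extremal polynomial, the kernel with one
  argument at \<open>x j\<close>: both its value at \<open>x j\<close> and its squared norm are
  \<open>khat j (x j) (x j)\<close>, so one factor of it cancels.\<close>

lemma upper_limit:
  assumes \<theta>: "0 < \<theta>" "\<theta> < 1" and x: "x \<longlonglongrightarrow> x0" and x0: "x0 > 0"
  shows "\<exists>\<kappa>. \<kappa> \<longlonglongrightarrow> jlim \<nu> (\<theta> ^ 6) x0 x0 \<and> (\<forall>\<^sub>F j in sequentially. khat j (x j) (x j) \<le> \<kappa> j)"
proof -
  obtain A :: nat where A: "real A \<ge> max 1 (6 + 12 / (\<theta>\<^sup>2 * (1 - \<theta>\<^sup>2)))"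
    using real_arch_simple by blast
  then have A1: "A \<ge> 1" and A': "real A \<ge> 6 + 12 / (\<theta>\<^sup>2 * (1 - \<theta>\<^sup>2))" by auto
  define c where "c = \<theta> ^ 3"
  have c: "c > 0" using \<theta> by (simp add: c_def)
  \<comment> \<open>The maximum secures \<open>M j \<ge> 1\<close> for every \<open>j\<close>, as
    \<open>jac_kernel_limit\<close> requires; eventually \<open>M j = A * N j\<close>.\<close>
  define M where "M = (\<lambda>j. max 1 (A * N j))"
  define S where "S = (\<lambda>j. 4 * (real (M j))\<^sup>2 * c\<^sup>2)"
  define N2 where "N2 = (\<lambda>j. N j + isqrt (N j))"
  define h where "h = (\<lambda>j. poly (node_poly (cheb_node (M j) (S j)) {N2 j<..M j}) (x j))"
  define D where "D = (\<lambda>j. (1 - x j / S j) ^ isqrt (N j))"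
  define k where "k = (\<lambda>j. jac_kernel \<nu> (S j) (M j) (x j) (x j))"
  have M1: "M j \<ge> 1" for j by (simp add: M_def)
  have S0: "S j > 0" for j using M1[of j] c by (simp add: S_def)
  have "N j \<le> M j" for j using A1 by (simp add: M_def max_def)
  then have Mlim: "filterlim M at_top sequentially"
    by (intro filterlim_at_top_mono[OF N_lim]) auto
  have N2lim: "filterlim N2 at_top sequentially"
    by (rule filterlim_at_top_mono[OF N_lim]) (auto simp: N2_def)
  have k: "k \<longlonglongrightarrow> jlim \<nu> (\<theta> ^ 6) x0 x0"
    unfolding k_def jlim_def
  proof (rule jac_kernel_limit[OF nu M1 S0 Mlim _ _ x x])
    have "S j / (4 * (real (M j))\<^sup>2) = \<theta> ^ 6" for j
      using M1[of j] by (simp add: S_def c_def flip: power_mult)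
    then show "(\<lambda>j. S j / (4 * (real (M j))\<^sup>2)) \<longlonglongrightarrow> \<theta> ^ 6" by simp
  qed (use \<theta> in auto)
  have h: "h \<longlonglongrightarrow> 1" unfolding h_def
    by (rule node_poly_tendsto_1[OF c N2lim x x0]) (simp add: S_def)
  have D: "D \<longlonglongrightarrow> 1" unfolding D_def
  proof (rule linear_power_tendsto_1[OF c Mlim x x0])
    show "\<forall>\<^sub>F j in sequentially. isqrt (N j) \<le> M j"
      using isqrt_le_self \<open>\<And>j. N j \<le> M j\<close> order_trans by (intro always_eventually allI) blast
  qed (simp add: S_def)
  have er: "(\<lambda>j. err \<nu> A (N j)) \<longlonglongrightarrow> 0"
    by (rule filterlim_compose[OF err_tendsto_0[OF nu A1] N_lim])
  define \<kappa> where "\<kappa> = (\<lambda>j. k j * (1 + err \<nu> A (N j)) / (h j * D j)\<^sup>2)"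
  have "\<kappa> \<longlonglongrightarrow> jlim \<nu> (\<theta> ^ 6) x0 x0 * (1 + 0) / (1 * 1)\<^sup>2"
    unfolding \<kappa>_def by (intro tendsto_intros k er h D) auto
  then have \<kappa>: "\<kappa> \<longlonglongrightarrow> jlim \<nu> (\<theta> ^ 6) x0 x0" by simp
  have "\<forall>\<^sub>F j in sequentially. h j * D j > 0"
    by (rule order_tendstoD[OF tendsto_mult[OF h D]]) simp
  moreover have "\<forall>\<^sub>F j in sequentially. x j > 0" using x x0 by (rule order_tendstoD)
  moreover have "\<forall>\<^sub>F j in sequentially. N j \<ge> 1 \<and> x j \<le> c\<^sup>2 / 4 * (real (N j))\<^sup>2"
    using c by (intro eventually_le_square[OF _ N_lim x]) auto
  moreover note eventually_compose_filterlim[OF upper_domination[OF \<theta> A'] N_lim] eventually_R_pos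
  ultimately have "\<forall>\<^sub>F j in sequentially. khat j (x j) (x j) \<le> \<kappa> j"
  proof eventually_elim
    case (elim j)
    have MA: "M j = A * N j" using elim A1 by (simp add: M_def)
    define R' where "R' = cheb_node (M j) (S j) (N2 j)"
    have dom: "N2 j < M j" "R' \<le> p (N j)"
      "\<And>t n. t \<in> {0..R'} \<Longrightarrow> n \<ge> M j \<Longrightarrow> poly (node_poly (cheb_node (M j) (S j)) {N2 j<..M j}) t \<le> (\<Prod>k\<in>{N j<..n}. 1 - t / p k)"
      using elim(4) unfolding R'_def N2_def MA S_def c_def by blast+
    have pR: "p (N j) \<le> R j" using p_le_iff_count[of "N j" "R j"] elim by (simp add: N_def)
    have N2M: "N2 j \<in> {1..M j}" using dom elim by (auto simp: N2_def)
    have "c\<^sup>2 / 4 * (real (N j))\<^sup>2 \<le> c\<^sup>2 / 4 * (real (N2 j))\<^sup>2" by (intro mult_left_mono power_mono) (auto simp: N2_def)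
    also have "\<dots> \<le> R'" unfolding R'_def S_def using cheb_node_ge[OF N2M, of c] by simp
    finally have xR': "x j \<in> {0..R'}" using elim by auto
    have le: "(poly (node_poly (cheb_node (M j) (S j)) {N2 j<..M j}) t)\<^sup>2 \<le> tail_prod p (R j) t"
      if t: "t \<in> {0..R'}" for t
    proof (rule tail_prod_ge)
      show "0 \<le> poly (node_poly (cheb_node (M j) (S j)) {N2 j<..M j}) t"
        unfolding poly_node_poly
      proof (rule prod_nonneg)
        fix k assume k: "k \<in> {N2 j<..M j}"
        have "t \<le> cheb_node (M j) (S j) k"
          using t k N2M cheb_node_mono[OF S0, of "N2 j" k "M j" j] by (auto simp: R'_def)
        then show "0 \<le> 1 - t / cheb_node (M j) (S j) k"
          using cheb_node_pos[OF S0, of k "M j" j] k by auto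
      qed
      show "\<forall>\<^sub>F n in sequentially. poly (node_poly (cheb_node (M j) (S j)) {N2 j<..M j}) t \<le> (\<Prod>k\<in>{count_upto p (R j)<..n}. 1 - t / p k)"
        using eventually_ge_at_top[of "M j"] by eventually_elim (use dom(3)[OF t] in \<open>simp add: N_def\<close>)
    qed
    obtain q where q: "degree q < N j" "\<And>z. poly q z = khat j z (x j)" "wnorm j q = khat j (x j) (x j)"
      using khat_reproducing[of j "x j"] elim by blast
    let ?\<kappa> = "khat j (x j) (x j)"
    have R'R: "R' \<le> R j" using dom(2) pR by linarith
    have "(?\<kappa> * h j * D j)\<^sup>2 \<le>
       k j * ((1 + nik_const \<nu> (M j) * (S j / R') powr (\<nu> + 1) * (1 - R' / S j) ^ (2 * isqrt (N j))) * ?\<kappa>)"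
      using upper_finite[OF nu elim(5) S0 N2M _ R'_def R'R le q(1) xR', of "isqrt (N j)"] q(2)[of "x j"]
      unfolding q(3)[symmetric] wnorm_def by (simp add: h_def D_def k_def N2_def)
    also have "\<dots> \<le> k j * ((1 + err \<nu> A (N j)) * ?\<kappa>)"
    proof (intro mult_left_mono mult_right_mono add_left_mono khat_nonneg)
      show "nik_const \<nu> (M j) * (S j / R') powr (\<nu> + 1) * (1 - R' / S j) ^ (2 * isqrt (N j)) \<le> err \<nu> A (N j)"
        unfolding R'_def MA using elim A1 dom(1) c
        by (intro err_bound(1)[OF nu c]) (auto simp: N2_def S_def MA)
      interpret J: jacobi \<nu> "S j" by standard (use nu S0 in auto)
      show "0 \<le> k j" unfolding k_def J.jac_kernel_eq by (intro sum_nonneg) auto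
    qed
    finally have main: "?\<kappa> * (?\<kappa> * (h j * D j)\<^sup>2) \<le> ?\<kappa> * (k j * (1 + err \<nu> A (N j)))"
      by (simp add: power_mult_distrib power2_eq_square mult_ac)
    have hD: "(h j * D j)\<^sup>2 > 0" by (rule zero_less_power[OF elim(1)])
    show ?case
    proof (cases "?\<kappa> = 0")
      case True
      interpret J: jacobi \<nu> "S j" by standard (use nu S0 in auto)
      have "0 \<le> k j" unfolding k_def J.jac_kernel_eq by (intro sum_nonneg) auto
      then show ?thesis using True err_pos[OF nu A1, of "N j"] elim by (simp add: \<kappa>_def)
    next
      case False
      then have "?\<kappa> > 0" using khat_nonneg[of j "x j"] by simp
      then have "?\<kappa> * (h j * D j)\<^sup>2 \<le> k j * (1 + err \<nu> A (N j))" using main by simp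
      then show ?thesis using hD by (simp only: \<kappa>_def pos_le_divide_eq)
    qed
  qed
  then show ?thesis using \<kappa> by blast
qed

text \<open>The bound \<open>v\<close> for the squared norm of \<open>q\<close> and the value of
  \<open>q\<close> at \<open>y\<close> have the same limit, as they would coincide for a reproducing
  kernel. This is the near optimality that \<open>khat_difference_bound\<close> rewards.\<close>

lemma lower_limit:
  assumes \<theta>: "0 < \<theta>" "\<theta> < 1" and x: "x \<longlonglongrightarrow> x0" and x0: "x0 > 0" and y: "y \<longlonglongrightarrow> y0" and y0: "y0 > 0"
  shows "\<exists>q v. (\<forall>\<^sub>F j in sequentially. degree (q j) < N j \<and> wnorm j (q j) \<le> v j) \<and>
     v \<longlonglongrightarrow> jlim \<nu> ((1 / \<theta>) ^ 6) y0 y0 \<and>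
     (\<lambda>j. poly (q j) (x j)) \<longlonglongrightarrow> jlim \<nu> ((1 / \<theta>) ^ 6) x0 y0 \<and>
     (\<lambda>j. poly (q j) (y j)) \<longlonglongrightarrow> jlim \<nu> ((1 / \<theta>) ^ 6) y0 y0"
proof -
  obtain B :: nat where B: "real B \<ge> 4 + 512 / (\<theta>\<^sup>2 * (1 - \<theta>))" using real_arch_simple by blast
  obtain m :: nat where m: "real m \<ge> 1 + 1 / (1 - \<theta>)" using real_arch_simple by blast
  define A where "A = B * m"
  have "512 / (\<theta>\<^sup>2 * (1 - \<theta>)) > 0" "1 / (1 - \<theta>) > 0" using \<theta> by auto
  then have "real B > 0" "real m > 0" using B m by linarith+
  then have A1: "A \<ge> 1" by (simp add: A_def)
  define c where "c = (1 / \<theta>) ^ 3"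
  have c: "c > 0" using \<theta> by (simp add: c_def)
  define M where "M = (\<lambda>j. max 1 (A * N j))"
  define d where "d = (\<lambda>j. isqrt (N j))"
  \<comment> \<open>Giving up \<open>d\<close> degrees leaves room for the damping factor; since d /
    M \<le> 1 / sqrt N, the limit of S / (4 M0^2) is still \<open>\<gamma>\<close>.\<close>
  define M0 where "M0 = (\<lambda>j. max 1 (M j - d j))"
  define S where "S = (\<lambda>j. 4 * (real (M j))\<^sup>2 * c\<^sup>2)"
  define \<gamma> where "\<gamma> = (1 / \<theta>) ^ 6"
  have \<gamma>0: "\<gamma> > 0" using \<theta> by (simp add: \<gamma>_def)
  define h where "h = (\<lambda>j z. poly (node_poly (cheb_node (M j) (S j)) {N j<..M j}) z)"
  define D where "D = (\<lambda>j z. (1 - z / S j) ^ d j)"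
  define k where "k = (\<lambda>j z. jac_kernel \<nu> (S j) (M0 j) z (y j))"
  have M1: "M j \<ge> 1" for j by (simp add: M_def)
  have M01: "M0 j \<ge> 1" for j by (simp add: M0_def)
  have S0: "S j > 0" for j using M1[of j] c by (simp add: S_def)
  have NM: "N j \<le> M j" for j using A1 by (simp add: M_def max_def)
  have Mlim: "filterlim M at_top sequentially"
    using NM by (intro filterlim_at_top_mono[OF N_lim]) auto
  have dN: "d j \<le> N j" for j by (simp add: d_def isqrt_le_self)
  have N1: "\<forall>\<^sub>F j in sequentially. N j \<ge> 1" using N_lim unfolding filterlim_at_top by (rule spec)
  note ev_dom = eventually_compose_filterlim[OF lower_domination[OF \<theta> B m A_def] N_lim]
  have ev2: "\<forall>\<^sub>F j in sequentially. N j \<ge> 1 \<and> 2 * N j < M j \<and> M j = A * N j \<and> M0 j = M j - d j"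
    using ev_dom N1
  proof eventually_elim
    case (elim j)
    have MA: "M j = A * N j" using elim A1 by (simp add: M_def)
    have lt: "2 * N j < M j" using elim(1) unfolding MA by blast
    then have "1 \<le> M j - d j" using dN[of j] elim(2) by linarith
    then have "M0 j = M j - d j" by (simp only: M0_def max_absorb2)
    then show ?case using MA lt elim(2) by blast
  qed
  have ev3: "\<forall>\<^sub>F j in sequentially. N j \<le> M0 j"
    using ev2
  proof eventually_elim
    case (elim j)
    then show ?case using dN[of j] by linarith
  qed
  have M0lim: "filterlim M0 at_top sequentially"
    by (rule filterlim_at_top_mono[OF N_lim ev3])
  have ratio: "(\<lambda>j. real (M0 j) / real (M j)) \<longlonglongrightarrow> 1"
  proof -
    have r: "(\<lambda>n. 1 / sqrt (real n)) \<longlonglongrightarrow> 0" by real_asymp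
    have "(\<lambda>j. 1 / sqrt (real (N j))) \<longlonglongrightarrow> 0" by (rule filterlim_compose[OF r N_lim])
    then have "(\<lambda>j. 1 - 1 / sqrt (real (N j))) \<longlonglongrightarrow> 1 - 0" by (intro tendsto_diff tendsto_const)
    then have lim: "(\<lambda>j. 1 - 1 / sqrt (real (N j))) \<longlonglongrightarrow> 1" by simp
    have e1: "\<forall>\<^sub>F j in sequentially. 1 - 1 / sqrt (real (N j)) \<le> real (M0 j) / real (M j)"
      using ev2
    proof eventually_elim
      case (elim j)
      have M: "real (M j) > 0" and Nr: "real (N j) > 0" using elim by auto
      have "real (d j) / real (M j) \<le> sqrt (real (N j)) / real (N j)"
        using isqrt_le[of "N j"] NM[of j] Nr by (intro frac_le) (auto simp: d_def)
      also have "\<dots> = 1 / sqrt (real (N j))" using Nr by (simp add: real_div_sqrt field_simps)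
      finally have 1: "real (d j) / real (M j) \<le> 1 / sqrt (real (N j))" .
      have "real (M0 j) = real (M j) - real (d j)" using elim dN[of j] by (simp add: of_nat_diff)
      then have "real (M0 j) / real (M j) = 1 - real (d j) / real (M j)" using M by (simp add: diff_divide_distrib)
      then show ?case using 1 by simp
    qed
    have e2: "\<forall>\<^sub>F j in sequentially. real (M0 j) / real (M j) \<le> 1"
      using ev2
    proof eventually_elim
      case (elim j)
      have "M0 j \<le> M j" "0 < M j" using elim by linarith+
      then show ?case by (simp add: divide_le_eq_1)
    qed
    from tendsto_sandwich[OF e1 e2 lim tendsto_const] show ?thesis .
  qed
  have Slim: "(\<lambda>j. S j / (4 * (real (M0 j))\<^sup>2)) \<longlonglongrightarrow> \<gamma>"
  proof -
    have "(\<lambda>j. \<gamma> / (real (M0 j) / real (M j))\<^sup>2) \<longlonglongrightarrow> \<gamma> / 1\<^sup>2" by (intro tendsto_intros ratio) auto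
    moreover have "\<gamma> / (real (M0 j) / real (M j))\<^sup>2 = S j / (4 * (real (M0 j))\<^sup>2)" for j
      using M1[of j] M01[of j] by (simp add: S_def \<gamma>_def c_def power_divide flip: power_mult)
    ultimately show ?thesis by simp
  qed
  have klim: "(\<lambda>j. k j (z j)) \<longlonglongrightarrow> jlim \<nu> \<gamma> z0 y0" if "z \<longlonglongrightarrow> z0" for z z0
    unfolding k_def jlim_def by (rule jac_kernel_limit[OF nu M01 S0 M0lim Slim \<gamma>0 that y])
  have hlim: "(\<lambda>j. h j (z j)) \<longlonglongrightarrow> 1" if "z \<longlonglongrightarrow> z0" "z0 > 0" for z z0
    unfolding h_def by (rule node_poly_tendsto_1[OF c N_lim that]) (simp add: S_def)
  have Dlim: "(\<lambda>j. D j (z j)) \<longlonglongrightarrow> 1" if "z \<longlonglongrightarrow> z0" "z0 > 0" for z z0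
    unfolding D_def
  proof (rule linear_power_tendsto_1[OF c Mlim that])
    show "\<forall>\<^sub>F j in sequentially. d j \<le> M j"
      using dN NM order_trans by (intro always_eventually allI) blast
  qed (simp add: S_def)
  have er: "(\<lambda>j. err \<nu> A (N j)) \<longlonglongrightarrow> 0"
    by (rule filterlim_compose[OF err_tendsto_0[OF nu A1] N_lim])
  define P where "P = (\<lambda>j q. degree q < N j \<and> wnorm j q \<le> k j (y j) * (1 + sqrt (err \<nu> A (N j)))\<^sup>2 \<and>
     (\<forall>z\<in>{0..S j}. (poly q z * h j z - k j z * D j z)\<^sup>2 \<le> err \<nu> A (N j) * (\<nu> + 1) * k j (y j) / S j powr (\<nu> + 1)))"
  have "\<forall>\<^sub>F j in sequentially. \<exists>q. P j q"
    using ev_dom ev2 eventually_R_pos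
  proof eventually_elim
    case (elim j)
    have MA: "M j = A * N j" using elim by simp
    have dom: "p (N j + 1) \<le> cheb_node (M j) (S j) (N j + 1)"
      "\<And>t n. t \<in> {0..p (N j + 1)} \<Longrightarrow> n \<ge> M j \<Longrightarrow> (\<Prod>k\<in>{N j<..n}. 1 - t / p k) \<le> h j t"
      using elim(1) unfolding h_def MA S_def c_def by blast+
    have lt: "2 * N j < M j" "1 \<le> N j" using elim(2) by blast+
    have NA: "Suc (N j) \<le> A * N j" using lt unfolding MA by linarith
    have pR: "R j < p (N j + 1)" using p_le_iff_count[of "N j + 1" "R j"] by (simp add: N_def not_le[symmetric])
    have RS: "R j \<le> S j" using pR dom(1) cheb_node_range[OF S0[of j], of "M j" "N j + 1"] by auto
    have le: "tail_prod p (R j) t \<le> (h j t)\<^sup>2" if t: "t \<in> {0..R j}" for t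
    proof (rule tail_prod_le[OF t])
      have tp: "t \<in> {0..p (N j + 1)}" using t pR by auto
      show "\<forall>\<^sub>F n in sequentially. (\<Prod>k\<in>{count_upto p (R j)<..n}. 1 - t / p k) \<le> h j t"
        using eventually_ge_at_top[of "M j"] by eventually_elim (use dom(2)[OF tp] in \<open>simp add: N_def\<close>)
      have "0 \<le> (\<Prod>k\<in>{N j<..M j}. 1 - t / p k)"
        using tail_factor[OF t] by (intro prod_nonneg) (auto simp: N_def less_imp_le)
      also have "\<dots> \<le> h j t" by (rule dom(2)[OF tp]) simp
      finally show "0 \<le> h j t" .
    qed
    have "\<exists>q. degree q < N j \<and>
     (LBINT t:{0..R j}. poly q t * poly q t * tail_weight p \<nu> (R j) t) \<le> k j (y j) * (1 + sqrt (err \<nu> A (N j)))\<^sup>2 \<and>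
     (\<forall>z\<in>{0..S j}. (poly q z * poly (node_poly (cheb_node (M j) (S j)) {N j<..M j}) z - jac_kernel \<nu> (S j) (M0 j) z (y j) * (1 - z / S j) ^ d j)\<^sup>2
        \<le> err \<nu> A (N j) * (\<nu> + 1) * k j (y j) / S j powr (\<nu> + 1))"
    proof (rule lower_finite[OF nu elim(3) RS])
      show "1 \<le> N j" "N j < M j" "1 \<le> M0 j" "M0 j + d j \<le> M j" using elim M01[of j] dN[of j] by auto
      show "nik_const \<nu> (M j) * (1 - cheb_node (M j) (S j) (Suc (N j)) / S j) ^ (2 * d j) \<le> err \<nu> A (N j)"
        unfolding MA d_def using lt A1 NA by (intro err_bound(2)[OF nu c]) (auto simp: S_def MA)
      show "0 < err \<nu> A (N j)" using elim by (intro err_pos nu A1) auto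
    qed (use le in \<open>auto simp: h_def k_def\<close>)
    then show ?case unfolding P_def wnorm_def h_def k_def D_def .
  qed
  then have ev: "\<forall>\<^sub>F j in sequentially. P j (SOME q. P j q)" by eventually_elim (rule someI_ex)
  define q where "q = (\<lambda>j. SOME q. P j q)"
  define v where "v = (\<lambda>j. k j (y j) * (1 + sqrt (err \<nu> A (N j)))\<^sup>2)"
  have evP: "\<forall>\<^sub>F j in sequentially. P j (q j)" using ev by (simp only: q_def)
  have "v \<longlonglongrightarrow> jlim \<nu> \<gamma> y0 y0 * (1 + sqrt 0)\<^sup>2" unfolding v_def by (intro tendsto_intros klim y er)
  then have v: "v \<longlonglongrightarrow> jlim \<nu> \<gamma> y0 y0" by simp
  have qlim: "(\<lambda>j. poly (q j) (z j)) \<longlonglongrightarrow> jlim \<nu> \<gamma> z0 y0" if z: "z \<longlonglongrightarrow> z0" "z0 > 0" for z z0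
  proof -
    define E where "E = (\<lambda>j. sqrt (err \<nu> A (N j) * (\<nu> + 1) * k j (y j)))"
    have "E \<longlonglongrightarrow> sqrt (0 * (\<nu> + 1) * jlim \<nu> \<gamma> y0 y0)" unfolding E_def by (intro tendsto_intros klim y er)
    then have E: "E \<longlonglongrightarrow> 0" by simp
    have "\<forall>\<^sub>F j in sequentially. z j > 0" using z by (rule order_tendstoD)
    \<comment> \<open>Besides \<open>z j \<le> S j\<close> this yields \<open>S j \<ge> 1\<close>,
      which allows the denominator \<open>S j powr (\<nu> + 1)\<close> to be dropped.\<close>
    moreover have "\<forall>\<^sub>F j in sequentially. M j \<ge> 1 \<and> max 1 (z j) \<le> 4 * c\<^sup>2 * (real (M j))\<^sup>2"
      using c by (intro eventually_le_square[OF _ Mlim tendsto_max[OF tendsto_const z(1)]]) auto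
    ultimately have "\<forall>\<^sub>F j in sequentially. norm (poly (q j) (z j) * h j (z j) - k j (z j) * D j (z j)) \<le> E j"
      using evP ev2
    proof eventually_elim
      case (elim j)
      have zS: "z j \<in> {0..S j}" and S1: "S j \<ge> 1" using elim by (auto simp: S_def mult_ac)
      have "(1::real) = 1 powr (\<nu> + 1)" by simp
      also have "\<dots> \<le> S j powr (\<nu> + 1)" using S1 nu by (intro powr_mono2) auto
      finally have Sp: "1 \<le> S j powr (\<nu> + 1)" .
      interpret J: jacobi \<nu> "S j" by standard (use nu S0 in auto)
      have "0 \<le> k j (y j)" unfolding k_def J.jac_kernel_eq by (intro sum_nonneg) auto
      then have nn: "0 \<le> err \<nu> A (N j) * (\<nu> + 1) * k j (y j)"
        using nu elim err_pos[OF nu A1, of "N j"] by (intro mult_nonneg_nonneg) auto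
      have "(poly (q j) (z j) * h j (z j) - k j (z j) * D j (z j))\<^sup>2 \<le> err \<nu> A (N j) * (\<nu> + 1) * k j (y j) / S j powr (\<nu> + 1)"
        using elim(3) zS by (auto simp: P_def)
      also have "\<dots> \<le> err \<nu> A (N j) * (\<nu> + 1) * k j (y j) / 1" using nn Sp by (intro divide_left_mono) auto
      finally show ?case unfolding E_def by (simp add: real_le_rsqrt)
    qed
    then have "(\<lambda>j. poly (q j) (z j) * h j (z j) - k j (z j) * D j (z j)) \<longlonglongrightarrow> 0"
      by (rule Lim_null_comparison[OF _ E])
    moreover have "(\<lambda>j. k j (z j) * D j (z j)) \<longlonglongrightarrow> jlim \<nu> \<gamma> z0 y0 * 1" by (intro tendsto_mult klim[OF z(1)] Dlim[OF z])
    ultimately have "(\<lambda>j. (poly (q j) (z j) * h j (z j) - k j (z j) * D j (z j)) + k j (z j) * D j (z j)) \<longlonglongrightarrow> 0 + jlim \<nu> \<gamma> z0 y0 * 1"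
      by (rule tendsto_add)
    then have "(\<lambda>j. poly (q j) (z j) * h j (z j) / h j (z j)) \<longlonglongrightarrow> jlim \<nu> \<gamma> z0 y0 / 1"
      by (intro tendsto_divide hlim[OF z]) auto
    moreover have "\<forall>\<^sub>F j in sequentially. poly (q j) (z j) * h j (z j) / h j (z j) = poly (q j) (z j)"
      using order_tendstoD(1)[OF hlim[OF z], of 0, simplified] by eventually_elim simp
    ultimately show ?thesis by (auto intro: Lim_transform_eventually)
  qed
  show ?thesis unfolding \<gamma>_def[symmetric]
  proof (intro exI conjI)
    show "\<forall>\<^sub>F j in sequentially. degree (q j) < N j \<and> wnorm j (q j) \<le> v j"
      using evP by eventually_elim (simp add: P_def v_def)
  qed (fact v qlim[OF x x0] qlim[OF y y0])+
qed

text \<open>For fixed \<open>\<theta>\<close>, \<open>a\<close> and \<open>b\<close> are the limits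
  of the upper bound and of the competitor. The error in the limit is at most sqrt (a(x,x) (a(y,y) -
  b(y,y))) plus the deviation of b(x,y) from the target, and both terms vanish as \<theta> -> 1. So
  \<open>\<theta>\<close> is fixed first and \<open>j\<close> is sent to infinity
  afterwards.\<close>

lemma khat_limit:
  assumes x: "x \<longlonglongrightarrow> x0" and x0: "x0 > 0" and y: "y \<longlonglongrightarrow> y0" and y0: "y0 > 0"
  shows "(\<lambda>j. khat j (x j) (y j)) \<longlonglongrightarrow> jlim \<nu> 1 x0 y0"
proof (rule tendstoI)
  fix e :: real assume e: "e > 0"
  define \<theta> where "\<theta> = (\<lambda>n. 1 - 1 / real (n + 2))"
  have \<theta>: "0 < \<theta> n" "\<theta> n < 1" for n by (auto simp: \<theta>_def)
  have \<theta>lim: "\<theta> \<longlonglongrightarrow> 1" unfolding \<theta>_def by real_asymp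
  have t6: "(\<lambda>n. \<theta> n ^ 6) \<longlonglongrightarrow> 1" using tendsto_power[OF \<theta>lim, of 6] by simp
  have i6: "(\<lambda>n. (1 / \<theta> n) ^ 6) \<longlonglongrightarrow> 1"
    using tendsto_power[OF tendsto_divide[OF tendsto_const \<theta>lim, of 1], of 6] by simp
  define a b where "a = (\<lambda>n. jlim \<nu> (\<theta> n ^ 6))" and "b = (\<lambda>n. jlim \<nu> ((1 / \<theta> n) ^ 6))"
  have "(\<lambda>n. sqrt (a n x0 x0 * (a n y0 y0 - 2 * b n y0 y0 + b n y0 y0)) + \<bar>b n x0 y0 - jlim \<nu> 1 x0 y0\<bar>) \<longlonglongrightarrow>
    sqrt (jlim \<nu> 1 x0 x0 * (jlim \<nu> 1 y0 y0 - 2 * jlim \<nu> 1 y0 y0 + jlim \<nu> 1 y0 y0)) + \<bar>jlim \<nu> 1 x0 y0 - jlim \<nu> 1 x0 y0\<bar>"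
    unfolding a_def b_def by (intro tendsto_intros jlim_limit[OF nu] t6 i6)
  then have "(\<lambda>n. sqrt (a n x0 x0 * (a n y0 y0 - 2 * b n y0 y0 + b n y0 y0)) + \<bar>b n x0 y0 - jlim \<nu> 1 x0 y0\<bar>) \<longlonglongrightarrow> 0"
    by simp
  from order_tendstoD(2)[OF this e]
  obtain n where n: "sqrt (a n x0 x0 * (a n y0 y0 - 2 * b n y0 y0 + b n y0 y0)) + \<bar>b n x0 y0 - jlim \<nu> 1 x0 y0\<bar> < e"
    using eventually_happens'[OF sequentially_bot] by blast
  obtain \<kappa>x where \<kappa>x: "\<kappa>x \<longlonglongrightarrow> a n x0 x0" "\<forall>\<^sub>F j in sequentially. khat j (x j) (x j) \<le> \<kappa>x j"
    using upper_limit[OF \<theta> x x0, of n] unfolding a_def by blast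
  obtain \<kappa>y where \<kappa>y: "\<kappa>y \<longlonglongrightarrow> a n y0 y0" "\<forall>\<^sub>F j in sequentially. khat j (y j) (y j) \<le> \<kappa>y j"
    using upper_limit[OF \<theta> y y0, of n] unfolding a_def by blast
  obtain q v where q: "\<forall>\<^sub>F j in sequentially. degree (q j) < N j \<and> wnorm j (q j) \<le> v j"
    "v \<longlonglongrightarrow> b n y0 y0" "(\<lambda>j. poly (q j) (x j)) \<longlonglongrightarrow> b n x0 y0" "(\<lambda>j. poly (q j) (y j)) \<longlonglongrightarrow> b n y0 y0"
    using lower_limit[OF \<theta> x x0 y y0, of n] unfolding b_def by blast
  have "(\<lambda>j. sqrt (\<kappa>x j * (\<kappa>y j - 2 * poly (q j) (y j) + v j)) + \<bar>poly (q j) (x j) - jlim \<nu> 1 x0 y0\<bar>) \<longlonglongrightarrow>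
     sqrt (a n x0 x0 * (a n y0 y0 - 2 * b n y0 y0 + b n y0 y0)) + \<bar>b n x0 y0 - jlim \<nu> 1 x0 y0\<bar>"
    by (intro tendsto_intros \<kappa>x \<kappa>y q)
  from order_tendstoD(2)[OF this n] \<kappa>x(2) \<kappa>y(2) q(1) eventually_R_pos
  show "\<forall>\<^sub>F j in sequentially. dist (khat j (x j) (y j)) (jlim \<nu> 1 x0 y0) < e"
  proof eventually_elim
    case (elim j)
    have dq: "degree (q j) < N j" and wv: "wnorm j (q j) \<le> v j" using elim by auto
    have nn: "0 \<le> khat j (y j) (y j) - 2 * poly (q j) (y j) + wnorm j (q j)"
      by (rule khat_difference_bound(2)[OF elim(5) dq])
    have "(khat j (x j) (y j) - poly (q j) (x j))\<^sup>2 \<le>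
       khat j (x j) (x j) * (khat j (y j) (y j) - 2 * poly (q j) (y j) + wnorm j (q j))"
      by (rule khat_difference_bound(1)[OF elim(5) dq])
    also have "\<dots> \<le> \<kappa>x j * (\<kappa>y j - 2 * poly (q j) (y j) + v j)"
      using elim wv nn khat_nonneg[of j "x j"] by (intro mult_mono) auto
    finally have "\<bar>khat j (x j) (y j) - poly (q j) (x j)\<bar> \<le> sqrt (\<kappa>x j * (\<kappa>y j - 2 * poly (q j) (y j) + v j))"
      by (simp add: real_le_rsqrt)
    then show ?case using elim(1) unfolding dist_real_def by linarith
  qed
qed

lemma tail_prod_limit:
  assumes x: "x \<longlonglongrightarrow> x0" and x0: "x0 > 0"
  shows "(\<lambda>j. tail_prod p (R j) (x j)) \<longlonglongrightarrow> 1"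
proof -
  have "(\<lambda>j. (1 - x j / real (N j))\<^sup>2) \<longlonglongrightarrow> (1 - 0)\<^sup>2"
    by (intro tendsto_intros tendsto_over_large[OF x N_lim])
  then have lim: "(\<lambda>j. (1 - x j / real (N j))\<^sup>2) \<longlonglongrightarrow> 1" by simp
  have "(\<lambda>j. 1 - x j / real (N j)) \<longlonglongrightarrow> 1 - 0"
    by (intro tendsto_intros tendsto_over_large[OF x N_lim])
  then have "\<forall>\<^sub>F j in sequentially. 0 < 1 - x j / real (N j)" by (rule order_tendstoD) simp
  moreover have "\<forall>\<^sub>F j in sequentially. x j > 0" using x x0 by (rule order_tendstoD)
  moreover have "\<forall>\<^sub>F j in sequentially. x j < x0 + 1" using x by (rule order_tendstoD) simp
  moreover have "\<forall>\<^sub>F j in sequentially. x0 + 1 \<le> R j" using R_lim unfolding filterlim_at_top by (rule spec)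
  moreover note eventually_compose_filterlim[OF tail_prod_near_1 R_lim]
  ultimately have ev: "\<forall>\<^sub>F j in sequentially. (1 - x j / real (N j))\<^sup>2 \<le> tail_prod p (R j) (x j) \<and> tail_prod p (R j) (x j) \<le> 1"
  proof eventually_elim
    case (elim j)
    then have xR: "x j \<in> {0..R j}" by auto
    then show ?case using elim tail_prod_le_1[OF xR] unfolding N_def by auto
  qed
  from ev have ev1: "\<forall>\<^sub>F j in sequentially. (1 - x j / real (N j))\<^sup>2 \<le> tail_prod p (R j) (x j)"
    by eventually_elim simp
  from ev have ev2: "\<forall>\<^sub>F j in sequentially. tail_prod p (R j) (x j) \<le> 1"
    by eventually_elim simp
  from tendsto_sandwich[OF ev1 ev2 lim tendsto_const] show ?thesis .
qed

lemma CD_kernel_limit: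
  assumes x: "x \<longlonglongrightarrow> x0" and x0: "x0 > 0" and y: "y \<longlonglongrightarrow> y0" and y0: "y0 > 0"
  shows "(\<lambda>j. CD_kernel 0 (R j) (tail_weight p \<nu> (R j)) (count_upto p (R j)) (x j) (y j)) \<longlonglongrightarrow>
     bess_kernel_int \<nu> x0 y0"
proof -
  have "(\<lambda>j. sqrt (x j powr \<nu> * tail_prod p (R j) (x j) * (y j powr \<nu> * tail_prod p (R j) (y j))) * khat j (x j) (y j)) \<longlonglongrightarrow>
     sqrt (x0 powr \<nu> * 1 * (y0 powr \<nu> * 1)) * jlim \<nu> 1 x0 y0"
    using x0 y0 by (intro tendsto_intros x y tail_prod_limit[OF x x0] tail_prod_limit[OF y y0] khat_limit[OF x x0 y y0]) auto
  moreover have "sqrt (x0 powr \<nu> * 1 * (y0 powr \<nu> * 1)) * jlim \<nu> 1 x0 y0 = bess_kernel_int \<nu> x0 y0"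
  proof -
    have "sqrt (x0 powr \<nu> * 1 * (y0 powr \<nu> * 1)) = (x0 * y0) powr (\<nu> / 2)"
      using x0 y0 by (simp add: powr_half_sqrt[symmetric] powr_powr flip: powr_mult)
    then show ?thesis by (simp add: jlim_def bess_kernel_int_def)
  qed
  ultimately show ?thesis
    by (simp add: CD_kernel_def tail_weight_eq khat_def onp_def N_def)
qed

end

theorem theorem1p1:
  fixes p :: "nat \<Rightarrow> real" and \<nu> :: real
  assumes "\<And>n. n \<ge> 1 \<Longrightarrow> p n > 0"
    and "strict_mono_on {1..} p"
    and "(\<lambda>n. p n / (real n)\<^sup>2) \<longlonglongrightarrow> pi\<^sup>2"
    and "\<nu> > -1"
  shows "\<forall>C. compact C \<and> C \<subseteq> {0<..} \<times> {0<..} \<longrightarrow>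
           uniform_limit C
             (\<lambda>R (x, y). CD_kernel 0 R (tail_weight p \<nu> R) (count_upto p R) x y)
             (\<lambda>(x, y). Bessel_kernel \<nu> x y) at_top"
proof (intro allI impI, elim conjE)
  fix C :: "(real \<times> real) set" assume C: "compact C" "C \<subseteq> {0<..} \<times> {0<..}"
  interpret bessel_like p by standard (use assms in auto)
  let ?F = "\<lambda>R z. CD_kernel 0 R (tail_weight p \<nu> R) (count_upto p R) (fst z) (snd z)"
  let ?f = "\<lambda>z. Bessel_kernel \<nu> (fst z) (snd z)"
  have "uniform_limit C ?F ?f at_top"
  proof (rule uniform_limitI, rule ccontr)
    fix e :: real assume e: "e > 0" and not: "\<not> (\<forall>\<^sub>F R in at_top. \<forall>z\<in>C. dist (?F R z) (?f z) < e)"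
    have "\<exists>R z. R \<ge> real n \<and> z \<in> C \<and> dist (?F R z) (?f z) \<ge> e" for n
      using not unfolding eventually_at_top_linorder by (metis not_le)
    then obtain R z where Rz: "\<And>n. R n \<ge> real n" "\<And>n. z n \<in> C" "\<And>n. dist (?F (R n) (z n)) (?f (z n)) \<ge> e"
      by metis
    obtain l r where l: "l \<in> C" "strict_mono r" "(z \<circ> r) \<longlonglongrightarrow> l"
      using compact_imp_seq_compact[OF C(1)] Rz(2) unfolding seq_compact_def by metis
    have Rlim: "filterlim (R \<circ> r) at_top sequentially"
    proof (rule filterlim_at_top_mono[OF filterlim_real_sequentially])
      have "real n \<le> (R \<circ> r) n" for n
        using Rz(1)[of "r n"] seq_suble[OF l(2), of n] by (simp add: order_trans[OF _ Rz(1)[of "r n"]])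
      then show "\<forall>\<^sub>F n in sequentially. real n \<le> (R \<circ> r) n" by simp
    qed
    interpret bessel_seq p \<nu> "R \<circ> r" by standard (use assms(4) Rlim in auto)
    have pos: "fst l > 0" "snd l > 0" using l(1) C(2) by auto
    have lim: "(\<lambda>n. fst (z (r n))) \<longlonglongrightarrow> fst l" "(\<lambda>n. snd (z (r n))) \<longlonglongrightarrow> snd l"
      using tendsto_fst[OF l(3)] tendsto_snd[OF l(3)] by (simp_all add: o_def)
    have "(\<lambda>n. ?F (R (r n)) (z (r n))) \<longlonglongrightarrow> bess_kernel_int \<nu> (fst l) (snd l)"
      using CD_kernel_limit[OF lim(1) pos(1) lim(2) pos(2)] by simp
    \<comment> \<open>The target is evaluated at the moving points as well, so the continuity of the
      Bessel kernel enters here.\<close>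
    moreover have "(\<lambda>n. ?f (z (r n))) \<longlonglongrightarrow> bess_kernel_int \<nu> (fst l) (snd l)"
    proof -
      have "?f (z n) = bess_kernel_int \<nu> (fst (z n)) (snd (z n))" for n
        using Rz(2)[of n] C(2) by (intro Bessel_kernel_eq assms(4)) auto
      then show ?thesis using bess_kernel_int_limit[OF assms(4) lim pos] by simp
    qed
    ultimately have "(\<lambda>n. dist (?F (R (r n)) (z (r n))) (?f (z (r n)))) \<longlonglongrightarrow>
        dist (bess_kernel_int \<nu> (fst l) (snd l)) (bess_kernel_int \<nu> (fst l) (snd l))"
      by (rule tendsto_dist)
    then have "(\<lambda>n. dist (?F (R (r n)) (z (r n))) (?f (z (r n)))) \<longlonglongrightarrow> 0" by simp
    from order_tendstoD(2)[OF this e] obtain n where "dist (?F (R (r n)) (z (r n))) (?f (z (r n))) < e"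
      using eventually_happens'[OF sequentially_bot] by blast
    then show False using Rz(3)[of "r n"] by linarith
  qed
  then show "uniform_limit C (\<lambda>R (x, y). CD_kernel 0 R (tail_weight p \<nu> R) (count_upto p R) x y)
             (\<lambda>(x, y). Bessel_kernel \<nu> x y) at_top"
    by (simp add: case_prod_unfold)
qed

end
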